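(* Let $\mathcal{M}$ be a $d$-dimensional Riemannian manifold with a retraction $\mathrm{Retr}$ and let $f\colon\mathcal{M}\to\mathbb{R}$ be twice continuously differentiable, with pullbacks $\hat f_x = f\circ\mathrm{Retr}_x$. Assume: (A1) there is $f^*\in\mathbb{R}$ with $f(x)\ge f^*$ for all $x\in\mathcal{M}$; (A2) there are $b_1>0$, $L>0$ such that $\|\nabla\hat f_x(s)-\nabla\hat f_x(0)\|\le L\|s\|$ for all $x\in\mathcal{M}$ and all $s\in \mathrm{T}_x\mathcal{M}$ with $\|s\|\le b_1$; (A3) there are $b_2>0$, $\rho>0$ such that $\|\nabla^2\hat f_x(s)-\nabla^2\hat f_x(0)\|\le\rho\|s\|$ (operator norm) for all $x\in\mathcal{M}$ and all $s\in \mathrm{T}_x\mathcal{M}$ with $\|s\|\le b_2$; (A4) there is $\beta\ge0$ such that for all $x\in\mathcal{M}$ and all $s\in \mathrm{T}_x\mathcal{M}$ with $\|s\|=1$, the curve $\gamma_{x,s}(t)=\mathrm{Retr}_x(ts)$ satisfies $\|\gamma_{x,s}''(0)\|\le\beta$. Let $b=\min\{b_1,b_2\}$, and let $\ell\in[L,L+\rho b]$ be such that for every $x\in\mathcal{M}$ the map $\nabla\hat f_x$ is $\ell$-Lipschitz continuous on the ball $B_{x,b}(0)$. Let $x_0\in\mathcal{M}$, $0<\epsilon\le\min\{\rho/\beta^2,b^2\rho\}$ (with $\rho/\beta^2=+\infty$ if $\beta=0$), $L\ge\sqrt{\rho\epsilon}$, $\epsilon^{3/2}\le 3\sqrt{\rho}\,(f(x_0)-f^*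 )$ and $\delta\in(0,1)$. Choose $\chi>1/4$ with $$\chi\ge 4\log_2\left(2^{31}\frac{\ell^2\sqrt d\,(f(x_0)-f^* )}{\delta\sqrt\rho\,\epsilon^{5/2}}\right)$$ and such that $\mathscr{T}$ below is an integer, and set $$\eta=\frac1\ell,\qquad r=\frac{\epsilon}{400\chi^3},\qquad \mathscr{T}=\frac{\ell\chi}{\sqrt{\rho\epsilon}},\qquad \mathscr{F}=\frac{1}{50\chi^3}\sqrt{\frac{\epsilon^3}{\rho}},$$ $$T=8\max\left\{\frac{\mathscr{T}}{3},\ \frac{(f(x_0)-f^* )\mathscr{T}}{\mathscr{F}},\ \frac{f(x_0)-f^*}{\eta\epsilon^2}\right\}=O\!\left(\frac{\ell(f(x_0)-f^* )}{\epsilon^2}(\log d)^4\right).$$ Then the algorithm $\mathrm{PRGD}(x_0,\eta,r,\mathscr{T},\epsilon,T,b)$ visits at least two iterates $x_t\in\mathcal{M}$ satisfying $\|\mathrm{grad} f(x_t)\|\le\epsilon$. With probability at least $1-\delta$, at least two-thirds of those iterates are $(4\epsilon)$-second-order critical points of $f$. If $\beta=0$, then the same claim holds with $\epsilon$-second-order critical points in place of $(4\epsilon)$-second-order critical points. The algorithm uses at most $T+\mathscr{T}\le 2T$ gradient queries.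
   Context: Retraction: a smooth map $\mathrm{Retr}$ from the tangent bundle $\mathrm{T}\mathcal{M}$ to $\mathcal{M}$ whose restriction $\mathrm{Retr}_x\colon \mathrm{T}_x\mathcal{M}\to\mathcal{M}$ satisfies $\mathrm{Retr}_x(0)=x$ and $\mathrm{D}\,\mathrm{Retr}_x(0)=\mathrm{Id}$ for every $x$. The pullback $\hat f_x=f\circ\mathrm{Retr}_x$ is a function on the inner product space $\mathrm{T}_x\mathcal{M}$ (Riemannian metric at $x$); $\nabla\hat f_x$, $\nabla^2\hat f_x$ are its classical gradient and Hessian. $\mathrm{grad} f$ and $\mathrm{Hess} f$ are the Riemannian gradient and Hessian (Levi-Civita connection); $\mathrm{grad} f(x)=\nabla\hat f_x(0)$. For a curve $\gamma$ on $\mathcal{M}$, $\gamma''=\frac{\mathrm{D}}{dt}\gamma'$ is its intrinsic acceleration (covariant derivative of the velocity along the curve). $\lambda_{\min}$ is the smallest eigenvalue. With $\rho$ the constant in (A3), a point $x\in\mathcal{M}$ is an $\varepsilon$-second-order critical point of $f$ if $\|\mathrm{grad} f(x)\|\le\varepsilon$ and $\lambda_{\min}(\mathrm{Hess} f(x))\ge-\sqrt{\rho\varepsilon}$. $B_{x,r}(s)=\{\dot s\in \mathrm{T}_x\mathcal{M}:\|\dot s-s\|_x\le r\}$, and $\mathrm{Uniform}(B_{x,r}(s))$ is the uniform distribution on it. The value $b=+\infty$ is allowed. Procedure $\mathrm{TangentSpaceSteps}(x,s_0,\eta,b,\mathscr{T})$: for $j=0,1,\dots,\mathscr{T}-1$,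 set $s_{j+1}=s_j-\eta\nabla\hat f_x(s_j)$; if $\|s_{j+1}\|\ge b$, set instead $s_{\mathscr{T}}=s_j-\alpha\eta\nabla\hat f_x(s_j)$, where $\alpha\in(0,1]$ is such that $\|s_j-\alpha\eta\nabla\hat f_x(s_j)\|=b$, and exit the loop. Return $\mathrm{Retr}_x(s_{\mathscr{T}})$. Algorithm $\mathrm{PRGD}(x_0,\eta,r,\mathscr{T},\epsilon,T,b)$: set $t=0$. While $t\le T$: if $\|\mathrm{grad} f(x_t)\|>\epsilon$, set $x_{t+1}=\mathrm{TangentSpaceSteps}(x_t,0,\eta,b,1)$ and increase $t$ by $1$; otherwise draw $\xi\sim\mathrm{Uniform}(B_{x_t,r}(0))$ (fresh, independent randomness), set $s_0=\eta\xi$, set $x_{t+\mathscr{T}}=\mathrm{TangentSpaceSteps}(x_t,s_0,\eta,b,\mathscr{T})$ and increase $t$ by $\mathscr{T}$. The iterates visited are the points $x_t$ at which the body of the while-loop is executed. Gradient queries are counted by the counter $t$: one for each step $x_t\mapsto x_{t+1}$ and $\mathscr{T}$ for each perturbed round $x_t\mapsto x_{t+\mathscr{T}}$. In the $O(\cdot)$ expression for $T$, $\chi$ is understood to be of the order of its lower bound, and logarithmic factors in $\ell$, $f(x_0)-f^*$, $1/\delta$, $1/\rho$, $1/\epsilon$ are suppressed. *)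

theory Defs
  imports "HOL-Probability.Probability"
begin

text \<open>
  Manifolds are modelled on a Euclidean space \<open>'e\<close>, so the dimension is \<open>DIM('e)\<close>; the points
  form the whole type \<open>'m\<close>.  As in Lean's mathlib, every point \<open>x\<close> has a preferred chart, and
  the tangent space at \<open>x\<close> is \<open>'e\<close>: a tangent vector at \<open>x\<close> is represented by its coordinates
  in the preferred chart at \<open>x\<close>.  The norm that the type \<open>'e\<close> carries plays no role; lengths
  of tangent vectors are always measured with the Riemannian metric.
\<close>

section \<open>Smooth maps between Euclidean spaces\<close>

text \<open>Only meaningful on open sets \<open>S\<close>.\<close>

primrec Ck_on :: "nat \<Rightarrow> ('a::euclidean_space \<Rightarrow> 'b::real_normed_vector) \<Rightarrow> 'a set \<Rightarrow> bool" where
  "Ck_on 0 F S \<longleftrightarrow> continuous_on S F"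
| "Ck_on (Suc k) F S \<longleftrightarrow>
     (\<forall>x\<in>S. F differentiable (at x)) \<and>
     (\<forall>v. Ck_on k (\<lambda>x. frechet_derivative F (at x) v) S)"

definition smooth_on :: "('a::euclidean_space \<Rightarrow> 'b::real_normed_vector) \<Rightarrow> 'a set \<Rightarrow> bool" where
  "smooth_on F S \<longleftrightarrow> (\<forall>k. Ck_on k F S)"


section \<open>Riemannian manifolds\<close>

type_synonym ('m, 'e) chart = "'m set \<times> ('m \<Rightarrow> 'e)"

record ('m, 'e) manifold =
  atlas :: "('m, 'e) chart set"
  chart_at :: "'m \<Rightarrow> ('m, 'e) chart"
  metric :: "'m \<Rightarrow> 'e \<Rightarrow> 'e \<Rightarrow> real"

definition chart_image :: "('m, 'e) chart \<Rightarrow> 'e set" where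
  "chart_image c = snd c ` fst c"

definition chart_inv :: "('m, 'e) chart \<Rightarrow> 'e \<Rightarrow> 'm" where
  "chart_inv c = inv_into (fst c) (snd c)"

definition smooth_manifold ::
  "('m::{t2_space, second_countable_topology}, 'e::euclidean_space) manifold \<Rightarrow> bool" where
  "smooth_manifold M \<longleftrightarrow>
     (\<forall>c\<in>atlas M. open (fst c) \<and> open (chart_image c) \<and>
        homeomorphism (fst c) (chart_image c) (snd c) (chart_inv c)) \<and>
     (\<forall>c\<in>atlas M. \<forall>c'\<in>atlas M.
        smooth_on (snd c' \<circ> chart_inv c) (snd c ` (fst c \<inter> fst c'))) \<and>
     (\<forall>x. chart_at M x \<in> atlas M \<and> x \<in> fst (chart_at M x))"

text \<open>Change of coordinates of a tangent vector at \<open>x\<close>, from the chart \<open>c\<close> to the chart \<open>c'\<close>.\<close>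

definition tangent_change ::
  "('m, 'e::euclidean_space) chart \<Rightarrow> ('m, 'e) chart \<Rightarrow> 'm \<Rightarrow> 'e \<Rightarrow> 'e" where
  "tangent_change c c' x = frechet_derivative (snd c' \<circ> chart_inv c) (at (snd c x))"

abbreviation to_chart ::
  "('m, 'e::euclidean_space) manifold \<Rightarrow> ('m, 'e) chart \<Rightarrow> 'm \<Rightarrow> 'e \<Rightarrow> 'e" where
  "to_chart M c x \<equiv> tangent_change (chart_at M x) c x"

abbreviation from_chart ::
  "('m, 'e::euclidean_space) manifold \<Rightarrow> ('m, 'e) chart \<Rightarrow> 'm \<Rightarrow> 'e \<Rightarrow> 'e" where
  "from_chart M c x \<equiv> tangent_change c (chart_at M x) x"

definition metric_in_chart ::
  "('m, 'e::euclidean_space) manifold \<Rightarrow> ('m, 'e) chart \<Rightarrow> 'e \<Rightarrow> 'e \<Rightarrow> 'e \<Rightarrow> real" where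
  "metric_in_chart M c p u v =
     (let x = chart_inv c p in metric M x (from_chart M c x u) (from_chart M c x v))"

definition is_inner_product :: "('e::real_vector \<Rightarrow> 'e \<Rightarrow> real) \<Rightarrow> bool" where
  "is_inner_product B \<longleftrightarrow>
     bilinear B \<and> (\<forall>u v. B u v = B v u) \<and> (\<forall>v. v \<noteq> 0 \<longrightarrow> B v v > 0)"

definition riemannian_manifold ::
  "('m::{t2_space, second_countable_topology}, 'e::euclidean_space) manifold \<Rightarrow> bool" where
  "riemannian_manifold M \<longleftrightarrow>
     smooth_manifold M \<and>
     (\<forall>x. is_inner_product (metric M x)) \<and>
     (\<forall>c\<in>atlas M. \<forall>u v. smooth_on (\<lambda>p. metric_in_chart M c p u v) (chart_image c))"

definition tnorm :: "('m, 'e) manifold \<Rightarrow> 'm \<Rightarrow> 'e \<Rightarrow> real" where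
  "tnorm M x v = sqrt (metric M x v v)"

definition tball :: "('m, 'e::real_vector) manifold \<Rightarrow> 'm \<Rightarrow> real \<Rightarrow> 'e \<Rightarrow> 'e set" where
  "tball M x r s = {v. tnorm M x (v - s) \<le> r}"

text \<open>Operator norm of a linear map on the tangent space at \<open>x\<close> (compare \<open>onorm\<close>).\<close>

definition tonorm :: "('m, 'e::real_vector) manifold \<Rightarrow> 'm \<Rightarrow> ('e \<Rightarrow> 'e) \<Rightarrow> real" where
  "tonorm M x A = (SUP v. tnorm M x (A v) / tnorm M x v)"

text \<open>
  The Levi-Civita connection.  In a chart, any affine connection differentiates a vector field
  \<open>W\<close> in direction \<open>v\<close> at \<open>p\<close> by \<open>DW(p) v + \<Gamma> v (W p)\<close>, with \<open>\<Gamma>\<close> bilinear (depending on \<open>p\<close>).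
  The Levi-Civita connection is the unique one that is torsion-free (\<open>\<Gamma>\<close> is symmetric) and
  compatible with the metric (\<open>D\<^sub>w \<langle>U, V\<rangle> = \<langle>\<nabla>\<^sub>w U, V\<rangle> + \<langle>U, \<nabla>\<^sub>w V\<rangle>\<close>, written out below
  for fields \<open>U\<close>, \<open>V\<close> that are constant in the chart).
\<close>

definition levi_civita ::
  "('m, 'e::euclidean_space) manifold \<Rightarrow> ('m, 'e) chart \<Rightarrow> 'e \<Rightarrow> 'e \<Rightarrow> 'e \<Rightarrow> 'e" where
  "levi_civita M c p = (THE \<Gamma>.
     bilinear \<Gamma> \<and>
     (\<forall>u v. \<Gamma> u v = \<Gamma> v u) \<and>
     (\<forall>u v w. frechet_derivative (\<lambda>q. metric_in_chart M c q u v) (at p) w =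
        metric_in_chart M c p (\<Gamma> w u) v + metric_in_chart M c p u (\<Gamma> w v)))"

definition covariant_deriv ::
  "('m, 'e::euclidean_space) manifold \<Rightarrow> ('m \<Rightarrow> 'e) \<Rightarrow> 'm \<Rightarrow> 'e \<Rightarrow> 'e" where
  "covariant_deriv M W x v =
     (let c = chart_at M x in
        frechet_derivative (\<lambda>p. to_chart M c (chart_inv c p) (W (chart_inv c p))) (at (snd c x)) v
        + levi_civita M c (snd c x) v (W x))"

definition velocity ::
  "('m, 'e::euclidean_space) manifold \<Rightarrow> (real \<Rightarrow> 'm) \<Rightarrow> real \<Rightarrow> 'e" where
  "velocity M \<gamma> t = vector_derivative (\<lambda>\<tau>. snd (chart_at M (\<gamma> t)) (\<gamma> \<tau>)) (at t)"

text \<open>Covariant derivative along the curve \<open>\<gamma>\<close> of a field \<open>V\<close> with \<open>V t\<close> tangent at \<open>\<gamma> t\<close>.\<close>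

definition covariant_deriv_along ::
  "('m, 'e::euclidean_space) manifold \<Rightarrow> (real \<Rightarrow> 'm) \<Rightarrow> (real \<Rightarrow> 'e) \<Rightarrow> real \<Rightarrow> 'e" where
  "covariant_deriv_along M \<gamma> V t =
     (let c = chart_at M (\<gamma> t) in
        vector_derivative (\<lambda>\<tau>. to_chart M c (\<gamma> \<tau>) (V \<tau>)) (at t)
        + levi_civita M c (snd c (\<gamma> t)) (velocity M \<gamma> t) (V t))"

definition intrinsic_acceleration ::
  "('m, 'e::euclidean_space) manifold \<Rightarrow> (real \<Rightarrow> 'm) \<Rightarrow> real \<Rightarrow> 'e" where
  "intrinsic_acceleration M \<gamma> = covariant_deriv_along M \<gamma> (velocity M \<gamma>)"


section \<open>Functions, retractions and pullbacks\<close>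

definition C2_function :: "('m, 'e::euclidean_space) manifold \<Rightarrow> ('m \<Rightarrow> real) \<Rightarrow> bool" where
  "C2_function M f \<longleftrightarrow> (\<forall>c\<in>atlas M. Ck_on 2 (f \<circ> chart_inv c) (chart_image c))"

text \<open>Gradient of \<open>F\<close> at \<open>s\<close> with respect to the inner product \<open>B\<close>.\<close>

definition gradient_wrt ::
  "('e::euclidean_space \<Rightarrow> 'e \<Rightarrow> real) \<Rightarrow> ('e \<Rightarrow> real) \<Rightarrow> 'e \<Rightarrow> 'e" where
  "gradient_wrt B F s = (THE u. \<forall>w. B u w = frechet_derivative F (at s) w)"

definition rgrad :: "('m, 'e::euclidean_space) manifold \<Rightarrow> ('m \<Rightarrow> real) \<Rightarrow> 'm \<Rightarrow> 'e" where
  "rgrad M f x =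
     gradient_wrt (metric M x) (f \<circ> chart_inv (chart_at M x)) (snd (chart_at M x) x)"

definition rHess :: "('m, 'e::euclidean_space) manifold \<Rightarrow> ('m \<Rightarrow> real) \<Rightarrow> 'm \<Rightarrow> 'e \<Rightarrow> 'e" where
  "rHess M f x v = covariant_deriv M (rgrad M f) x v"

definition min_eigenvalue :: "('e::real_vector \<Rightarrow> 'e) \<Rightarrow> real" where
  "min_eigenvalue A = Min {l. \<exists>v. v \<noteq> 0 \<and> A v = l *\<^sub>R v}"

definition second_order_critical ::
  "('m, 'e::euclidean_space) manifold \<Rightarrow> ('m \<Rightarrow> real) \<Rightarrow> real \<Rightarrow> real \<Rightarrow> 'm \<Rightarrow> bool" where
  "second_order_critical M f \<rho> \<epsilon> x \<longleftrightarrow>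
     tnorm M x (rgrad M f x) \<le> \<epsilon> \<and> min_eigenvalue (rHess M f x) \<ge> - sqrt (\<rho> * \<epsilon>)"

text \<open>
  Smoothness is that of a map on the tangent bundle: a chart \<open>c\<close> identifies the part of the bundle
  over its domain with pairs \<open>(p, w)\<close> of coordinates.  Openness of \<open>D\<close> expresses continuity.
\<close>

definition retraction_on_manifold ::
  "('m, 'e::euclidean_space) manifold \<Rightarrow> ('m \<Rightarrow> 'e \<Rightarrow> 'm) \<Rightarrow> bool" where
  "retraction_on_manifold M R \<longleftrightarrow>
     (\<forall>c\<in>atlas M. \<forall>c'\<in>atlas M.
        let \<Phi> = (\<lambda>(p, w). R (chart_inv c p) (from_chart M c (chart_inv c p) w));
            D = {(p, w). p \<in> chart_image c \<and> \<Phi> (p, w) \<in> fst c'}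
        in open D \<and> smooth_on (snd c' \<circ> \<Phi>) D) \<and>
     (\<forall>x. R x 0 = x \<and> ((snd (chart_at M x) \<circ> R x) has_derivative (\<lambda>v. v)) (at 0))"

definition pullback_grad ::
  "('m, 'e::euclidean_space) manifold \<Rightarrow> ('m \<Rightarrow> 'e \<Rightarrow> 'm) \<Rightarrow> ('m \<Rightarrow> real) \<Rightarrow> 'm \<Rightarrow> 'e \<Rightarrow> 'e" where
  "pullback_grad M R f x s = gradient_wrt (metric M x) (f \<circ> R x) s"

definition pullback_Hess ::
  "('m, 'e::euclidean_space) manifold \<Rightarrow> ('m \<Rightarrow> 'e \<Rightarrow> 'm) \<Rightarrow> ('m \<Rightarrow> real) \<Rightarrow> 'm \<Rightarrow> 'e \<Rightarrow> 'e \<Rightarrow> 'e"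
  where
  "pullback_Hess M R f x s = frechet_derivative (pullback_grad M R f x) (at s)"


section \<open>The algorithm\<close>

text \<open>
  The last argument is the number of steps that remain.  If the current point is inside the ball of
  radius \<open>b\<close> and the full step is not, there is exactly one admissible \<open>\<alpha>\<close>.
\<close>

primrec tangent_iterate ::
  "('m, 'e::euclidean_space) manifold \<Rightarrow> ('m \<Rightarrow> 'e \<Rightarrow> 'm) \<Rightarrow> ('m \<Rightarrow> real) \<Rightarrow> 'm
     \<Rightarrow> real \<Rightarrow> ereal \<Rightarrow> 'e \<Rightarrow> nat \<Rightarrow> 'e" where
  "tangent_iterate M R f x \<eta> b s 0 = s"
| "tangent_iterate M R f x \<eta> b s (Suc n) =
     (let g = pullback_grad M R f x s; s' = s - \<eta> *\<^sub>R g in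
      if ereal (tnorm M x s') \<ge> b
      then (let \<alpha> = (SOME \<alpha>. 0 < \<alpha> \<and> \<alpha> \<le> 1 \<and> ereal (tnorm M x (s - (\<alpha> * \<eta>) *\<^sub>R g)) = b)
            in s - (\<alpha> * \<eta>) *\<^sub>R g)
      else tangent_iterate M R f x \<eta> b s' n)"

definition tangent_space_steps ::
  "('m, 'e::euclidean_space) manifold \<Rightarrow> ('m \<Rightarrow> 'e \<Rightarrow> 'm) \<Rightarrow> ('m \<Rightarrow> real) \<Rightarrow> 'm
     \<Rightarrow> 'e \<Rightarrow> real \<Rightarrow> ereal \<Rightarrow> nat \<Rightarrow> 'm" where
  "tangent_space_steps M R f x s0 \<eta> b N = R x (tangent_iterate M R f x \<eta> b s0 N)"

text \<open>
  One execution.  The index \<open>k\<close> numbers the executions of the loop body: \<open>X k\<close> and \<open>t k\<close> are the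
  iterate and the counter after \<open>k\<close> of them, and \<open>\<xi> k\<close> is the perturbation drawn in the next one
  (irrelevant if none is drawn).  When the loop has been left, the state no longer changes.
\<close>

definition prgd_path ::
  "('m, 'e::euclidean_space) manifold \<Rightarrow> ('m \<Rightarrow> 'e \<Rightarrow> 'm) \<Rightarrow> ('m \<Rightarrow> real)
     \<Rightarrow> 'm \<Rightarrow> real \<Rightarrow> real \<Rightarrow> nat \<Rightarrow> real \<Rightarrow> real \<Rightarrow> ereal
     \<Rightarrow> (nat \<Rightarrow> 'm) \<Rightarrow> (nat \<Rightarrow> nat) \<Rightarrow> (nat \<Rightarrow> 'e) \<Rightarrow> bool" where
  "prgd_path M R f x0 \<eta> r N \<epsilon> T b X t \<xi> \<longleftrightarrow>
     X 0 = x0 \<and> t 0 = 0 \<and>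
     (\<forall>k. if real (t k) \<le> T
          then if tnorm M (X k) (rgrad M f (X k)) > \<epsilon>
               then X (Suc k) = tangent_space_steps M R f (X k) 0 \<eta> b 1 \<and>
                    t (Suc k) = t k + 1
               else \<xi> k \<in> tball M (X k) r 0 \<and>
                    X (Suc k) = tangent_space_steps M R f (X k) (\<eta> *\<^sub>R \<xi> k) \<eta> b N \<and>
                    t (Suc k) = t k + N
          else X (Suc k) = X k \<and> t (Suc k) = t k)"

text \<open>
  The Borel sets of the tangent bundle, generated by the sets that are open in a bundle chart
  (this suffices because the manifold is second countable).
\<close>

definition tangent_borel ::
  "('m, 'e::euclidean_space) manifold \<Rightarrow> ('m \<times> 'e) measure" where
  "tangent_borel M =
     sigma UNIV {{(x, v). x \<in> fst c \<and> (snd c x, to_chart M c x v) \<in> G} | c G.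
                   c \<in> atlas M \<and> open G}"

text \<open>
  In coordinates, the volume measure of an inner product on the tangent space is a constant multiple
  of Lebesgue measure, and the constant cancels when normalising.
\<close>

definition uniform_tball ::
  "('m, 'e::euclidean_space) manifold \<Rightarrow> 'm \<Rightarrow> real \<Rightarrow> 'e \<Rightarrow> 'e measure" where
  "uniform_tball M x r s = uniform_measure lborel (tball M x r s)"

text \<open>
  A randomised run on a probability space \<open>P\<close>.  \<open>F k\<close> is the history before the \<open>(k + 1)\<close>-st
  execution of the loop body.  The draws being fresh means that, given the history, \<open>\<xi> k\<close> is
  uniform on the ball in the tangent space at the current iterate \<open>X k\<close>, whenever a draw is made.
\<close>

definition prgd_run ::
  "('m::{t2_space, second_countable_topology}, 'e::euclidean_space) manifold
     \<Rightarrow> ('m \<Rightarrow> 'e \<Rightarrow> 'm) \<Rightarrow> ('m \<Rightarrow> real)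
     \<Rightarrow> 'm \<Rightarrow> real \<Rightarrow> real \<Rightarrow> nat \<Rightarrow> real \<Rightarrow> real \<Rightarrow> ereal
     \<Rightarrow> 'w measure \<Rightarrow> (nat \<Rightarrow> 'w measure)
     \<Rightarrow> (nat \<Rightarrow> 'w \<Rightarrow> 'm) \<Rightarrow> (nat \<Rightarrow> 'w \<Rightarrow> nat) \<Rightarrow> (nat \<Rightarrow> 'w \<Rightarrow> 'e) \<Rightarrow> bool" where
  "prgd_run M R f x0 \<eta> r N \<epsilon> T b P F X t \<xi> \<longleftrightarrow>
     prob_space P \<and>
     (\<forall>k. subalgebra P (F k) \<and> subalgebra (F (Suc k)) (F k)) \<and>
     (\<forall>k. X k \<in> F k \<rightarrow>\<^sub>M borel) \<and>
     (\<forall>k. (\<lambda>\<omega>. (X k \<omega>, \<xi> k \<omega>)) \<in> F (Suc k) \<rightarrow>\<^sub>M tangent_borel M) \<and>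
     (\<forall>\<omega>\<in>space P.
        prgd_path M R f x0 \<eta> r N \<epsilon> T b (\<lambda>k. X k \<omega>) (\<lambda>k. t k \<omega>) (\<lambda>k. \<xi> k \<omega>)) \<and>
     (\<forall>k. \<forall>C\<in>sets (tangent_borel M). AE \<omega> in P.
        real (t k \<omega>) \<le> T \<and> tnorm M (X k \<omega>) (rgrad M f (X k \<omega>)) \<le> \<epsilon> \<longrightarrow>
        real_cond_exp P (F k) (\<lambda>\<omega>'. indicator C (X k \<omega>', \<xi> k \<omega>')) \<omega> =
          measure (uniform_tball M (X k \<omega>) r 0) {v. (X k \<omega>, v) \<in> C})"

text \<open>Indices of the visited iterates (those entering the loop body) with small gradient.\<close>

definition low_gradient_visits ::
  "('m, 'e::euclidean_space) manifold \<Rightarrow> ('m \<Rightarrow> real) \<Rightarrow> real \<Rightarrow> real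
     \<Rightarrow> (nat \<Rightarrow> 'm) \<Rightarrow> (nat \<Rightarrow> nat) \<Rightarrow> nat set" where
  "low_gradient_visits M f \<epsilon> T X t =
     {k. real (t k) \<le> T \<and> tnorm M (X k) (rgrad M f (X k)) \<le> \<epsilon>}"


section \<open>Parameters\<close>

text \<open>The letter \<open>l\<close> is the Lipschitz constant of the pullback gradients, and \<open>\<Delta>\<close> stands for \<open>f(x\<^sub>0) - f\<^sup>*\<close>.\<close>

definition chi_bound :: "nat \<Rightarrow> real \<Rightarrow> real \<Rightarrow> real \<Rightarrow> real \<Rightarrow> real \<Rightarrow> real" where
  "chi_bound d l \<rho> \<epsilon> \<delta> \<Delta> =
     4 * log 2 (2 ^ 31 * (l\<^sup>2 * sqrt (real d) * \<Delta>) / (\<delta> * sqrt \<rho> * \<epsilon> powr (5 / 2)))"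

definition round_length :: "real \<Rightarrow> real \<Rightarrow> real \<Rightarrow> real \<Rightarrow> real" where
  "round_length l \<rho> \<epsilon> chi = l * chi / sqrt (\<rho> * \<epsilon>)"

definition round_decrease :: "real \<Rightarrow> real \<Rightarrow> real \<Rightarrow> real" where
  "round_decrease \<rho> \<epsilon> chi = 1 / (50 * chi ^ 3) * sqrt (\<epsilon> ^ 3 / \<rho>)"

definition horizon :: "real \<Rightarrow> real \<Rightarrow> real \<Rightarrow> real \<Rightarrow> real \<Rightarrow> real" where
  "horizon l \<rho> \<epsilon> chi \<Delta> =
     8 * max (round_length l \<rho> \<epsilon> chi / 3)
        (max (\<Delta> * round_length l \<rho> \<epsilon> chi / round_decrease \<rho> \<epsilon> chi)
             (\<Delta> / ((1 / l) * \<epsilon>\<^sup>2)))"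

end

theory Submission
  imports Defs
begin

text \<open>
  On each tangent space the pullback \<open>f \<circ> R x\<close> is an ordinary function on an inner product space.
  Gradient descent with step \<open>1 / l\<close> obeys \<open>\<parallel>z - s\<parallel>\<^sup>2 \<le> (2 n / l) (f s - f z)\<close> after \<open>n\<close> steps
  (improve or localize), so a perturbed round that fails to decrease \<open>f\<close> by \<open>\<F>\<close> never leaves a
  small ball.  In that ball the gradient is almost linear.  If the Hessian at the centre has
  an eigenvalue below \<open>- sqrt (\<rho> \<epsilon>)\<close>, two runs whose starting points differ along its bottom
  eigenvector therefore separate exponentially, and the perturbations for which the round stays
  localized form a set that is exponentially thin in this direction.  Its volume is
  compared with that of the ball by packing disjoint translates.  This loses a factor of the order of
  \<open>sqrt d\<close> against integration over slices, and so does a union bound over all indices up to \<open>T\<close>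
  instead of over the perturbed rounds; both losses are absorbed by the exponential gain, since
  the factor \<open>4\<close> in the lower bound for \<open>chi\<close> makes \<open>2 powr chi\<close> as large as the fourth power of the
  argument of the logarithm.

  The Hessians of \<open>f\<close> and of the pullback differ by the pairing of the gradient with the acceleration of
  the retraction curves, which is at most \<open>\<beta> \<epsilon>\<close>.  Hence every low-gradient visit at a point that is not critical
  decreases \<open>f\<close> by \<open>\<F>\<close>, off an event of probability \<open>\<delta>\<close>, while all other visits increase it by at
  most \<open>\<F> / 4\<close>; the budget \<open>f x0 - fstar\<close> then leaves room for at most one third of such visits.

  The measure of a non-measurable set is \<open>0\<close>, so the events have to be shown measurable: the
  set of critical points is closed because the Hessian is a tensor, continuous in every chart.
\<close>

section \<open>Inner products\<close>

text \<open>How the constants fit. The round length makes \<open>N\<close> times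
  \<open>p * e / l\<close> equal to \<open>chi\<close>, so the unstable direction is amplified by at
  least \<open>2 powr chi\<close>. The radius \<open>m\<close> makes \<open>N\<close> times
  \<open>\<rho> * m / l\<close> equal to 1/3, so the accumulated linearization error is at most half
  of the linear part. A draw costs at most F/4, hence a successful round has to lower the pullback
  by 5/4 F from its perturbed start, and \<open>S\<close> bounds the localization radius for that
  drop. The 4 in 4 \<epsilon> doubles the curvature to 2 sqrt (\<rho> \<epsilon>), of which \<beta>
  \<epsilon> takes at most half. If at least a third of the low-gradient visits succeeded, each
  visit would gain F/6 on average; these visits would then take at most 3/4 and the high-gradient
  steps at most 1/4 of \<open>T\<close>, which contradicts the exit from the loop. A recurring
  obstacle: tangent vectors are coordinates in the preferred chart of their base point, and this
  chart may jump from point to point. Regularity in the base point is therefore always stated in one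
  fixed chart.\<close>

lemma psd_cauchy_schwarz:
  fixes Q :: "'a::real_vector \<Rightarrow> 'a \<Rightarrow> real"
  assumes bil: "bilinear Q" and sym: "\<And>u v. Q u v = Q v u" and psd: "\<And>v. Q v v \<ge> 0"
  shows "(Q u v)\<^sup>2 \<le> Q u u * Q v v"
proof -
  have exp: "0 \<le> Q u u - 2 * t * Q u v + t\<^sup>2 * Q v v" for t
  proof -
    have "Q (u - t *\<^sub>R v) (u - t *\<^sub>R v) = Q u u - 2 * t * Q u v + t\<^sup>2 * Q v v"
      using sym[of v u] by (simp add: bilinear_lsub[OF bil] bilinear_rsub[OF bil] bilinear_lmul[OF bil]
          bilinear_rmul[OF bil] power2_eq_square algebra_simps)
    then show ?thesis using psd[of "u - t *\<^sub>R v"] by simp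
  qed
  show ?thesis
  proof (cases "Q v v = 0")
    case True
    have "Q u v = 0"
    proof (rule ccontr)
      assume n: "Q u v \<noteq> 0"
      \<comment> \<open>With Q v v = 0 the expression is affine in t; this value of t makes it
        -1.\<close>
      have "0 \<le> Q u u - 2 * ((Q u u + 1) / (2 * Q u v)) * Q u v"
        using exp[of "(Q u u + 1) / (2 * Q u v)"] True by simp
      then show False using n by (simp add: field_simps)
    qed
    then show ?thesis by (simp add: True)
  next
    case False
    then have p: "Q v v > 0" using psd[of v] by linarith
    have "0 \<le> (Q u u - 2 * (Q u v / Q v v) * Q u v + (Q u v / Q v v)\<^sup>2 * Q v v) * Q v v"
      using exp[of "Q u v / Q v v"] p by simp
    also have "\<dots> = Q u u * Q v v - (Q u v)\<^sup>2"
      using p by (simp add: field_simps power2_eq_square)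
    finally show ?thesis by simp
  qed
qed

text \<open>The metric at a point is an arbitrary inner product, unrelated to the norm of the type.
  Compactness and continuity are transferred between the two through the norm equivalence
  \<open>nrm_lower\<close>, \<open>nrm_upper\<close>.\<close>

locale inner_form =
  fixes B :: "'e::euclidean_space \<Rightarrow> 'e \<Rightarrow> real"
  assumes inner: "is_inner_product B"
begin

definition nrm :: "'e \<Rightarrow> real" where "nrm v = sqrt (B v v)"

lemma bil: "bilinear B" and sym: "B u v = B v u"
  using inner by (auto simp: is_inner_product_def)

lemma pos: "v \<noteq> 0 \<Longrightarrow> B v v > 0"
  using inner by (auto simp: is_inner_product_def)

lemmas B_simps [simp] = bilinear_ladd[OF bil] bilinear_radd[OF bil] bilinear_lsub[OF bil]
  bilinear_rsub[OF bil] bilinear_lmul[OF bil] bilinear_rmul[OF bil] bilinear_lzero[OF bil]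
  bilinear_rzero[OF bil] bilinear_lneg[OF bil] bilinear_rneg[OF bil]

lemma nonneg: "B v v \<ge> 0"
  using pos[of v] by (cases "v = 0") auto

lemma nrm_sq: "(nrm v)\<^sup>2 = B v v" and nrm_nonneg [simp]: "nrm v \<ge> 0"
  using nonneg by (auto simp: nrm_def)

lemma nrm_zero [simp]: "nrm 0 = 0"
  by (simp add: nrm_def)

lemma nrm_eq_0 [simp]: "nrm v = 0 \<longleftrightarrow> v = 0"
  using pos[of v] by (cases "v = 0") (auto simp: nrm_def)

lemma nrm_pos: "v \<noteq> 0 \<Longrightarrow> nrm v > 0"
  using pos[of v] by (simp add: nrm_def)

lemma nrm_scale [simp]: "nrm (a *\<^sub>R v) = \<bar>a\<bar> * nrm v"
  by (simp add: nrm_def real_sqrt_mult flip: mult.assoc)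

lemma nrm_minus [simp]: "nrm (- v) = nrm v"
  by (simp add: nrm_def)

lemma cauchy_schwarz: "\<bar>B u v\<bar> \<le> nrm u * nrm v"
proof -
  have "(B u v)\<^sup>2 \<le> (nrm u * nrm v)\<^sup>2"
    using psd_cauchy_schwarz[OF bil sym nonneg, of u v] by (simp add: power_mult_distrib nrm_sq)
  then show ?thesis by (metis abs_le_square_iff abs_of_nonneg mult_nonneg_nonneg nrm_nonneg)
qed

lemma cauchy_schwarz': "B u v \<le> nrm u * nrm v"
  using cauchy_schwarz[of u v] by linarith

lemma nrm_triangle: "nrm (u + v) \<le> nrm u + nrm v"
proof (rule power2_le_imp_le)
  show "(nrm (u + v))\<^sup>2 \<le> (nrm u + nrm v)\<^sup>2"
    using cauchy_schwarz'[of u v] sym[of u v]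
    by (simp add: nrm_sq power2_sum algebra_simps)
qed simp

lemma nrm_diff_triangle: "nrm (u - w) \<le> nrm (u - v) + nrm (v - w)"
  using nrm_triangle[of "u - v" "v - w"] by simp

lemma nrm_diff: "nrm (u - v) \<le> nrm u + nrm v"
  using nrm_triangle[of u "- v"] by simp

lemma bounded_bilinear_B: "bounded_bilinear B"
  using bil bilinear_conv_bounded_bilinear by blast

lemmas continuous_on_B [continuous_intros] = bounded_bilinear.continuous_on[OF bounded_bilinear_B]
lemmas bounded_linear_B_left = bounded_bilinear.bounded_linear_left[OF bounded_bilinear_B]
lemmas bounded_linear_B_right = bounded_bilinear.bounded_linear_right[OF bounded_bilinear_B]

lemma continuous_on_nrm: "continuous_on S nrm"
  unfolding nrm_def by (intro continuous_intros)

lemma nrm_lower: "\<exists>c>0. \<forall>v. c * norm v \<le> nrm v"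
proof -
  have "\<exists>x\<in>sphere 0 1. \<forall>y\<in>sphere 0 1. nrm x \<le> nrm y"
    by (intro continuous_attains_inf continuous_on_nrm) auto
  then obtain x where x: "norm x = 1" and le: "\<And>y. norm y = 1 \<Longrightarrow> nrm x \<le> nrm y" by auto
  have "nrm x * norm v \<le> nrm v" for v
  proof (cases "v = 0")
    case False
    have "nrm x \<le> nrm ((1 / norm v) *\<^sub>R v)" using False by (intro le) simp
    then show ?thesis using False by (simp add: field_simps)
  qed simp
  moreover have "nrm x > 0" using x by (intro nrm_pos) auto
  ultimately show ?thesis by blast
qed

lemma nrm_upper: "\<exists>C>0. \<forall>v. nrm v \<le> C * norm v"
proof -
  obtain K where K: "K > 0" "\<And>a b. norm (B a b) \<le> norm a * norm b * K"
    using bounded_bilinear.pos_bounded[OF bounded_bilinear_B] by blast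
  have "nrm v \<le> sqrt K * norm v" for v
  proof -
    have "B v v \<le> K * (norm v)\<^sup>2" using K(2)[of v v] by (simp add: power2_eq_square algebra_simps)
    then have "nrm v \<le> sqrt (K * (norm v)\<^sup>2)" by (simp add: nrm_def)
    then show ?thesis by (simp add: real_sqrt_mult)
  qed
  then show ?thesis using K(1) by (intro exI[of _ "sqrt K"]) auto
qed

lemma eqI: "(\<And>w. B u w = B v w) \<Longrightarrow> u = v"
  by (metis B_simps(3) nrm_def nrm_eq_0 real_sqrt_zero right_minus_eq)

lemma riesz:
  assumes "linear h"
  shows "\<exists>u. \<forall>w. B u w = h w"
proof -
  \<comment> \<open>\<open>J u\<close> encodes the functional \<open>B u\<close> by its values on
    the basis. Nondegeneracy makes \<open>J\<close> injective, and equal dimensions make it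
    surjective.\<close>
  define J where "J u = (\<Sum>i\<in>Basis. B u i *\<^sub>R i)" for u
  have lin: "linear J" unfolding J_def
    by (intro linearI) (simp_all add: algebra_simps scaleR_sum_right flip: sum.distrib)
  have J: "J u \<bullet> i = B u i" if "i \<in> Basis" for u i
    using that by (simp add: J_def inner_sum_left inner_Basis if_distrib cong: if_cong)
  have ext: "B u w = g w" if "\<And>i. i \<in> Basis \<Longrightarrow> B u i = g i" "linear g" for u w and g :: "'e \<Rightarrow> real"
    using linear_eq_on_span[of "B u" g Basis w] that bounded_linear.linear[OF bounded_linear_B_right]
    by (auto simp: span_Basis)
  have "inj J"
  proof (rule injI)
    fix u v assume "J u = J v"
    then have "B u i = B v i" if "i \<in> Basis" for i using J that by metis
    then show "u = v"
      using ext[of u "B v"] bounded_linear.linear[OF bounded_linear_B_right] by (intro eqI) auto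
  qed
  then have "surj J" using lin linear_injective_imp_surjective by blast
  then obtain u where u: "J u = (\<Sum>i\<in>Basis. h i *\<^sub>R i)" by (metis surjD)
  have "B u i = h i" if "i \<in> Basis" for i
    using J[OF that, of u] that unfolding u
    by (simp add: inner_sum_left inner_Basis if_distrib cong: if_cong)
  then show ?thesis using ext[of u h] assms by blast
qed

lemma gradient_wrt_works:
  assumes "(F has_derivative F') (at s)"
  shows "B (gradient_wrt B F s) w = F' w"
proof -
  have F': "frechet_derivative F (at s) = F'" using assms by (metis frechet_derivative_at)
  obtain u where u: "\<forall>w. B u w = F' w"
    using riesz has_derivative_linear[OF assms] by blast
  have "gradient_wrt B F s = u"
    unfolding gradient_wrt_def F'
  proof (rule the_equality)
    show "\<forall>w. B u w = F' w" by (fact u)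
  next
    fix v assume "\<forall>w. B v w = F' w"
    then show "v = u" using u by (intro eqI) simp
  qed
  then show ?thesis using u by simp
qed

text \<open>A minimizer of the quadratic form on the compact unit sphere of \<open>B\<close> is an
  eigenvector. Instead of Lagrange multipliers: A - m I is semidefinite and its form vanishes at the
  minimizer, so by Cauchy-Schwarz the minimizer lies in the kernel.\<close>

lemma min_eigenvector:
  assumes lin: "linear A" and symA: "\<And>u v. B (A u) v = B u (A v)"
  shows "\<exists>e m. e \<noteq> 0 \<and> A e = m *\<^sub>R e \<and> (\<forall>v. m * B v v \<le> B (A v) v)"
proof -
  let ?S = "{v. nrm v = 1}"
  obtain c where c: "c > 0" "\<And>v. c * norm v \<le> nrm v" using nrm_lower by blast
  have "closed ?S" by (intro closed_Collect_eq continuous_on_nrm continuous_intros)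
  moreover have "bounded ?S"
  proof (rule boundedI)
    fix v assume "v \<in> ?S"
    then have "c * norm v \<le> 1" using c(2)[of v] by simp
    then show "norm v \<le> 1 / c" using c(1) by (simp add: field_simps)
  qed
  ultimately have comp: "compact ?S" by (simp add: compact_eq_bounded_closed)
  obtain i :: 'e where "i \<in> Basis" using nonempty_Basis by blast
  then have "i \<noteq> 0" by auto
  then have "nrm ((1 / nrm i) *\<^sub>R i) = 1" by simp
  then have ne: "?S \<noteq> {}" by blast
  have contA: "continuous_on ?S A" using lin linear_continuous_on linear_conv_bounded_linear by blast
  have "continuous_on ?S (\<lambda>v. B (A v) v)"
    by (intro continuous_intros contA)
  from continuous_attains_inf[OF comp ne this]
  obtain e where e: "nrm e = 1" and le: "\<And>v. nrm v = 1 \<Longrightarrow> B (A e) e \<le> B (A v) v" by blast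
  define m where "m = B (A e) e"
  have all: "m * B v v \<le> B (A v) v" for v
  proof (cases "v = 0")
    case False
    have "m \<le> B (A ((1 / nrm v) *\<^sub>R v)) ((1 / nrm v) *\<^sub>R v)"
      unfolding m_def using False by (intro le) simp
    also have "\<dots> = B (A v) v / (nrm v)\<^sup>2"
      by (simp add: linear_scale[OF lin] power2_eq_square)
    finally show ?thesis using pos[OF False] by (simp add: nrm_sq field_simps)
  qed (simp add: linear_0[OF lin])
  define Q where "Q u v = B (A u) v - m * B u v" for u v
  have "bilinear Q" unfolding bilinear_def Q_def
    by (auto intro!: linearI simp: linear_add[OF lin] linear_scale[OF lin] algebra_simps)
  moreover have "Q u v = Q v u" for u v unfolding Q_def by (metis sym symA)
  moreover have "Q v v \<ge> 0" for v unfolding Q_def using all[of v] by simp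
  ultimately have "(Q e v)\<^sup>2 \<le> Q e e * Q v v" for v by (rule psd_cauchy_schwarz)
  moreover have "Q e e = 0" using e nrm_sq[of e] by (simp add: Q_def m_def)
  ultimately have "Q e v = 0" for v by simp
  then have "A e = m *\<^sub>R e" by (intro eqI) (simp add: Q_def)
  moreover have "e \<noteq> 0" using e by auto
  ultimately show ?thesis using all by blast
qed

text \<open>\<open>min_eigenvalue\<close> is a \<open>Min\<close>, which is meaningful only on a
  finite set. Eigenvectors for distinct eigenvalues are orthogonal, hence independent, and
  independent sets are finite.\<close>

lemma finite_eigenvalues:
  assumes lin: "linear A" and symA: "\<And>u v. B (A u) v = B u (A v)"
  shows "finite {l. \<exists>v. v \<noteq> 0 \<and> A v = l *\<^sub>R v}" (is "finite ?E")
proof -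
  define w where "w l = (SOME v. v \<noteq> 0 \<and> A v = l *\<^sub>R v)" for l
  have w: "w l \<noteq> 0" "A (w l) = l *\<^sub>R w l" if "l \<in> ?E" for l
    using someI_ex[of "\<lambda>v. v \<noteq> 0 \<and> A v = l *\<^sub>R v"] that unfolding w_def by auto
  have orth: "B (w l) (w l') = 0" if "l \<in> ?E" "l' \<in> ?E" "l \<noteq> l'" for l l'
    using symA[of "w l" "w l'"] w(2)[OF that(1)] w(2)[OF that(2)] that(3) by simp
  have inj: "inj_on w ?E"
  proof (rule inj_onI, rule ccontr)
    fix l l' assume l: "l \<in> ?E" "l' \<in> ?E" and eq: "w l = w l'" and "l \<noteq> l'"
    then have "B (w l) (w l) = 0" using orth[OF l] by simp
    then show False using pos[OF w(1)[OF l(1)]] by simp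
  qed
  have "independent (w ` ?E)"
    unfolding dependent_def
  proof clarsimp
    fix l v assume v: "v \<noteq> 0" "A v = l *\<^sub>R v" and sp: "w l \<in> span (w ` ?E - {w l})"
    then have l: "l \<in> ?E" by auto
    have "span (w ` ?E - {w l}) \<subseteq> {y. B (w l) y = 0}"
    proof (rule span_minimal)
      show "w ` ?E - {w l} \<subseteq> {y. B (w l) y = 0}" using orth[OF l] by auto
      show "subspace {y. B (w l) y = 0}" by (auto simp: subspace_def)
    qed
    then show False using sp w(1)[OF l] pos by fastforce
  qed
  then have "finite (w ` ?E)" by (rule independent_imp_finite)
  then show ?thesis using inj finite_imageD by blast
qed

text \<open>Replaces the eigenvalue by one inequality per vector; this is the form in which Hessians
  are compared and the critical set is shown closed.\<close>

lemma min_eigenvalue_ge_iff: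
  assumes lin: "linear A" and symA: "\<And>u v. B (A u) v = B u (A v)"
  shows "c \<le> min_eigenvalue A \<longleftrightarrow> (\<forall>v. c * B v v \<le> B (A v) v)"
proof -
  let ?E = "{l. \<exists>v. v \<noteq> 0 \<and> A v = l *\<^sub>R v}"
  obtain e m where e: "e \<noteq> 0" "A e = m *\<^sub>R e" and m: "\<And>v. m * B v v \<le> B (A v) v"
    using min_eigenvector[OF assms] by blast
  have "m \<le> l" if "l \<in> ?E" for l
  proof -
    obtain v where v: "v \<noteq> 0" "A v = l *\<^sub>R v" using \<open>l \<in> ?E\<close> by auto
    then show ?thesis using m[of v] pos[of v] by simp
  qed
  then have "Min ?E = m"
    using finite_eigenvalues[OF assms] e by (intro Min_eqI) auto
  then have *: "min_eigenvalue A = m" by (simp add: min_eigenvalue_def)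
  show ?thesis
  proof
    assume "c \<le> min_eigenvalue A"
    then show "\<forall>v. c * B v v \<le> B (A v) v"
      unfolding * using m mult_right_mono[OF _ nonneg] order_trans by blast
  next
    assume "\<forall>v. c * B v v \<le> B (A v) v"
    then have "c * B e e \<le> m * B e e" using e(2)
      by (metis bilinear_lmul[OF bil] real_scaleR_def)
    then show "c \<le> min_eigenvalue A" using pos[OF e(1)] * by simp
  qed
qed

text \<open>Cauchy-Schwarz for the form <A u, v> at v = A u bounds the fourth power of the norm of A
  u by c^2 times the squared norms of u and A u.\<close>

lemma psd_nrm_le:
  assumes lin: "linear A" and symA: "\<And>u v. B (A u) v = B u (A v)"
    and psd: "\<And>v. 0 \<le> B (A v) v" and le: "\<And>v. B (A v) v \<le> c * B v v"
  shows "nrm (A u) \<le> c * nrm u"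
proof (cases "A u = 0")
  case True
  have "0 \<le> c"
  proof -
    obtain i :: 'e where "i \<in> Basis" using nonempty_Basis by blast
    then have "0 < B i i" by (intro pos) auto
    moreover have "0 \<le> c * B i i" using psd[of i] le[of i] by linarith
    ultimately show ?thesis by (simp add: zero_le_mult_iff)
  qed
  then show ?thesis using True by simp
next
  case False
  define Q where "Q u v = B (A u) v" for u v
  have "bilinear Q" unfolding bilinear_def Q_def
    by (auto intro!: linearI simp: linear_add[OF lin] linear_scale[OF lin] algebra_simps)
  moreover have "Q u v = Q v u" for u v unfolding Q_def by (metis sym symA)
  moreover have "Q v v \<ge> 0" for v unfolding Q_def using psd by simp
  ultimately have "(Q u (A u))\<^sup>2 \<le> Q u u * Q (A u) (A u)" by (rule psd_cauchy_schwarz)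
  also have "\<dots> \<le> (c * B u u) * (c * B (A u) (A u))"
    unfolding Q_def using psd le by (intro mult_mono) (auto intro: order_trans)
  finally have "(B (A u) (A u))\<^sup>2 \<le> c\<^sup>2 * B u u * B (A u) (A u)"
    by (simp add: Q_def power2_eq_square algebra_simps)
  then have *: "B (A u) (A u) \<le> c\<^sup>2 * B u u"
    using pos[OF False] by (simp add: power2_eq_square)
  have "0 < B (A u) (A u)" using pos[OF False] .
  have c0: "0 \<le> c"
  proof -
    have "0 < B u u" using False lin linear_0 by (intro pos) auto
    moreover have "0 \<le> c * B u u" using psd[of u] le[of u] by linarith
    ultimately show ?thesis by (simp add: zero_le_mult_iff)
  qed
  show ?thesis
    by (rule power2_le_imp_le) (use * c0 in \<open>auto simp: nrm_sq power_mult_distrib\<close>)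
qed

end

section \<open>Differential calculus\<close>

lemma linear_Basis_expansion:
  fixes Q :: "'e::euclidean_space \<Rightarrow> 'c::real_vector"
  assumes "linear Q"
  shows "Q v = (\<Sum>i\<in>Basis. (v \<bullet> i) *\<^sub>R Q i)"
proof -
  have "Q v = Q (\<Sum>i\<in>Basis. (v \<bullet> i) *\<^sub>R i)" by (simp only: euclidean_representation)
  also have "\<dots> = (\<Sum>i\<in>Basis. Q ((v \<bullet> i) *\<^sub>R i))" by (rule linear_sum[OF assms])
  also have "\<dots> = (\<Sum>i\<in>Basis. (v \<bullet> i) *\<^sub>R Q i)" by (simp add: linear_scale[OF assms])
  finally show ?thesis .
qed

lemma bilinear_Basis_expansion:
  fixes Q :: "'e::euclidean_space \<Rightarrow> 'f::euclidean_space \<Rightarrow> 'c::real_vector"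
  assumes "bilinear Q"
  shows "Q v w = (\<Sum>i\<in>Basis. (v \<bullet> i) *\<^sub>R Q i w)"
    and "Q v w = (\<Sum>j\<in>Basis. (w \<bullet> j) *\<^sub>R Q v j)"
proof -
  have l: "linear (\<lambda>v. Q v w)" "linear (Q v)" using assms by (auto simp: bilinear_def)
  show "Q v w = (\<Sum>i\<in>Basis. (v \<bullet> i) *\<^sub>R Q i w)" by (rule linear_Basis_expansion[OF l(1)])
  show "Q v w = (\<Sum>j\<in>Basis. (w \<bullet> j) *\<^sub>R Q v j)" by (rule linear_Basis_expansion[OF l(2)])
qed

text \<open>A product rule for a linear map that varies with y and is known only through its values
  at fixed vectors. In finite dimension this suffices: expand the argument in the basis.\<close>

lemma has_derivative_moving_linear:
  fixes Q :: "'a::real_normed_vector \<Rightarrow> 'e::euclidean_space \<Rightarrow> 'c::real_normed_vector"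
  assumes S: "open S" "x \<in> S" and lin: "\<And>y. y \<in> S \<Longrightarrow> linear (Q y)"
    and D: "\<And>u. ((\<lambda>y. Q y u) has_derivative D u) (at x)"
    and V: "(V has_derivative V') (at x)"
  shows "((\<lambda>y. Q y (V y)) has_derivative (\<lambda>w. D (V x) w + Q x (V' w))) (at x)"
proof -
  have D_lin: "D u = (\<lambda>w. \<Sum>i\<in>Basis. (u \<bullet> i) *\<^sub>R D i w)" for u
  proof -
    have "((\<lambda>y. \<Sum>i\<in>Basis. (u \<bullet> i) *\<^sub>R Q y i) has_derivative (\<lambda>w. \<Sum>i\<in>Basis. (u \<bullet> i) *\<^sub>R D i w)) (at x)"
      by (intro has_derivative_sum has_derivative_scaleR_right D)
    then have "((\<lambda>y. Q y u) has_derivative (\<lambda>w. \<Sum>i\<in>Basis. (u \<bullet> i) *\<^sub>R D i w)) (at x)"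
      by (rule has_derivative_transform_within_open[OF _ S])
        (rule linear_Basis_expansion[OF lin, symmetric])
    then show ?thesis using D has_derivative_unique by blast
  qed
  have "((\<lambda>y. \<Sum>i\<in>Basis. (V y \<bullet> i) *\<^sub>R Q y i) has_derivative
      (\<lambda>w. \<Sum>i\<in>Basis. (V x \<bullet> i) *\<^sub>R D i w + (V' w \<bullet> i) *\<^sub>R Q x i)) (at x)"
    by (intro has_derivative_sum has_derivative_scaleR has_derivative_inner_left V D)
  then have "((\<lambda>y. Q y (V y)) has_derivative
      (\<lambda>w. \<Sum>i\<in>Basis. (V x \<bullet> i) *\<^sub>R D i w + (V' w \<bullet> i) *\<^sub>R Q x i)) (at x)"
    by (rule has_derivative_transform_within_open[OF _ S])
      (rule linear_Basis_expansion[OF lin, symmetric])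
  also have "(\<lambda>w. \<Sum>i\<in>Basis. (V x \<bullet> i) *\<^sub>R D i w + (V' w \<bullet> i) *\<^sub>R Q x i) =
      (\<lambda>w. D (V x) w + Q x (V' w))"
  proof
    fix w
    have "D (V x) w = (\<Sum>i\<in>Basis. (V x \<bullet> i) *\<^sub>R D i w)" by (rule fun_cong[OF D_lin])
    moreover have "Q x (V' w) = (\<Sum>i\<in>Basis. (V' w \<bullet> i) *\<^sub>R Q x i)"
      by (rule linear_Basis_expansion[OF lin[OF S(2)]])
    ultimately show "(\<Sum>i\<in>Basis. (V x \<bullet> i) *\<^sub>R D i w + (V' w \<bullet> i) *\<^sub>R Q x i) =
        D (V x) w + Q x (V' w)" by (simp only: sum.distrib)
  qed
  finally show ?thesis .
qed

lemma continuous_on_moving_linear: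
  fixes Q :: "'a::topological_space \<Rightarrow> 'e::euclidean_space \<Rightarrow> 'c::real_normed_vector"
  assumes lin: "\<And>y. y \<in> S \<Longrightarrow> linear (Q y)"
    and Q: "\<And>u. continuous_on S (\<lambda>y. Q y u)" and V: "continuous_on S V"
  shows "continuous_on S (\<lambda>y. Q y (V y))"
proof -
  have "continuous_on S (\<lambda>y. \<Sum>i\<in>Basis. (V y \<bullet> i) *\<^sub>R Q y i)"
    by (intro continuous_intros Q V)
  then show ?thesis
    by (rule continuous_on_eq) (rule linear_Basis_expansion[OF lin, symmetric])
qed

lemma has_derivative_moving_bilinear:
  fixes Q :: "'a::real_normed_vector \<Rightarrow> 'e::euclidean_space \<Rightarrow> 'f::euclidean_space \<Rightarrow> 'c::real_normed_vector"
  assumes S: "open S" "x \<in> S" and bil: "\<And>y. y \<in> S \<Longrightarrow> bilinear (Q y)"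
    and D: "\<And>u v. ((\<lambda>y. Q y u v) has_derivative D u v) (at x)"
    and U: "(U has_derivative U') (at x)" and V: "(V has_derivative V') (at x)"
  shows "((\<lambda>y. Q y (U y) (V y)) has_derivative
    (\<lambda>w. D (U x) (V x) w + Q x (U' w) (V x) + Q x (U x) (V' w))) (at x)"
proof -
  have l1: "linear (\<lambda>u. Q y u v)" and l2: "linear (\<lambda>v. Q y u v)" if "y \<in> S" for y u v
    using bil[OF that] by (simp_all add: bilinear_def)
  have "((\<lambda>y. Q y (U y) v) has_derivative (\<lambda>w. D (U x) v w + Q x (U' w) v)) (at x)" for v
    by (rule has_derivative_moving_linear[OF S, where Q = "\<lambda>y u. Q y u v" and D = "\<lambda>u. D u v", OF l1 D U])
  then show ?thesis
    using has_derivative_moving_linear[where Q = "\<lambda>y v. Q y (U y) v"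
        and D = "\<lambda>v w. D (U x) v w + Q x (U' w) v", OF S l2 _ V] by simp
qed

lemma continuous_on_moving_bilinear:
  fixes Q :: "'a::topological_space \<Rightarrow> 'e::euclidean_space \<Rightarrow> 'f::euclidean_space \<Rightarrow> 'c::real_normed_vector"
  assumes bil: "\<And>y. y \<in> S \<Longrightarrow> bilinear (Q y)"
    and Q: "\<And>u v. continuous_on S (\<lambda>y. Q y u v)" and U: "continuous_on S U" and V: "continuous_on S V"
  shows "continuous_on S (\<lambda>y. Q y (U y) (V y))"
proof -
  have l1: "linear (\<lambda>u. Q y u v)" and l2: "linear (\<lambda>v. Q y u v)" if "y \<in> S" for y u v
    using bil[OF that] by (simp_all add: bilinear_def)
  have "continuous_on S (\<lambda>y. Q y (U y) v)" for v
    by (rule continuous_on_moving_linear[where Q = "\<lambda>y u. Q y u v", OF l1 Q U])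
  then show ?thesis
    using continuous_on_moving_linear[where Q = "\<lambda>y v. Q y (U y) v", OF l2 _ V] by simp
qed

text \<open>A product rule in which \<open>a\<close> is merely continuous, since the other factor
  vanishes at the point. \<open>differentiable_riesz\<close> applies it to coordinates of a map
  whose differentiability is still to be proved.\<close>

lemma has_derivative_mult_zero:
  fixes a b :: "'a::real_normed_vector \<Rightarrow> real"
  assumes a: "isCont a x" and b: "(b has_derivative b') (at x)" and b0: "b x = 0"
  shows "((\<lambda>y. a y * b y) has_derivative (\<lambda>w. a x * b' w)) (at x)"
proof -
  have bl: "bounded_linear b'" using b by (rule has_derivative_bounded_linear)
  obtain K where K: "K > 0" "\<And>w. norm (b' w) \<le> norm w * K"
    using bounded_linear.pos_bounded[OF bl] by blast
  obtain d where d: "d > 0" "\<And>y. norm (y - x) < d \<Longrightarrow> norm (b y - b x - b' (y - x)) \<le> 1 * norm (y - x)"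
    using b unfolding has_derivative_at_alt by (metis zero_less_one)
  have bd: "\<bar>b y\<bar> \<le> (K + 1) * norm (y - x)" if "norm (y - x) < d" for y
  proof -
    have "\<bar>b y\<bar> \<le> \<bar>b y - b' (y - x)\<bar> + \<bar>b' (y - x)\<bar>" by linarith
    then show ?thesis using d(2)[OF that] K(2)[of "y - x"] b0 by (simp add: algebra_simps)
  qed
  have "((\<lambda>y. (a y - a x) * b y) has_derivative (\<lambda>w. 0)) (at x)"
    unfolding has_derivative_at_alt
  proof (intro conjI allI impI)
    fix e :: real assume e: "e > 0"
    obtain d2 where d2: "d2 > 0" "\<And>y. norm (y - x) < d2 \<Longrightarrow> \<bar>a y - a x\<bar> < e / (K + 1)"
      using a e K(1) unfolding continuous_at_eps_delta dist_norm real_norm_def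
      by (metis add_pos_pos divide_pos_pos zero_less_one)
    have "norm ((a y - a x) * b y - (a x - a x) * b x - 0) \<le> e * norm (y - x)"
      if "norm (y - x) < min d d2" for y
    proof -
      have "\<bar>a y - a x\<bar> * \<bar>b y\<bar> \<le> (e / (K + 1)) * ((K + 1) * norm (y - x))"
        using that d2(2)[of y] bd[of y] e K by (intro mult_mono) auto
      then show ?thesis using K(1) by (simp add: abs_mult)
    qed
    then show "\<exists>d>0. \<forall>y. norm (y - x) < d \<longrightarrow>
        norm ((a y - a x) * b y - (a x - a x) * b x - 0) \<le> e * norm (y - x)"
      using d(1) d2(1) by (intro exI[of _ "min d d2"]) auto
  qed simp
  moreover have "((\<lambda>y. a x * b y) has_derivative (\<lambda>w. a x * b' w)) (at x)"
    using b by (rule has_derivative_mult_right)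
  ultimately have "((\<lambda>y. (a y - a x) * b y + a x * b y) has_derivative (\<lambda>w. 0 + a x * b' w)) (at x)"
    by (rule has_derivative_add)
  then show ?thesis by (simp add: algebra_simps)
qed

text \<open>The representative is given implicitly, so it is compared with its value at p0 by
  testing against the difference u = G p - G p0: near p0 the form B p is bounded below by a fixed
  multiple of the Euclidean square, while B p u u is the residual of G p0 at p, which tends to
  0.\<close>

lemma continuous_on_riesz:
  fixes B :: "'a::topological_space \<Rightarrow> 'e::euclidean_space \<Rightarrow> 'e \<Rightarrow> real"
  assumes ip: "\<And>p. p \<in> S \<Longrightarrow> is_inner_product (B p)"
    and B: "\<And>u v. continuous_on S (\<lambda>p. B p u v)" and h: "\<And>w. continuous_on S (\<lambda>p. h p w)"
    and G: "\<And>p w. p \<in> S \<Longrightarrow> B p (G p) w = h p w"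
  shows "continuous_on S G"
  unfolding continuous_on_def
proof
  fix p0 assume p0: "p0 \<in> S"
  interpret I: inner_form "B p0" using ip[OF p0] by unfold_locales
  obtain c0 where c0: "c0 > 0" "\<And>v. c0 * norm v \<le> I.nrm v" using I.nrm_lower by blast
  define c where "c = c0\<^sup>2"
  have c: "c > 0" "c * (norm v)\<^sup>2 \<le> B p0 v v" for v
    using c0(1) power_mono[OF c0(2)[of v], of 2] by (auto simp: c_def I.nrm_sq power_mult_distrib)
  \<comment> \<open>\<open>E\<close> measures the change of the form since p0; \<open>K\<close>
    measures how far G p0 is from representing h p with respect to B p.\<close>
  define E where "E p = (\<Sum>i\<in>Basis. \<Sum>j\<in>Basis. \<bar>B p i j - B p0 i j\<bar>)" for p
  define K where "K p = (\<Sum>i\<in>Basis. \<bar>h p i - B p (G p0) i\<bar>)" for p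
  have bil: "bilinear (B p)" if "p \<in> S" for p using ip[OF that] by (simp add: is_inner_product_def)
  have Bt: "((\<lambda>p. B p u v) \<longlongrightarrow> B p0 u v) (at p0 within S)" for u v
    using B p0 by (simp add: continuous_on_def)
  have ht: "((\<lambda>p. h p w) \<longlongrightarrow> h p0 w) (at p0 within S)" for w
    using h p0 by (simp add: continuous_on_def)
  have "(E \<longlongrightarrow> (\<Sum>i\<in>(Basis::'e set). \<Sum>j\<in>(Basis::'e set). \<bar>B p0 i j - B p0 i j\<bar>)) (at p0 within S)"
    unfolding E_def by (intro tendsto_intros Bt)
  then have E0: "(E \<longlongrightarrow> 0) (at p0 within S)" by simp
  have "(K \<longlongrightarrow> (\<Sum>i\<in>(Basis::'e set). \<bar>h p0 i - B p0 (G p0) i\<bar>)) (at p0 within S)"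
    unfolding K_def by (intro tendsto_intros Bt ht)
  then have K0: "(K \<longlongrightarrow> 0) (at p0 within S)" using G[OF p0] by simp
  have evS: "\<forall>\<^sub>F p in at p0 within S. p \<in> S" by (simp add: eventually_at_filter)
  have evE: "\<forall>\<^sub>F p in at p0 within S. E p < c / 2"
    using order_tendstoD(2)[OF E0, of "c / 2"] c(1) by simp
  have bound: "\<forall>\<^sub>F p in at p0 within S. norm (G p - G p0) \<le> 2 / c * K p"
    using evS evE
  proof eventually_elim
    case (elim p)
    define u where "u = G p - G p0"
    note bi = bil[OF elim(1)]
    have bi0: "bilinear (B p0)" by (rule bil[OF p0])
    have l2: "B p v w = (\<Sum>i\<in>Basis. \<Sum>j\<in>Basis. (v \<bullet> i) * (w \<bullet> j) * B p i j)" if "bilinear (B p)" for p v w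
    proof -
      have "B p v w = (\<Sum>i\<in>Basis. (v \<bullet> i) *\<^sub>R B p i w)"
        by (rule bilinear_Basis_expansion(1)[OF that])
      also have "\<dots> = (\<Sum>i\<in>Basis. (v \<bullet> i) *\<^sub>R (\<Sum>j\<in>Basis. (w \<bullet> j) *\<^sub>R B p i j))"
        by (subst bilinear_Basis_expansion(2)[OF that]) (rule refl)
      finally show ?thesis by (simp add: sum_distrib_left mult.assoc)
    qed
    have "\<bar>B p u u - B p0 u u\<bar> = \<bar>\<Sum>i\<in>Basis. \<Sum>j\<in>Basis. (u \<bullet> i) * (u \<bullet> j) * (B p i j - B p0 i j)\<bar>"
      unfolding l2[OF bi, of u u] l2[OF bi0, of u u] by (simp add: algebra_simps sum_subtractf)
    also have "\<dots> \<le> (\<Sum>i\<in>Basis. \<Sum>j\<in>Basis. (norm u)\<^sup>2 * \<bar>B p i j - B p0 i j\<bar>)"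
    proof (intro order_trans[OF sum_abs] sum_mono)
      fix i j :: 'e assume "i \<in> Basis" "j \<in> Basis"
      then show "\<bar>(u \<bullet> i) * (u \<bullet> j) * (B p i j - B p0 i j)\<bar> \<le> (norm u)\<^sup>2 * \<bar>B p i j - B p0 i j\<bar>"
        unfolding abs_mult power2_eq_square
        by (intro mult_mono Basis_le_norm) auto
    qed
    also have "\<dots> = (norm u)\<^sup>2 * E p" by (simp add: E_def sum_distrib_left)
    also have "\<dots> \<le> (norm u)\<^sup>2 * (c / 2)" using elim(2) by (intro mult_left_mono) auto
    finally have "c / 2 * (norm u)\<^sup>2 \<le> B p u u" using c(2)[of u] abs_ge_minus_self[of "B p u u - B p0 u u"] by (simp add: algebra_simps)
    also have "B p u u = (\<Sum>i\<in>Basis. (u \<bullet> i) *\<^sub>R B p u i)"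
      by (rule bilinear_Basis_expansion(2)[OF bi])
    also have "\<dots> = (\<Sum>i\<in>Basis. (u \<bullet> i) * (h p i - B p (G p0) i))"
      by (simp add: u_def bilinear_lsub[OF bi] G[OF elim(1)])
    also have "\<dots> \<le> (\<Sum>i\<in>Basis. norm u * \<bar>h p i - B p (G p0) i\<bar>)"
    proof (rule sum_mono)
      fix i :: 'e assume "i \<in> Basis"
      have "(u \<bullet> i) * (h p i - B p (G p0) i) \<le> \<bar>u \<bullet> i\<bar> * \<bar>h p i - B p (G p0) i\<bar>"
        by (metis abs_ge_self abs_mult)
      also have "\<dots> \<le> norm u * \<bar>h p i - B p (G p0) i\<bar>"
        by (intro mult_right_mono Basis_le_norm \<open>i \<in> Basis\<close>) auto
      finally show "(u \<bullet> i) * (h p i - B p (G p0) i) \<le> norm u * \<bar>h p i - B p (G p0) i\<bar>" .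
    qed
    also have "\<dots> = norm u * K p" by (simp add: K_def sum_distrib_left)
    finally have *: "norm u * (c / 2 * norm u) \<le> norm u * K p" by (simp add: power2_eq_square algebra_simps)
    have "c / 2 * norm u \<le> K p"
    proof (cases "u = 0")
      case True then show ?thesis by (simp add: K_def sum_nonneg)
    next
      case False then show ?thesis using * by simp
    qed
    then show ?case using c(1) by (simp add: u_def field_simps)
  qed
  have "((\<lambda>p. 2 / c * K p) \<longlongrightarrow> 2 / c * 0) (at p0 within S)" by (intro tendsto_intros K0)
  then have "((\<lambda>p. norm (G p - G p0)) \<longlongrightarrow> 0) (at p0 within S)"
    using bound by (intro tendsto_sandwich[OF _ bound tendsto_const]) auto
  then show "(G \<longlongrightarrow> G p0) (at p0 within S)"
    using tendsto_norm_zero_iff LIM_zero_iff by blast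
qed

text \<open>No inverse matrix is differentiated. For fixed w, B p0 (G p) w equals h p w minus (B p -
  B p0) (G p) w, and the last term is a continuous factor times one that vanishes at p0. Then G is
  recovered from these numbers by a fixed linear left inverse.\<close>

lemma differentiable_riesz:
  fixes B :: "'a::real_normed_vector \<Rightarrow> 'e::euclidean_space \<Rightarrow> 'e \<Rightarrow> real"
  assumes S: "open S" "p0 \<in> S" and ip: "\<And>p. p \<in> S \<Longrightarrow> is_inner_product (B p)"
    and B: "\<And>u v p. p \<in> S \<Longrightarrow> (\<lambda>p. B p u v) differentiable (at p)"
    and h: "\<And>w p. p \<in> S \<Longrightarrow> (\<lambda>p. h p w) differentiable (at p)"
    and G: "\<And>p w. p \<in> S \<Longrightarrow> B p (G p) w = h p w"
  shows "G differentiable (at p0)"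
proof -
  have bil: "bilinear (B p)" if "p \<in> S" for p using ip[OF that] by (simp add: is_inner_product_def)
  have "continuous_on S G"
    by (rule continuous_on_riesz[where B = B and h = h, OF ip])
      (auto intro!: continuous_at_imp_continuous_on differentiable_imp_continuous_within B h G)
  then have Gc: "isCont G p0" using S continuous_on_eq_continuous_at by blast
  have lin: "(\<lambda>p. B p0 (G p) w) differentiable (at p0)" for w
  proof -
    define D where "D i = frechet_derivative (\<lambda>p. B p i w) (at p0)" for i
    define h' where "h' = frechet_derivative (\<lambda>p. h p w) (at p0)"
    have D: "((\<lambda>p. B p i w) has_derivative D i) (at p0)" for i
      using B[OF S(2)] unfolding D_def frechet_derivative_works .
    have h': "((\<lambda>p. h p w) has_derivative h') (at p0)"
      using h[OF S(2)] unfolding h'_def frechet_derivative_works .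
    have "((\<lambda>p. h p w - (\<Sum>i\<in>Basis. (G p \<bullet> i) * (B p i w - B p0 i w))) has_derivative
        (\<lambda>v. h' v - (\<Sum>i\<in>Basis. (G p0 \<bullet> i) * (D i v - 0)))) (at p0)"
      by (intro has_derivative_diff h' has_derivative_sum has_derivative_mult_zero D has_derivative_const
          continuous_intros Gc) simp
    then have "((\<lambda>p. B p0 (G p) w) has_derivative
        (\<lambda>v. h' v - (\<Sum>i\<in>Basis. (G p0 \<bullet> i) * (D i v - 0)))) (at p0)"
    proof (rule has_derivative_transform_within_open[OF _ S])
      fix p assume p: "p \<in> S"
      have e: "B q (G p) w = (\<Sum>i\<in>Basis. (G p \<bullet> i) *\<^sub>R B q i w)" if "q \<in> S" for q
        by (rule bilinear_Basis_expansion(1)[OF bil[OF that]])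
      show "h p w - (\<Sum>i\<in>Basis. (G p \<bullet> i) * (B p i w - B p0 i w)) = B p0 (G p) w"
        using e[OF p] e[OF S(2)] G[OF p, of w] by (simp add: algebra_simps sum_subtractf)
    qed
    then show ?thesis by (auto simp: differentiable_def)
  qed
  interpret I: inner_form "B p0" using ip[OF S(2)] by unfold_locales
  define J where "J u = (\<Sum>i\<in>Basis. B p0 u i *\<^sub>R i)" for u
  have J_lin: "linear J" unfolding J_def
    by (intro linearI) (simp_all add: algebra_simps scaleR_sum_right flip: sum.distrib)
  have "inj J"
  proof (rule injI)
    fix u v assume *: "J u = J v"
    have J: "J u \<bullet> i = B p0 u i" if "i \<in> Basis" for u i
      using that by (simp add: J_def inner_sum_left inner_Basis if_distrib cong: if_cong)
    have "B p0 u w = B p0 v w" for w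
      unfolding bilinear_Basis_expansion(2)[OF I.bil, of _ w]
      using * J by (intro sum.cong refl) metis
    then show "u = v" by (rule I.eqI)
  qed
  then obtain g where g: "linear g" "g \<circ> J = id" using linear_injective_left_inverse J_lin by blast
  have "(\<lambda>p. B p0 (G p) i *\<^sub>R i) differentiable (at p0)" for i
  proof -
    obtain D where "((\<lambda>p. B p0 (G p) i) has_derivative D) (at p0)"
      using lin[of i] unfolding differentiable_def by blast
    from has_derivative_scaleR_left[OF this, of i] show ?thesis by (rule differentiableI)
  qed
  then have "(\<lambda>p. J (G p)) differentiable (at p0)"
    unfolding J_def by (intro differentiable_sum) auto
  then have "(g \<circ> (\<lambda>p. J (G p))) differentiable (at p0)"
    by (intro differentiable_chain_at linear_imp_differentiable g)
  moreover have "g \<circ> (\<lambda>p. J (G p)) = G" using g(2) by (auto simp: fun_eq_iff)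
  ultimately show ?thesis by simp
qed

text \<open>The second difference is symmetric in u and v, so this bound yields symmetry of second
  derivatives from differentiability of the first derivative at the single point x. The mean value
  theorem in direction u turns the second difference into a difference of first derivatives.\<close>

lemma second_difference_bound:
  fixes F :: "'a::real_normed_vector \<Rightarrow> real"
  assumes S: "open S" "x \<in> S" and F: "\<And>y. y \<in> S \<Longrightarrow> (F has_derivative F' y) (at y)"
    and D: "((\<lambda>y. F' y u) has_derivative D) (at x)" and e: "e > 0"
  shows "\<exists>d>0. \<forall>t. 0 < t \<and> t < d \<longrightarrow>
    \<bar>F (x + t *\<^sub>R u + t *\<^sub>R v) - F (x + t *\<^sub>R u) - F (x + t *\<^sub>R v) + F x - t\<^sup>2 * D v\<bar> \<le> e * t\<^sup>2"
proof -
  \<comment> \<open>The two points at which the derivative is expanded have norms adding up to at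
    most t (2 |u| + |v|); the 1 keeps \<open>C\<close> positive.\<close>
  define C where "C = 2 * norm u + norm v + 1"
  have C: "C > 0" by (simp add: C_def add_nonneg_pos)
  obtain r where r: "r > 0" "ball x r \<subseteq> S" using S open_contains_ball by blast
  obtain d where d: "d > 0" "\<And>y. norm (y - x) < d \<Longrightarrow>
      norm (F' y u - F' x u - D (y - x)) \<le> e / C * norm (y - x)"
    using D e C unfolding has_derivative_at_alt by (metis divide_pos_pos)
  have lin: "linear D" using D has_derivative_linear by blast
  show ?thesis
  proof (intro exI[of _ "min r d / C"] conjI allI impI)
    show "min r d / C > 0" using r d C by simp
    fix t assume "0 < t \<and> t < min r d / C"
    then have t: "0 < t" "t * C < min r d" using C by (auto simp: field_simps)
    have small: "norm (\<tau> *\<^sub>R u + s *\<^sub>R v) < min r d" if "0 \<le> \<tau>" "\<tau> \<le> t" "0 \<le> s" "s \<le> t" for \<tau> s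
    proof -
      have "norm (\<tau> *\<^sub>R u + s *\<^sub>R v) \<le> \<tau> * norm u + s * norm v"
        using that by (metis abs_of_nonneg norm_scaleR norm_triangle_ineq)
      also have "\<dots> \<le> t * norm u + t * norm v" using that by (intro add_mono mult_right_mono) auto
      also have "\<dots> \<le> t * C" using t(1) by (simp add: C_def algebra_simps)
      finally show ?thesis using t(2) by simp
    qed
    have inS: "x + \<tau> *\<^sub>R u + s *\<^sub>R v \<in> S" if "0 \<le> \<tau>" "\<tau> \<le> t" "0 \<le> s" "s \<le> t" for \<tau> s
    proof -
      have "dist x (x + (\<tau> *\<^sub>R u + s *\<^sub>R v)) < r" using small[OF that] unfolding dist_norm
        by (metis add_diff_cancel_left' min_less_iff_conj norm_minus_commute)
      then show ?thesis using r(2) by (metis add.assoc mem_ball subsetD)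
    qed
    \<comment> \<open>The summand with factor 0 lets one derivative formula, for s = t and s = 0,
      serve both terms.\<close>
    define \<phi> where "\<phi> \<tau> = F (x + \<tau> *\<^sub>R u + t *\<^sub>R v) - F (x + \<tau> *\<^sub>R u + 0 *\<^sub>R v)" for \<tau>
    have der: "(\<phi> has_real_derivative
        (F' (x + \<tau> *\<^sub>R u + t *\<^sub>R v) u - F' (x + \<tau> *\<^sub>R u + 0 *\<^sub>R v) u)) (at \<tau>)"
      if "0 \<le> \<tau>" "\<tau> \<le> t" for \<tau>
    proof -
      have *: "((\<lambda>\<tau>. F (x + \<tau> *\<^sub>R u + s *\<^sub>R v)) has_real_derivative F' (x + \<tau> *\<^sub>R u + s *\<^sub>R v) u) (at \<tau>)"
        if "s = 0 \<or> s = t" for s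
      proof -
        have FS: "(F has_derivative F' (x + \<tau> *\<^sub>R u + s *\<^sub>R v)) (at (x + \<tau> *\<^sub>R u + s *\<^sub>R v))"
          using that t(1) \<open>0 \<le> \<tau>\<close> \<open>\<tau> \<le> t\<close> by (intro F inS) auto
        have "((\<lambda>\<tau>. F (x + \<tau> *\<^sub>R u + s *\<^sub>R v)) has_derivative
            (\<lambda>w. F' (x + \<tau> *\<^sub>R u + s *\<^sub>R v) (w *\<^sub>R u))) (at \<tau>)"
          by (rule has_derivative_compose[where g = F and f = "\<lambda>\<tau>. x + \<tau> *\<^sub>R u + s *\<^sub>R v", OF _ FS])
            (auto intro!: derivative_eq_intros)
        then show ?thesis
          by (rule has_derivative_imp_has_field_derivative)
            (simp add: linear_scale[OF has_derivative_linear[OF FS]])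
      qed
      show ?thesis unfolding \<phi>_def by (rule DERIV_diff; rule *; simp)
    qed
    obtain \<tau> where \<tau>: "0 < \<tau>" "\<tau> < t" and eq: "\<phi> t - \<phi> 0 = (t - 0) *
        (F' (x + \<tau> *\<^sub>R u + t *\<^sub>R v) u - F' (x + \<tau> *\<^sub>R u + 0 *\<^sub>R v) u)"
      using MVT2[of 0 t \<phi>, OF t(1) der] by blast
    define a1 where "a1 = \<tau> *\<^sub>R u + t *\<^sub>R v"
    define a0 where "a0 = \<tau> *\<^sub>R u"
    have n1: "norm (F' (x + a1) u - F' x u - D a1) \<le> e / C * norm a1"
      using d(2)[of "x + a1"] small[of \<tau> t] \<tau> t by (simp add: a1_def)
    have n0: "norm (F' (x + a0) u - F' x u - D a0) \<le> e / C * norm a0"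
      using d(2)[of "x + a0"] small[of \<tau> 0] \<tau> t by (simp add: a0_def)
    have Da: "D a1 - D a0 = t * D v"
      by (simp add: a1_def a0_def linear_add[OF lin] linear_scale[OF lin])
    have na: "norm a1 + norm a0 \<le> t * C"
    proof -
      have "norm a1 \<le> \<tau> * norm u + t * norm v" unfolding a1_def
        using \<tau> t by (metis abs_of_pos norm_scaleR norm_triangle_ineq)
      moreover have "norm a0 = \<tau> * norm u" using \<tau> by (simp add: a0_def)
      moreover have "\<tau> * norm u \<le> t * norm u" using \<tau> by (intro mult_right_mono) auto
      ultimately show ?thesis using t(1) by (simp add: C_def algebra_simps)
    qed
    have "\<bar>(F' (x + a1) u - F' (x + a0) u) - t * D v\<bar> \<le> e / C * norm a1 + e / C * norm a0"
      using n1 n0 Da by simp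
    also have "\<dots> = e / C * (norm a1 + norm a0)" by (simp add: algebra_simps)
    also have "\<dots> \<le> e / C * (t * C)" using na e C by (intro mult_left_mono) auto
    also have "\<dots> = e * t" using C by simp
    finally have "t * \<bar>(F' (x + a1) u - F' (x + a0) u) - t * D v\<bar> \<le> t * (e * t)"
      using t(1) by (intro mult_left_mono) auto
    moreover have "t * \<bar>(F' (x + a1) u - F' (x + a0) u) - t * D v\<bar> =
        \<bar>t * (F' (x + a1) u - F' (x + a0) u) - t\<^sup>2 * D v\<bar>"
    proof -
      have "t * (F' (x + a1) u - F' (x + a0) u) - t\<^sup>2 * D v = t * (F' (x + a1) u - F' (x + a0) u - t * D v)"
        by (simp add: power2_eq_square algebra_simps)
      then show ?thesis using t(1) by (simp add: abs_mult)
    qed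
    moreover have "F (x + t *\<^sub>R u + t *\<^sub>R v) - F (x + t *\<^sub>R u) - F (x + t *\<^sub>R v) + F x =
        t * (F' (x + a1) u - F' (x + a0) u)"
      using eq by (simp add: \<phi>_def a1_def a0_def add.assoc)
    ultimately show "\<bar>F (x + t *\<^sub>R u + t *\<^sub>R v) - F (x + t *\<^sub>R u) - F (x + t *\<^sub>R v) + F x - t\<^sup>2 * D v\<bar>
        \<le> e * t\<^sup>2" by (simp add: power2_eq_square algebra_simps)
  qed
qed

lemma second_derivative_symmetric:
  fixes F :: "'a::real_normed_vector \<Rightarrow> real"
  assumes S: "open S" "x \<in> S" and F: "\<And>y. y \<in> S \<Longrightarrow> (F has_derivative F' y) (at y)"
    and Du: "((\<lambda>y. F' y u) has_derivative Du) (at x)" and Dv: "((\<lambda>y. F' y v) has_derivative Dv) (at x)"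
  shows "Du v = Dv u"
proof (rule ccontr)
  assume n: "Du v \<noteq> Dv u"
  \<comment> \<open>Two errors of size e add up to half of the supposed discrepancy.\<close>
  define e where "e = \<bar>Du v - Dv u\<bar> / 4"
  have e: "e > 0" using n by (simp add: e_def)
  obtain d1 where d1: "d1 > 0" "\<And>t. 0 < t \<Longrightarrow> t < d1 \<Longrightarrow>
    \<bar>F (x + t *\<^sub>R u + t *\<^sub>R v) - F (x + t *\<^sub>R u) - F (x + t *\<^sub>R v) + F x - t\<^sup>2 * Du v\<bar> \<le> e * t\<^sup>2"
    using second_difference_bound[OF S F Du e, of v] by blast
  obtain d2 where d2: "d2 > 0" "\<And>t. 0 < t \<Longrightarrow> t < d2 \<Longrightarrow>
    \<bar>F (x + t *\<^sub>R v + t *\<^sub>R u) - F (x + t *\<^sub>R v) - F (x + t *\<^sub>R u) + F x - t\<^sup>2 * Dv u\<bar> \<le> e * t\<^sup>2"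
    using second_difference_bound[OF S F Dv e, of u] by blast
  define t where "t = min d1 d2 / 2"
  have t: "0 < t" "t < d1" "t < d2" using d1(1) d2(1) by (auto simp: t_def min_def)
  have "\<bar>t\<^sup>2 * Du v - t\<^sup>2 * Dv u\<bar> \<le> 2 * (e * t\<^sup>2)"
    using d1(2)[OF t(1,2)] d2(2)[OF t(1,3)] by (simp add: add.assoc add.commute[of "t *\<^sub>R v"])
  then have "\<bar>Du v - Dv u\<bar> * t\<^sup>2 \<le> 2 * e * t\<^sup>2"
    by (simp add: abs_mult mult.commute flip: left_diff_distrib)
  then have "\<bar>Du v - Dv u\<bar> \<le> 2 * e" using t(1) mult_right_le_imp_le[of "\<bar>Du v - Dv u\<bar>" "t\<^sup>2" "2 * e"] by simp
  then have "4 * e \<le> 2 * e" by (simp add: e_def)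
  then show False using e by simp
qed

lemma second_derivative_symmetric':
  fixes F :: "'a::real_normed_vector \<Rightarrow> 'e::euclidean_space"
  assumes S: "open S" "x \<in> S" and F: "\<And>y. y \<in> S \<Longrightarrow> (F has_derivative F' y) (at y)"
    and Du: "((\<lambda>y. F' y u) has_derivative Du) (at x)" and Dv: "((\<lambda>y. F' y v) has_derivative Dv) (at x)"
  shows "Du v = Dv u"
proof (rule euclidean_eqI)
  fix i :: 'e
  show "Du v \<bullet> i = Dv u \<bullet> i"
    by (rule second_derivative_symmetric[OF S, where F = "\<lambda>y. F y \<bullet> i" and F' = "\<lambda>y w. F' y w \<bullet> i"])
      (intro has_derivative_inner_left F Du Dv; assumption)+
qed

lemma Ck_on_differentiable: "Ck_on (Suc k) F S \<Longrightarrow> x \<in> S \<Longrightarrow>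
    (F has_derivative frechet_derivative F (at x)) (at x)"
  by (simp add: frechet_derivative_works)

lemma Ck_on_continuous: "Ck_on k F S \<Longrightarrow> continuous_on S F"
  by (cases k) (auto intro!: continuous_at_imp_continuous_on differentiable_imp_continuous_within)

lemma smooth_on_derivative:
  assumes "smooth_on F S"
  shows "smooth_on (\<lambda>x. frechet_derivative F (at x) v) S"
    and "x \<in> S \<Longrightarrow> (F has_derivative frechet_derivative F (at x)) (at x)"
    and "continuous_on S F"
  using assms Ck_on_differentiable[of 0 F S x] Ck_on_continuous[of 0 F S]
  unfolding smooth_on_def by (metis Ck_on.simps(2))+

section \<open>Gradient descent on one tangent space\<close>

text \<open>The step without the exit rule, defined on the whole tangent space. Localization is
  phrased with its iterates, so measurability does not involve the choice of \<alpha> in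
  \<open>tangent_iterate\<close>.\<close>

definition gd_step ::
  "('m, 'e::euclidean_space) manifold \<Rightarrow> ('m \<Rightarrow> 'e \<Rightarrow> 'm) \<Rightarrow> ('m \<Rightarrow> real) \<Rightarrow> 'm \<Rightarrow> real \<Rightarrow> 'e \<Rightarrow> 'e" where
  "gd_step M R f x \<eta> s = s - \<eta> *\<^sub>R pullback_grad M R f x s"

text \<open>The Cauchy-Schwarz inequality of improve or localize, in a form that adds one step (b)
  to n earlier ones (a) and so fits an induction.\<close>

lemma power2_sum_le_mult:
  fixes a b A C n :: real
  assumes "0 \<le> n" "0 \<le> A" "0 \<le> C" "a\<^sup>2 \<le> n * A" "b\<^sup>2 \<le> C"
  shows "(a + b)\<^sup>2 \<le> (1 + n) * (A + C)"
proof (cases "n = 0")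
  case True
  then show ?thesis using assms by simp
next
  case False
  then have n: "n > 0" using assms by simp
  have "0 \<le> (a - n * b)\<^sup>2" by simp
  then have "n * (2 * a * b) \<le> a\<^sup>2 + n\<^sup>2 * b\<^sup>2" by (simp add: power2_eq_square algebra_simps)
  also have "\<dots> \<le> n * A + n\<^sup>2 * C" using assms by (intro add_mono mult_left_mono) auto
  also have "\<dots> = n * (A + n * C)" by (simp add: power2_eq_square algebra_simps)
  finally have "2 * a * b \<le> A + n * C" using n by simp
  then show ?thesis using assms by (simp add: power2_sum algebra_simps)
qed

text \<open>What a round uses of the geometry: a twice differentiable function on one inner product
  space. The gradient is Lipschitz on the ball of radius b, possibly infinite, and the Hessian is
  compared only with its value at the centre.\<close>

locale tangent_model = inner_form "metric M x"
  for M :: "('m, 'e::euclidean_space) manifold" and x :: 'm +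
  fixes R :: "'m \<Rightarrow> 'e \<Rightarrow> 'm" and f :: "'m \<Rightarrow> real" and l \<rho> :: real and b :: ereal
  assumes deriv: "((f \<circ> R x) has_derivative (\<lambda>w. metric M x (pullback_grad M R f x s) w)) (at s)"
    and deriv2: "(pullback_grad M R f x has_derivative pullback_Hess M R f x s) (at s)"
    and Hess_sym: "metric M x (pullback_Hess M R f x 0 u) v = metric M x u (pullback_Hess M R f x 0 v)"
    and l_pos: "l > 0" and rho_pos: "\<rho> > 0" and b_pos: "b > 0"
    and lip: "ereal (tnorm M x s) \<le> b \<Longrightarrow> ereal (tnorm M x s') \<le> b \<Longrightarrow>
      tnorm M x (pullback_grad M R f x s - pullback_grad M R f x s') \<le> l * tnorm M x (s - s')"
    and Hess_lip: "ereal (tnorm M x s) \<le> b \<Longrightarrow>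
      tnorm M x (pullback_Hess M R f x s v - pullback_Hess M R f x 0 v) \<le> \<rho> * tnorm M x s * tnorm M x v"
begin

abbreviation "gr \<equiv> pullback_grad M R f x"
abbreviation "H \<equiv> pullback_Hess M R f x"
abbreviation "fh \<equiv> f \<circ> R x"
abbreviation "gd \<equiv> gd_step M R f x (1 / l)"

lemma tnorm_eq: "tnorm M x = nrm"
  by (auto simp: tnorm_def nrm_def)

lemmas lip' = lip[unfolded tnorm_eq]
lemmas Hess_lip' = Hess_lip[unfolded tnorm_eq]

lemma inb_segment:
  assumes "ereal (nrm s) \<le> b" "ereal (nrm (s + u)) \<le> b" "0 \<le> t" "t \<le> 1"
  shows "ereal (nrm (s + t *\<^sub>R u)) \<le> b"
proof -
  have "s + t *\<^sub>R u = (1 - t) *\<^sub>R s + t *\<^sub>R (s + u)" by (simp add: algebra_simps)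
  then have "nrm (s + t *\<^sub>R u) \<le> (1 - t) * nrm s + t * nrm (s + u)"
    using nrm_triangle[of "(1 - t) *\<^sub>R s" "t *\<^sub>R (s + u)"] assms(3,4) by simp
  also have "\<dots> \<le> (1 - t) * max (nrm s) (nrm (s + u)) + t * max (nrm s) (nrm (s + u))"
    using assms(3,4) by (intro add_mono mult_left_mono) auto
  also have "\<dots> = max (nrm s) (nrm (s + u))" by (simp add: algebra_simps)
  finally have "ereal (nrm (s + t *\<^sub>R u)) \<le> ereal (max (nrm s) (nrm (s + u)))" by (simp only: ereal_less_eq)
  also have "\<dots> \<le> b" using assms(1,2) by (simp add: max_def)
  finally show ?thesis .
qed

lemma fh_along: "((\<lambda>t. fh (s + t *\<^sub>R u)) has_real_derivative metric M x (gr (s + t *\<^sub>R u)) u) (at t)"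
proof -
  have "((\<lambda>t. fh (s + t *\<^sub>R u)) has_derivative (\<lambda>w. metric M x (gr (s + t *\<^sub>R u)) (w *\<^sub>R u))) (at t)"
    by (rule has_derivative_compose[where g = fh and f = "\<lambda>t. s + t *\<^sub>R u", OF _ deriv])
      (auto intro!: derivative_eq_intros)
  then show ?thesis by (rule has_derivative_imp_has_field_derivative) simp
qed

lemma gr_along: "((\<lambda>t. metric M x (gr (s + t *\<^sub>R u)) v) has_real_derivative metric M x (H (s + t *\<^sub>R u) u) v) (at t)"
proof -
  have "((\<lambda>t. gr (s + t *\<^sub>R u)) has_derivative (\<lambda>w. H (s + t *\<^sub>R u) (w *\<^sub>R u))) (at t)"
    by (rule has_derivative_compose[where g = gr and f = "\<lambda>t. s + t *\<^sub>R u", OF _ deriv2])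
      (auto intro!: derivative_eq_intros)
  then have "((\<lambda>t. metric M x (gr (s + t *\<^sub>R u)) v) has_derivative
      (\<lambda>w. metric M x (H (s + t *\<^sub>R u) (w *\<^sub>R u)) v)) (at t)"
    by (rule bounded_linear.has_derivative[OF bounded_linear_B_left])
  then show ?thesis
    by (rule has_derivative_imp_has_field_derivative)
      (simp add: linear_scale[OF has_derivative_linear[OF deriv2]])
qed

lemma descent:
  assumes "ereal (nrm s) \<le> b" "ereal (nrm (s + u)) \<le> b"
  shows "fh (s + u) \<le> fh s + metric M x (gr s) u + l / 2 * (nrm u)\<^sup>2"
proof -
  \<comment> \<open>The function minus its quadratic upper model along the segment; the Lipschitz
    bound makes its derivative nonpositive.\<close>
  define \<phi> where "\<phi> t = fh (s + t *\<^sub>R u) - t * metric M x (gr s) u - l * (nrm u)\<^sup>2 * (t\<^sup>2 / 2)" for t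
  have "\<phi> 1 \<le> \<phi> 0"
  proof (rule DERIV_nonpos_imp_nonincreasing[of 0 1 \<phi>])
    fix t :: real assume t: "0 \<le> t" "t \<le> 1"
    let ?y = "metric M x (gr (s + t *\<^sub>R u)) u - metric M x (gr s) u - l * (nrm u)\<^sup>2 * t"
    have "(\<phi> has_real_derivative ?y) (at t)"
      unfolding \<phi>_def comp_def by (auto intro!: derivative_eq_intros fh_along[unfolded comp_def])
    moreover have "?y \<le> 0"
    proof -
      have "metric M x (gr (s + t *\<^sub>R u)) u - metric M x (gr s) u = metric M x (gr (s + t *\<^sub>R u) - gr s) u"
        by simp
      also have "\<dots> \<le> nrm (gr (s + t *\<^sub>R u) - gr s) * nrm u" by (rule cauchy_schwarz')
      also have "\<dots> \<le> (l * nrm (s + t *\<^sub>R u - s)) * nrm u"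
        using assms inb_segment[OF assms t] by (intro mult_right_mono lip') auto
      also have "\<dots> = l * (nrm u)\<^sup>2 * t" using t by (simp add: power2_eq_square)
      finally show ?thesis by simp
    qed
    ultimately show "\<exists>y. (\<phi> has_real_derivative y) (at t) \<and> y \<le> 0" by blast
  qed simp
  then show ?thesis by (simp add: \<phi>_def)
qed

text \<open>Stated for all step sizes up to 1 / l so that it also covers the shortened step that
  ends on the boundary.\<close>

lemma step_decrease:
  assumes "ereal (nrm s) \<le> b" "ereal (nrm (s - a *\<^sub>R gr s)) \<le> b" "0 \<le> a" "a \<le> 1 / l"
  shows "fh (s - a *\<^sub>R gr s) \<le> fh s - a / 2 * (nrm (gr s))\<^sup>2"
    and "(nrm (a *\<^sub>R gr s))\<^sup>2 \<le> 2 / l * (fh s - fh (s - a *\<^sub>R gr s))"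
proof -
  have al: "l * a \<le> 1" using assms(4) l_pos by (simp add: field_simps)
  have "fh (s - a *\<^sub>R gr s) \<le> fh s - a * (nrm (gr s))\<^sup>2 + l / 2 * (a\<^sup>2 * (nrm (gr s))\<^sup>2)"
    using descent[of s "- (a *\<^sub>R gr s)"] assms
    by (simp add: nrm_sq power_mult_distrib)
  also have "l / 2 * (a\<^sup>2 * (nrm (gr s))\<^sup>2) = (l * a) * (a * (nrm (gr s))\<^sup>2) / 2"
    by (simp add: power2_eq_square)
  also have "\<dots> \<le> 1 * (a * (nrm (gr s))\<^sup>2) / 2"
    using al assms(3) by (intro divide_right_mono mult_right_mono) auto
  finally show 1: "fh (s - a *\<^sub>R gr s) \<le> fh s - a / 2 * (nrm (gr s))\<^sup>2" by simp
  have "(nrm (a *\<^sub>R gr s))\<^sup>2 = a * (a * (nrm (gr s))\<^sup>2)"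
    by (simp add: power_mult_distrib power2_eq_square)
  also have "\<dots> \<le> (1 / l) * (a * (nrm (gr s))\<^sup>2)"
    using assms(3,4) by (intro mult_right_mono) auto
  also have "\<dots> \<le> (1 / l) * (2 * (fh s - fh (s - a *\<^sub>R gr s)))"
    using 1 l_pos by (intro mult_left_mono) auto
  finally show "(nrm (a *\<^sub>R gr s))\<^sup>2 \<le> 2 / l * (fh s - fh (s - a *\<^sub>R gr s))" by simp
qed

text \<open>Shows that the \<open>SOME\<close> in \<open>tangent_iterate\<close> has a witness: the
  norm varies continuously along the step from below b to at least b.\<close>

lemma exit_scaling:
  assumes "ereal (nrm s) < b" "b \<le> ereal (nrm (s - \<eta> *\<^sub>R v))"
  shows "\<exists>\<alpha>. 0 < \<alpha> \<and> \<alpha> \<le> 1 \<and> ereal (nrm (s - (\<alpha> * \<eta>) *\<^sub>R v)) = b"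
proof -
  obtain c where c: "b = ereal c" using assms by (cases b) auto
  have "\<exists>\<alpha>\<ge>0. \<alpha> \<le> 1 \<and> nrm (s - (\<alpha> * \<eta>) *\<^sub>R v) = c"
  proof (rule IVT')
    show "continuous_on {0..1} (\<lambda>\<alpha>. nrm (s - (\<alpha> * \<eta>) *\<^sub>R v))"
      unfolding nrm_def by (intro continuous_intros)
  qed (use assms c in auto)
  then obtain \<alpha> where \<alpha>: "0 \<le> \<alpha>" "\<alpha> \<le> 1" "nrm (s - (\<alpha> * \<eta>) *\<^sub>R v) = c" by blast
  moreover have "\<alpha> \<noteq> 0" using \<alpha>(3) assms(1) c by auto
  ultimately show ?thesis using c by (intro exI[of _ \<alpha>]) auto
qed

lemma tangent_iterate_Suc_cases:
  assumes "ereal (nrm s) < b"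
  obtains (exit) \<alpha> where "b \<le> ereal (nrm (gd s))" "0 < \<alpha>" "\<alpha> \<le> 1"
      "ereal (nrm (s - (\<alpha> * (1 / l)) *\<^sub>R gr s)) = b"
      "tangent_iterate M R f x (1 / l) b s (Suc n) = s - (\<alpha> * (1 / l)) *\<^sub>R gr s"
  | (step) "ereal (nrm (gd s)) < b"
      "tangent_iterate M R f x (1 / l) b s (Suc n) = tangent_iterate M R f x (1 / l) b (gd s) n"
proof (cases "b \<le> ereal (nrm (gd s))")
  case True
  define \<alpha> where "\<alpha> = (SOME \<alpha>. 0 < \<alpha> \<and> \<alpha> \<le> 1 \<and> ereal (tnorm M x (s - (\<alpha> * (1 / l)) *\<^sub>R gr s)) = b)"
  have "0 < \<alpha> \<and> \<alpha> \<le> 1 \<and> ereal (tnorm M x (s - (\<alpha> * (1 / l)) *\<^sub>R gr s)) = b"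
    unfolding \<alpha>_def
    by (rule someI_ex) (use exit_scaling[OF assms, of "1 / l" "gr s"] True in \<open>auto simp: tnorm_eq gd_step_def\<close>)
  then show thesis
    using True by (intro exit[of \<alpha>]) (auto simp: tnorm_eq gd_step_def Let_def \<alpha>_def)
next
  case False
  then show thesis by (intro step) (auto simp: tnorm_eq gd_step_def Let_def)
qed

text \<open>Improve or localize. The run agrees with the iterates of \<open>gd\<close> only as long
  as it does not exit; an exit shows in an end point of norm exactly b, so the statements about
  intermediate iterates are made under the other alternative.\<close>

lemma tangent_iterate_bounds:
  fixes s :: 'e and n :: nat
  assumes "ereal (nrm s) < b"
  defines "z \<equiv> tangent_iterate M R f x (1 / l) b s n"
  shows "ereal (nrm z) \<le> b \<and> fh z \<le> fh s \<and> (nrm (z - s))\<^sup>2 \<le> 2 / l * (real n * (fh s - fh z)) \<and>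
    (ereal (nrm z) = b \<or> (\<forall>j\<le>n. fh z \<le> fh ((gd ^^ j) s) \<and>
      (nrm ((gd ^^ j) s - s))\<^sup>2 \<le> 2 / l * (real j * (fh s - fh ((gd ^^ j) s)))))"
  using assms(1) unfolding z_def
proof (induction n arbitrary: s)
  case 0
  then show ?case by auto
next
  case (Suc n)
  \<comment> \<open>Prepends one step to a displacement bound for the j following steps.\<close>
  have merge: "(nrm (y - s))\<^sup>2 \<le> 2 / l * (real (Suc j) * (fh s - fh y))"
    if 1: "(nrm (gd s - s))\<^sup>2 \<le> 2 / l * (fh s - fh (gd s))"
      and 2: "(nrm (y - gd s))\<^sup>2 \<le> 2 / l * (real j * (fh (gd s) - fh y))"
      and 3: "fh (gd s) \<le> fh s" "fh y \<le> fh (gd s)" for y j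
  proof -
    have "nrm (y - s) \<le> nrm (y - gd s) + nrm (gd s - s)" by (rule nrm_diff_triangle)
    then have "(nrm (y - s))\<^sup>2 \<le> (nrm (y - gd s) + nrm (gd s - s))\<^sup>2" by (intro power_mono) auto
    also have "\<dots> \<le> (1 + real j) * (2 / l * (fh (gd s) - fh y) + 2 / l * (fh s - fh (gd s)))"
    proof (rule power2_sum_le_mult)
      show "0 \<le> 2 / l * (fh (gd s) - fh y)" "0 \<le> 2 / l * (fh s - fh (gd s))"
        using 3 l_pos by (auto intro!: mult_nonneg_nonneg)
      show "(nrm (y - gd s))\<^sup>2 \<le> real j * (2 / l * (fh (gd s) - fh y))"
        using 2 by (simp only: mult.left_commute)
    qed (use 1 in simp_all)
    finally show ?thesis by (simp add: algebra_simps add_divide_distrib)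
  qed
  from Suc.prems show ?case
  proof (cases rule: tangent_iterate_Suc_cases[where n = n])
    case (exit \<alpha>)
    have a: "0 \<le> \<alpha> * (1 / l)" "\<alpha> * (1 / l) \<le> 1 / l"
      using exit l_pos mult_right_mono[of \<alpha> 1 "1 / l"] by auto
    have b: "ereal (nrm s) \<le> b" "ereal (nrm (s - (\<alpha> * (1 / l)) *\<^sub>R gr s)) \<le> b"
      using Suc.prems exit by auto
    let ?z = "s - (\<alpha> * (1 / l)) *\<^sub>R gr s"
    note sd = step_decrease[OF b a]
    have le: "fh ?z \<le> fh s" using sd(1) a(1) by (smt (verit) zero_le_power2 mult_nonneg_nonneg divide_nonneg_nonneg)
    have "(nrm (?z - s))\<^sup>2 \<le> 2 / l * (fh s - fh ?z)"
    proof -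
      have "?z - s = - ((\<alpha> * (1 / l)) *\<^sub>R gr s)" by simp
      then have "nrm (?z - s) = nrm ((\<alpha> * (1 / l)) *\<^sub>R gr s)" by (simp only: nrm_minus)
      then show ?thesis using sd(2) by simp
    qed
    also have "\<dots> \<le> 2 / l * (real (Suc n) * (fh s - fh ?z))"
      using le l_pos mult_right_mono[of 1 "real (Suc n)" "fh s - fh ?z"] by (intro mult_left_mono) auto
    finally show ?thesis using exit(4) le unfolding exit(5) by simp
  next
    case step
    let ?z = "tangent_iterate M R f x (1 / l) b (gd s) n"
    have b: "ereal (nrm s) \<le> b" "ereal (nrm (s - (1 / l) *\<^sub>R gr s)) \<le> b"
      using Suc.prems step by (auto simp: gd_step_def)
    note sd = step_decrease[OF b, folded gd_step_def]
    have le: "fh (gd s) \<le> fh s" using sd(1) l_pos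
      by (smt (verit) zero_le_power2 mult_nonneg_nonneg divide_nonneg_nonneg)
    have mv: "(nrm (gd s - s))\<^sup>2 \<le> 2 / l * (fh s - fh (gd s))"
      using sd(2) l_pos by (simp add: gd_step_def)
    note IH = Suc.IH[OF step(1)]
    have loc: "fh ?z \<le> fh ((gd ^^ j) s) \<and> (nrm ((gd ^^ j) s - s))\<^sup>2 \<le> 2 / l * (real j * (fh s - fh ((gd ^^ j) s)))"
      if all: "\<forall>j\<le>n. fh ?z \<le> fh ((gd ^^ j) (gd s)) \<and>
        (nrm ((gd ^^ j) (gd s) - gd s))\<^sup>2 \<le> 2 / l * (real j * (fh (gd s) - fh ((gd ^^ j) (gd s))))"
        and j: "j \<le> Suc n" for j
    proof (cases j)
      case 0
      then show ?thesis using IH le by auto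
    next
      case (Suc i)
      then have i: "i \<le> n" using j by simp
      have eq: "(gd ^^ j) s = (gd ^^ i) (gd s)" using Suc by (simp add: funpow_swap1)
      have "fh ((gd ^^ i) (gd s)) \<le> fh (gd s)"
      proof (cases i)
        case 0 then show ?thesis by simp
      next
        case (Suc k)
        \<comment> \<open>Monotonicity comes from the displacement bound itself: its right-hand side
          dominates a square, and i is positive here.\<close>
        then have "0 \<le> 2 / l * (real i * (fh (gd s) - fh ((gd ^^ i) (gd s))))"
          using all i by (intro order_trans[OF zero_le_power2]) blast
        moreover have "0 < 2 / l" "0 < real i" using Suc l_pos by auto
        ultimately show ?thesis by (simp only: zero_le_mult_iff) linarith
      qed
      moreover have "fh ?z \<le> fh ((gd ^^ i) (gd s))"
        "(nrm ((gd ^^ i) (gd s) - gd s))\<^sup>2 \<le> 2 / l * (real i * (fh (gd s) - fh ((gd ^^ i) (gd s))))"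
        using all i by blast+
      ultimately show ?thesis using merge[OF mv _ le, of "(gd ^^ i) (gd s)" i]
        unfolding eq by (simp only: \<open>j = Suc i\<close> simp_thms)
    qed
    have z: "ereal (nrm ?z) \<le> b" "fh ?z \<le> fh (gd s)"
      "(nrm (?z - gd s))\<^sup>2 \<le> 2 / l * (real n * (fh (gd s) - fh ?z))" using IH by auto
    have "ereal (nrm ?z) = b \<or> (\<forall>j\<le>Suc n. fh ?z \<le> fh ((gd ^^ j) s) \<and>
        (nrm ((gd ^^ j) s - s))\<^sup>2 \<le> 2 / l * (real j * (fh s - fh ((gd ^^ j) s))))"
    proof (cases "ereal (nrm ?z) = b")
      case False
      then have all: "\<forall>j\<le>n. fh ?z \<le> fh ((gd ^^ j) (gd s)) \<and>
        (nrm ((gd ^^ j) (gd s) - gd s))\<^sup>2 \<le> 2 / l * (real j * (fh (gd s) - fh ((gd ^^ j) (gd s))))"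
        using IH by blast
      show ?thesis using loc[OF all] by blast
    qed simp
    then show ?thesis
      unfolding step(2) using z(1) order_trans[OF z(2) le] merge[OF mv z(3) le z(2)] by blast
  qed
qed

text \<open>The second assumption keeps the end point strictly inside the ball, which rules out an
  exit and makes the bounds on all iterates available.\<close>

lemma no_decrease_imp_localized:
  assumes sb: "ereal (nrm s) < b" and s: "ereal (nrm s + sqrt (2 / l * (real n * D))) < b"
    and D: "fh s - fh (tangent_iterate M R f x (1 / l) b s n) \<le> D" and j: "j \<le> n"
  shows "nrm ((gd ^^ j) s - s) \<le> sqrt (2 / l * (real n * D))"
proof -
  let ?z = "tangent_iterate M R f x (1 / l) b s n" and ?S = "sqrt (2 / l * (real n * D))"
  note tb = tangent_iterate_bounds[OF sb, of n]
  have D0: "0 \<le> D" using tb D by linarith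
  have "(nrm (?z - s))\<^sup>2 \<le> 2 / l * (real n * (fh s - fh ?z))" using tb by blast
  also have "\<dots> \<le> 2 / l * (real n * D)" using D l_pos by (intro mult_left_mono) auto
  finally have "nrm (?z - s) \<le> ?S" by (rule real_le_rsqrt)
  then have "nrm ?z \<le> nrm s + ?S" using nrm_triangle[of s "?z - s"] by simp
  then have "ereal (nrm ?z) < b" using s by (meson ereal_less_eq(3) le_less_trans)
  then have *: "fh ?z \<le> fh ((gd ^^ j) s)"
      "(nrm ((gd ^^ j) s - s))\<^sup>2 \<le> 2 / l * (real j * (fh s - fh ((gd ^^ j) s)))"
    using tb j by auto
  have "real j * (fh s - fh ((gd ^^ j) s)) \<le> real j * D"
    using *(1) D by (intro mult_left_mono) auto
  also have "\<dots> \<le> real n * D" using j D0 by (intro mult_right_mono) auto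
  finally have "(nrm ((gd ^^ j) s - s))\<^sup>2 \<le> 2 / l * (real n * D)"
    using *(2) l_pos by (meson divide_nonneg_pos mult_left_mono order_trans zero_le_numeral)
  then show ?thesis by (rule real_le_rsqrt)
qed

text \<open>Truncation does not spoil the drop: a shortened step has length b, which is at least e /
  l, and the drop is half the product of step length and gradient norm.\<close>

lemma large_gradient_decrease:
  assumes g: "e \<le> nrm (gr 0)" "0 < e" and eb: "ereal (e / l) \<le> b"
  shows "fh (tangent_iterate M R f x (1 / l) b 0 1) \<le> fh 0 - e\<^sup>2 / (2 * l)"
proof -
  have 0: "ereal (nrm 0) < b" using b_pos by (simp flip: zero_ereal_def)
  then show ?thesis
  proof (cases rule: tangent_iterate_Suc_cases[where n = 0])
    case (exit \<alpha>)
    let ?z = "0 - (\<alpha> * (1 / l)) *\<^sub>R gr 0"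
    have a: "0 \<le> \<alpha> * (1 / l)" "\<alpha> * (1 / l) \<le> 1 / l"
      using exit l_pos mult_right_mono[of \<alpha> 1 "1 / l"] by auto
    have "e / l \<le> nrm ?z" using eb exit(4) by (metis ereal_less_eq(3))
    also have "nrm ?z = (\<alpha> * (1 / l)) * nrm (gr 0)" using exit(2) l_pos by simp
    finally have "(e / l) * e \<le> ((\<alpha> * (1 / l)) * nrm (gr 0)) * nrm (gr 0)"
      using g l_pos a order_trans[OF _ \<open>e / l \<le> nrm ?z\<close>] by (intro mult_mono) (auto intro!: divide_nonneg_pos mult_nonneg_nonneg less_imp_le[OF exit(2)])
    moreover have "fh ?z \<le> fh 0 - (\<alpha> * (1 / l)) / 2 * (nrm (gr 0))\<^sup>2"
      by (rule step_decrease) (use 0 exit a in auto)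
    ultimately show ?thesis using exit(5) by (simp add: power2_eq_square)
  next
    case step
    have "fh (0 - (1 / l) *\<^sub>R gr 0) \<le> fh 0 - (1 / l) / 2 * (nrm (gr 0))\<^sup>2"
      by (rule step_decrease) (use 0 step l_pos in \<open>auto simp: gd_step_def\<close>)
    moreover have "e\<^sup>2 \<le> (nrm (gr 0))\<^sup>2" using g by (intro power_mono) auto
    then have "e\<^sup>2 / (2 * l) \<le> (1 / l) / 2 * (nrm (gr 0))\<^sup>2" using l_pos by (simp add: field_simps)
    ultimately show ?thesis using step(2) by (simp add: gd_step_def)
  qed
qed

lemma perturbation_bound:
  assumes "ereal (nrm s) \<le> b"
  shows "fh s \<le> fh 0 + nrm (gr 0) * nrm s + l / 2 * (nrm s)\<^sup>2"
  using descent[of 0 s] assms less_imp_le[OF b_pos] cauchy_schwarz'[of "gr 0" s] by (simp flip: zero_ereal_def)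

text \<open>Otherwise the gradient would grow along u faster than its Lipschitz constant permits.
  This makes I - H(0)/l positive semidefinite, so that its norm is governed by the bottom eigenvalue
  alone.\<close>

lemma Hess_upper: "metric M x (H 0 u) u \<le> l * metric M x u u"
proof (rule ccontr)
  assume n: "\<not> ?thesis"
  define \<psi> where "\<psi> t = metric M x (gr (0 + t *\<^sub>R u)) u - t * (l * metric M x u u)" for t
  have "(\<psi> has_real_derivative (metric M x (H (0 + 0 *\<^sub>R u) u) u - 1 * (l * metric M x u u))) (at 0)"
    unfolding \<psi>_def
    by (rule derivative_intros gr_along)+ (auto intro!: derivative_eq_intros)
  moreover have "metric M x (H (0 + 0 *\<^sub>R u) u) u - 1 * (l * metric M x u u) > 0" using n by simp
  ultimately obtain d where d: "d > 0" "\<And>h. 0 < h \<Longrightarrow> h < d \<Longrightarrow> \<psi> 0 < \<psi> (0 + h)"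
    using DERIV_pos_inc_right by blast
  obtain c where c: "c > 0" "ereal c \<le> b"
    using b_pos by (cases b) (auto intro: that[of 1] that)
  \<comment> \<open>Small enough for the strict increase of \<open>\<psi>\<close> and for staying in
    the ball of radius c.\<close>
  define h where "h = min (d / 2) (c / (nrm u + 1))"
  have u: "nrm u + 1 > 0" by (simp add: add_nonneg_pos)
  have h: "0 < h" "h < d" "h * nrm u \<le> c"
  proof -
    show "0 < h" using d c u by (simp add: h_def)
    show "h < d" using d(1) by (simp add: h_def min_less_iff_disj)
    have "h \<le> c / (nrm u + 1)" by (simp add: h_def)
    then have "h * (nrm u + 1) \<le> c" using u by (simp add: field_simps)
    moreover have "h * nrm u \<le> h * (nrm u + 1)" using \<open>0 < h\<close> by (intro mult_left_mono) auto
    ultimately show "h * nrm u \<le> c" by linarith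
  qed
  have inb: "ereal (nrm (h *\<^sub>R u)) \<le> b" using h c by (metis abs_of_pos ereal_less_eq(3) nrm_scale order_trans)
  have "metric M x (gr (h *\<^sub>R u) - gr 0) u \<le> nrm (gr (h *\<^sub>R u) - gr 0) * nrm u" by (rule cauchy_schwarz')
  also have "\<dots> \<le> (l * nrm (h *\<^sub>R u - 0)) * nrm u"
    using inb b_pos by (intro mult_right_mono lip') (auto simp flip: zero_ereal_def)
  also have "\<dots> = h * (l * metric M x u u)" using h by (simp add: power2_eq_square flip: nrm_sq)
  finally show False using d(2)[OF h(1,2)] by (simp add: \<psi>_def)
qed

lemma gradient_linearization:
  assumes "nrm s \<le> m" "nrm s' \<le> m" "ereal m \<le> b"
  shows "nrm (gr s' - gr s - H 0 (s' - s)) \<le> \<rho> * m * nrm (s' - s)"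
proof -
  define u where "u = s' - s"
  \<comment> \<open>The mean value theorem is scalar, so the error is paired with itself.\<close>
  define v where "v = gr s' - gr s - H 0 u"
  define \<phi> where "\<phi> t = metric M x (gr (s + t *\<^sub>R u)) v - t * metric M x (H 0 u) v" for t
  have der: "(\<phi> has_real_derivative (metric M x (H (s + t *\<^sub>R u) u) v - metric M x (H 0 u) v)) (at t)" for t
    unfolding \<phi>_def by (auto intro!: derivative_eq_intros gr_along)
  obtain \<tau> where \<tau>: "0 < \<tau>" "\<tau> < 1" "\<phi> 1 - \<phi> 0 =
      (1 - 0) * (metric M x (H (s + \<tau> *\<^sub>R u) u) v - metric M x (H 0 u) v)"
    using MVT2[of 0 1 \<phi>, OF _ der] by auto
  have mb: "nrm (s + \<tau> *\<^sub>R u) \<le> m"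
  proof -
    have "s + \<tau> *\<^sub>R u = (1 - \<tau>) *\<^sub>R s + \<tau> *\<^sub>R s'" by (simp add: u_def algebra_simps)
    then have "nrm (s + \<tau> *\<^sub>R u) \<le> (1 - \<tau>) * nrm s + \<tau> * nrm s'"
      using nrm_triangle[of "(1 - \<tau>) *\<^sub>R s" "\<tau> *\<^sub>R s'"] \<tau> by simp
    also have "\<dots> \<le> (1 - \<tau>) * m + \<tau> * m" using \<tau> assms by (intro add_mono mult_left_mono) auto
    finally show ?thesis by (simp add: algebra_simps)
  qed
  have "(nrm v)\<^sup>2 = \<phi> 1 - \<phi> 0" by (simp add: \<phi>_def nrm_sq u_def v_def)
  also have "\<dots> = metric M x (H (s + \<tau> *\<^sub>R u) u - H 0 u) v" using \<tau> by simp
  also have "\<dots> \<le> nrm (H (s + \<tau> *\<^sub>R u) u - H 0 u) * nrm v" by (rule cauchy_schwarz')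
  also have "\<dots> \<le> (\<rho> * nrm (s + \<tau> *\<^sub>R u) * nrm u) * nrm v"
    using mb assms(3) by (intro mult_right_mono Hess_lip') (auto intro: order_trans[of _ "ereal m"])
  also have "\<dots> \<le> (\<rho> * m * nrm u) * nrm v"
    using mb rho_pos by (intro mult_right_mono mult_left_mono) auto
  finally have "nrm v * nrm v \<le> (\<rho> * m * nrm u) * nrm v" by (simp add: power2_eq_square)
  moreover have "0 \<le> \<rho> * m * nrm u"
    using assms(1) rho_pos nrm_nonneg[of s] by (auto intro!: mult_nonneg_nonneg nrm_nonneg intro: order_trans simp del: nrm_nonneg)
  ultimately have "nrm v \<le> \<rho> * m * nrm u"
    by (cases "nrm v = 0") (auto simp: less_le)
  then show ?thesis by (simp add: v_def u_def)
qed

text \<open>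
  The difference of two runs of gradient descent follows the linear recursion
  \<open>d \<mapsto> (I - H(0)/l) d\<close> up to a relative error \<open>\<rho> m / l\<close> per step; along the bottom eigenvector of
  the Hessian the linear part grows by the factor \<open>1 + \<gamma>/l\<close>, which is the largest one possible.
\<close>

lemma gd_separation:
  fixes \<gamma> m :: real
  assumes d0: "H 0 d0 = - \<gamma> *\<^sub>R d0" and low: "\<And>u. - \<gamma> * metric M x u u \<le> metric M x (H 0 u) u"
    and \<gamma>: "0 \<le> \<gamma>" and mb: "ereal m \<le> b" and m: "0 \<le> m"
    and loc: "\<And>j. j < n \<Longrightarrow> nrm ((gd ^^ j) s) \<le> m" "\<And>j. j < n \<Longrightarrow> nrm ((gd ^^ j) (s + d0)) \<le> m"
  shows "(1 + \<gamma> / l) ^ n * nrm d0 * (2 - (1 + \<rho> * m / l) ^ n) \<le> nrm ((gd ^^ n) (s + d0) - (gd ^^ n) s)"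
proof -
  define c k where "c = 1 + \<gamma> / l" and "k = \<rho> * m / l"
  have c: "c \<ge> 1" using \<gamma> l_pos by (simp add: c_def)
  have k: "k \<ge> 0" using m rho_pos l_pos by (simp add: k_def)
  define A where "A u = u - (1 / l) *\<^sub>R H 0 u" for u
  have Hlin: "linear (H 0)" using deriv2 has_derivative_linear by blast
  have Alin: "linear A" unfolding A_def
    by (intro linearI) (simp_all add: linear_add[OF Hlin] linear_scale[OF Hlin] algebra_simps)
  have A_le: "nrm (A u) \<le> c * nrm u" for u
  proof (rule psd_nrm_le[OF Alin])
    fix u v
    show "metric M x (A u) v = metric M x u (A v)" by (simp add: A_def Hess_sym)
    show "0 \<le> metric M x (A v) v" using Hess_upper[of v] l_pos by (simp add: A_def field_simps)
    show "metric M x (A v) v \<le> c * metric M x v v"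
    proof -
      have "(1 / l) * (- \<gamma> * metric M x v v) \<le> (1 / l) * metric M x (H 0 v) v"
        using low l_pos by (intro mult_left_mono) auto
      then show ?thesis by (simp add: A_def c_def algebra_simps)
    qed
  qed
  have A_d0: "A d0 = c *\<^sub>R d0" by (simp add: A_def d0 c_def algebra_simps)
  define D where "D j = (gd ^^ j) (s + d0) - (gd ^^ j) s" for j
  have step: "nrm (D (Suc j) - A (D j)) \<le> k * nrm (D j)" if "j < n" for j
  proof -
    have "D (Suc j) - A (D j) = - (1 / l) *\<^sub>R (gr ((gd ^^ j) (s + d0)) - gr ((gd ^^ j) s) - H 0 (D j))"
      by (simp add: D_def A_def gd_step_def algebra_simps)
    then have "nrm (D (Suc j) - A (D j)) =
        (1 / l) * nrm (gr ((gd ^^ j) (s + d0)) - gr ((gd ^^ j) s) - H 0 (D j))"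
      using l_pos by (simp only: nrm_scale) simp
    also have "\<dots> \<le> (1 / l) * (\<rho> * m * nrm (D j))"
      unfolding D_def using l_pos by (intro mult_left_mono gradient_linearization loc mb that) auto
    finally show ?thesis by (simp add: k_def)
  qed
  \<comment> \<open>The relative deviation from the pure linear growth of d0 compounds by the factor
    1 + k at each step.\<close>
  have err: "nrm (D j - c ^ j *\<^sub>R d0) \<le> c ^ j * nrm d0 * ((1 + k) ^ j - 1)" if "j \<le> n" for j
    using that
  proof (induction j)
    case 0
    then show ?case by (simp add: D_def)
  next
    case (Suc j)
    let ?q = "D j - c ^ j *\<^sub>R d0"
    have IH: "nrm ?q \<le> c ^ j * nrm d0 * ((1 + k) ^ j - 1)" using Suc by simp
    have "D (Suc j) - c ^ Suc j *\<^sub>R d0 = A ?q + (D (Suc j) - A (D j))"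
      by (simp add: linear_diff[OF Alin] linear_scale[OF Alin] A_d0 mult.commute)
    then have "nrm (D (Suc j) - c ^ Suc j *\<^sub>R d0) \<le> nrm (A ?q) + nrm (D (Suc j) - A (D j))"
      by (metis nrm_triangle)
    also have "\<dots> \<le> c * nrm ?q + k * nrm (D j)"
      using A_le step[of j] Suc.prems by (intro add_mono) auto
    \<comment> \<open>Inserting the factor c, which is at least 1, loses little and gives the closed
      form of the induction.\<close>
    also have "\<dots> \<le> c * nrm ?q + c * (k * (nrm ?q + c ^ j * nrm d0))"
    proof -
      have "nrm (D j) \<le> nrm ?q + c ^ j * nrm d0"
        using nrm_triangle[of ?q "c ^ j *\<^sub>R d0"] c by simp
      then have "k * nrm (D j) \<le> k * (nrm ?q + c ^ j * nrm d0)" using k by (intro mult_left_mono)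
      also have "\<dots> \<le> c * (k * (nrm ?q + c ^ j * nrm d0))"
        using mult_right_mono[OF c, of "k * (nrm ?q + c ^ j * nrm d0)"] k c by simp
      finally show ?thesis by simp
    qed
    also have "\<dots> = c * ((1 + k) * nrm ?q + k * (c ^ j * nrm d0))" by (simp add: algebra_simps)
    also have "\<dots> \<le> c * ((1 + k) * (c ^ j * nrm d0 * ((1 + k) ^ j - 1)) + k * (c ^ j * nrm d0))"
      using IH c k by (intro mult_left_mono add_right_mono) auto
    also have "\<dots> = c ^ Suc j * nrm d0 * ((1 + k) ^ Suc j - 1)" by (simp add: algebra_simps)
    finally show ?case .
  qed
  have "nrm (c ^ n *\<^sub>R d0) \<le> nrm (D n) + nrm (D n - c ^ n *\<^sub>R d0)"
    using nrm_diff[of "D n" "D n - c ^ n *\<^sub>R d0"] by simp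
  then have "c ^ n * nrm d0 \<le> nrm (D n) + c ^ n * nrm d0 * ((1 + k) ^ n - 1)"
    using err[of n] c by simp
  then show ?thesis by (simp add: D_def c_def k_def algebra_simps)
qed

end

section \<open>Riemannian geometry in charts\<close>

text \<open>The conditions at a single point, with \<open>D w u v\<close> in the role of the
  derivative of the metric in direction w. Existence and uniqueness of the connection become linear
  algebra.\<close>

definition levi_civita_form :: "('e::euclidean_space \<Rightarrow> 'e \<Rightarrow> real) \<Rightarrow> ('e \<Rightarrow> 'e \<Rightarrow> 'e \<Rightarrow> real) \<Rightarrow> ('e \<Rightarrow> 'e \<Rightarrow> 'e) \<Rightarrow> bool" where
  "levi_civita_form B D \<Gamma> \<longleftrightarrow> bilinear \<Gamma> \<and> (\<forall>u v. \<Gamma> u v = \<Gamma> v u) \<and>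
     (\<forall>u v w. D w u v = B (\<Gamma> w u) v + B u (\<Gamma> w v))"

context inner_form begin

text \<open>The Koszul formula for fields with constant coordinates, whose brackets vanish. It
  yields uniqueness, and its right-hand side defines the connection in
  \<open>levi_civita_form_exists\<close>.\<close>

lemma koszul:
  assumes "levi_civita_form B D \<Gamma>"
  shows "2 * B (\<Gamma> u v) w = D u v w + D v u w - D w u v"
proof -
  have s: "\<Gamma> a b = \<Gamma> b a" and c: "D w u v = B (\<Gamma> w u) v + B u (\<Gamma> w v)" for a b u v w
    using assms by (auto simp: levi_civita_form_def)
  have "D u v w + D v u w - D w u v =
      B (\<Gamma> u v) w + B v (\<Gamma> u w) + (B (\<Gamma> u v) w + B u (\<Gamma> v w)) - (B v (\<Gamma> u w) + B u (\<Gamma> v w))"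
    unfolding c by (simp only: s[of v u] s[of w u] s[of w v] sym[of "\<Gamma> u w" v])
  then show ?thesis by simp
qed

lemma levi_civita_form_unique:
  assumes "levi_civita_form B D \<Gamma>" "levi_civita_form B D \<Gamma>'"
  shows "\<Gamma> = \<Gamma>'"
proof (intro ext eqI)
  fix u v w
  show "B (\<Gamma> u v) w = B (\<Gamma>' u v) w" using koszul[OF assms(1), of u v w] koszul[OF assms(2), of u v w] by simp
qed

lemma levi_civita_form_exists:
  assumes l1: "\<And>u v. linear (\<lambda>w. D w u v)" and l2: "\<And>w v. linear (\<lambda>u. D w u v)"
    and s: "\<And>w u v. D w u v = D w v u"
  shows "\<exists>\<Gamma>. levi_civita_form B D \<Gamma>"
proof -
  have l3: "linear (\<lambda>v. D w u v)" for w u using l2[of w u] by (simp only: s[of w u])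
  define K where "K u v w = (D u v w + D v u w - D w u v) / 2" for u v w
  have "linear (K u v)" for u v unfolding K_def
    by (intro linearI) (simp_all add: linear_add[OF l1] linear_scale[OF l1] linear_add[OF l3] linear_scale[OF l3]
        algebra_simps add_divide_distrib diff_divide_distrib)
  then have "\<exists>g. \<forall>w. B g w = K u v w" for u v by (rule riesz)
  then have "\<forall>u v. \<exists>g. \<forall>w. B g w = K u v w" by blast
  then have "\<exists>\<Gamma>. \<forall>u v w. B (\<Gamma> u v) w = K u v w" by (simp only: choice_iff)
  then obtain \<Gamma> where \<Gamma>: "\<And>u v w. B (\<Gamma> u v) w = K u v w" by blast
  have Ks: "K u v w = K v u w" for u v w unfolding K_def using s[of w u v] by simp
  have \<Gamma>s: "\<Gamma> u v = \<Gamma> v u" for u v by (rule eqI) (simp only: \<Gamma> Ks[of u v])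
  moreover have "bilinear \<Gamma>"
  proof -
    have "linear (\<lambda>u. \<Gamma> u v)" for v
      by (intro linearI eqI) (simp_all add: \<Gamma> K_def linear_add[OF l1] linear_scale[OF l1] linear_add[OF l2]
          linear_scale[OF l2] linear_add[OF l3] linear_scale[OF l3] algebra_simps add_divide_distrib diff_divide_distrib)
    moreover from this have "linear (\<lambda>v. \<Gamma> u v)" for u by (simp only: \<Gamma>s[of u])
    ultimately show ?thesis by (simp add: bilinear_def)
  qed
  moreover have "D w u v = B (\<Gamma> w u) v + B u (\<Gamma> w v)" for u v w
    unfolding sym[of u "\<Gamma> w v"] \<Gamma> K_def using s[of w u v] s[of u w v] s[of v w u] by (simp add: field_simps)
  ultimately show ?thesis unfolding levi_civita_form_def by blast
qed

end

locale riemannian =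
  fixes M :: "('m::{t2_space, second_countable_topology}, 'e::euclidean_space) manifold"
  assumes riemannian: "riemannian_manifold M"
begin

abbreviation "tc \<equiv> tangent_change"
abbreviation "g \<equiv> metric_in_chart M"
abbreviation "dg c p w u v \<equiv> frechet_derivative (\<lambda>q. g c q u v) (at p) w"
abbreviation "c0 \<equiv> chart_at M"

definition trans :: "('m, 'e) chart \<Rightarrow> ('m, 'e) chart \<Rightarrow> 'e \<Rightarrow> 'e" where
  "trans c c' = snd c' \<circ> chart_inv c"

definition overlap :: "('m, 'e) chart \<Rightarrow> ('m, 'e) chart \<Rightarrow> 'e set" where
  "overlap c c' = snd c ` (fst c \<inter> fst c')"

lemma smooth_mfd: "smooth_manifold M"
  using riemannian by (simp add: riemannian_manifold_def)

lemma
  assumes "c \<in> atlas M"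
  shows open_dom: "open (fst c)" and open_img: "open (chart_image c)"
    and homeo: "homeomorphism (fst c) (chart_image c) (snd c) (chart_inv c)"
  using smooth_mfd assms by (auto simp: smooth_manifold_def)

lemma c0 [simp]: "c0 x \<in> atlas M" "x \<in> fst (c0 x)"
  using smooth_mfd by (auto simp: smooth_manifold_def)

lemma chart_inv_left [simp]: "c \<in> atlas M \<Longrightarrow> x \<in> fst c \<Longrightarrow> chart_inv c (snd c x) = x"
  using homeo homeomorphism_apply1 by blast

lemma chart_inv_right [simp]: "c \<in> atlas M \<Longrightarrow> p \<in> chart_image c \<Longrightarrow> snd c (chart_inv c p) = p"
  using homeo homeomorphism_apply2 by blast

lemma chart_inv_in [simp]: "c \<in> atlas M \<Longrightarrow> p \<in> chart_image c \<Longrightarrow> chart_inv c p \<in> fst c"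
  by (auto simp: chart_image_def)

lemma chart_image_in [simp]: "x \<in> fst c \<Longrightarrow> snd c x \<in> chart_image c"
  by (simp add: chart_image_def)

lemma overlap_iff: "c \<in> atlas M \<Longrightarrow> p \<in> overlap c c' \<longleftrightarrow> p \<in> chart_image c \<and> chart_inv c p \<in> fst c'"
  by (auto simp: overlap_def chart_image_def)

lemma overlap_in: "x \<in> fst c \<Longrightarrow> x \<in> fst c' \<Longrightarrow> snd c x \<in> overlap c c'"
  by (auto simp: overlap_def)

lemma open_overlap:
  assumes "c \<in> atlas M" "c' \<in> atlas M"
  shows "open (overlap c c')"
proof -
  have "overlap c c' = chart_image c \<inter> chart_inv c -` fst c'" using overlap_iff[OF assms(1), of _ c'] by auto
  moreover have "continuous_on (chart_image c) (chart_inv c)"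
    using homeo[OF assms(1)] by (simp add: homeomorphism_def)
  ultimately show ?thesis
    using continuous_open_preimage[OF _ open_img[OF assms(1)] open_dom[OF assms(2)]] by simp
qed

lemma trans_smooth: "c \<in> atlas M \<Longrightarrow> c' \<in> atlas M \<Longrightarrow> smooth_on (trans c c') (overlap c c')"
  using smooth_mfd by (auto simp: smooth_manifold_def trans_def overlap_def)

lemma trans_apply: "c \<in> atlas M \<Longrightarrow> x \<in> fst c \<Longrightarrow> trans c c' (snd c x) = snd c' x"
  by (simp add: trans_def)

lemma tc_eq: "tc c c' x = frechet_derivative (trans c c') (at (snd c x))"
  by (simp add: tangent_change_def trans_def)

lemma trans_deriv:
  assumes "c \<in> atlas M" "c' \<in> atlas M" "x \<in> fst c" "x \<in> fst c'"
  shows "(trans c c' has_derivative tc c c' x) (at (snd c x))"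
  unfolding tc_eq
  by (rule smooth_on_derivative(2)[OF trans_smooth[OF assms(1,2)] overlap_in[OF assms(3,4)]])

lemma tc_linear:
  assumes "c \<in> atlas M" "c' \<in> atlas M" "x \<in> fst c" "x \<in> fst c'"
  shows "linear (tc c c' x)"
  using trans_deriv[OF assms] by (rule has_derivative_linear)

lemma tc_id [simp]:
  assumes "c \<in> atlas M" "x \<in> fst c"
  shows "tc c c x v = v"
proof -
  have "((\<lambda>p. p) has_derivative (\<lambda>v. v)) (at (snd c x))" by (rule has_derivative_ident)
  then have "(trans c c has_derivative (\<lambda>v. v)) (at (snd c x))"
    by (rule has_derivative_transform_within_open[OF _ open_img[OF assms(1)]]) (use assms in \<open>auto simp: trans_def\<close>)
  from fun_cong[OF has_derivative_unique[OF this trans_deriv[OF assms(1,1,2,2)]]] show ?thesis by simp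
qed

text \<open>The cocycle identity: the chain rule for transition maps, which agree with each other
  only on the overlap.\<close>

lemma tc_comp:
  assumes c: "c \<in> atlas M" "c' \<in> atlas M" "c'' \<in> atlas M" and x: "x \<in> fst c" "x \<in> fst c'" "x \<in> fst c''"
  shows "tc c' c'' x (tc c c' x v) = tc c c'' x v"
proof -
  have "((\<lambda>p. trans c' c'' (trans c c' p)) has_derivative (\<lambda>v. tc c' c'' x (tc c c' x v))) (at (snd c x))"
    by (rule has_derivative_compose[where g = "trans c' c''", OF trans_deriv[OF c(1,2) x(1,2)]])
      (use trans_deriv[OF c(2,3) x(2,3)] in \<open>simp add: trans_apply[OF c(1) x(1)]\<close>)
  then have "(trans c c'' has_derivative (\<lambda>v. tc c' c'' x (tc c c' x v))) (at (snd c x))"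
    by (rule has_derivative_transform_within_open[OF _ open_overlap[OF c(1,2)] overlap_in[OF x(1,2)]])
      (use c in \<open>auto simp: trans_def overlap_iff\<close>)
  from fun_cong[OF has_derivative_unique[OF this trans_deriv[OF c(1,3) x(1,3)]]] show ?thesis .
qed

lemma tc_inv [simp]:
  assumes "c \<in> atlas M" "c' \<in> atlas M" "x \<in> fst c" "x \<in> fst c'"
  shows "tc c' c x (tc c c' x v) = v"
  using tc_comp[OF assms(1,2,1,3,4,3)] assms by simp

lemma metric_inner: "is_inner_product (metric M x)"
  using riemannian by (simp add: riemannian_manifold_def)

lemma g_at: "c \<in> atlas M \<Longrightarrow> x \<in> fst c \<Longrightarrow>
    g c (snd c x) u v = metric M x (tc c (c0 x) x u) (tc c (c0 x) x v)"
  by (simp add: metric_in_chart_def)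

lemma metric_eq_g:
  assumes "c \<in> atlas M" "x \<in> fst c"
  shows "metric M x u v = g c (snd c x) (tc (c0 x) c x u) (tc (c0 x) c x v)"
  using assms by (simp add: g_at)

lemma g_c0: "g (c0 x) (snd (c0 x) x) = metric M x"
  by (intro ext) (simp add: g_at)

lemma g_change:
  assumes "c \<in> atlas M" "c' \<in> atlas M" "x \<in> fst c" "x \<in> fst c'"
  shows "g c (snd c x) u v = g c' (snd c' x) (tc c c' x u) (tc c c' x v)"
  using assms by (simp add: g_at tc_comp)

lemma g_inner:
  assumes "c \<in> atlas M" "p \<in> chart_image c"
  shows "is_inner_product (g c p)"
proof -
  define x where "x = chart_inv c p"
  have x: "x \<in> fst c" "snd c x = p" using assms by (auto simp: x_def)
  interpret I: inner_form "metric M x" using metric_inner by unfold_locales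
  have lin: "linear (tc c (c0 x) x)" using assms x by (intro tc_linear) auto
  have gp: "g c p u v = metric M x (tc c (c0 x) x u) (tc c (c0 x) x v)" for u v
    using g_at[OF assms(1) x(1), of u v] unfolding x(2) .
  have "bilinear (g c p)"
    unfolding bilinear_def gp[abs_def]
    by (auto intro!: linearI simp: linear_add[OF lin] linear_scale[OF lin])
  moreover have "g c p v v > 0" if "v \<noteq> 0" for v
  proof -
    have "tc c (c0 x) x v \<noteq> 0"
    proof
      assume "tc c (c0 x) x v = 0"
      then have "tc (c0 x) c x 0 = v" using tc_inv[of c "c0 x" x v] assms x by simp
      moreover have "tc (c0 x) c x 0 = 0" using assms x by (intro linear_0 tc_linear) auto
      ultimately show False using that by simp
    qed
    then show ?thesis unfolding gp by (rule I.pos)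
  qed
  moreover have "g c p u v = g c p v u" for u v unfolding gp by (rule I.sym)
  ultimately show ?thesis unfolding is_inner_product_def by blast
qed

lemma g_bilinear: "c \<in> atlas M \<Longrightarrow> p \<in> chart_image c \<Longrightarrow> bilinear (g c p)"
  using g_inner by (simp add: is_inner_product_def)

lemma g_sym: "c \<in> atlas M \<Longrightarrow> p \<in> chart_image c \<Longrightarrow> g c p u v = g c p v u"
  using g_inner by (simp add: is_inner_product_def)

lemma g_smooth: "c \<in> atlas M \<Longrightarrow> smooth_on (\<lambda>p. g c p u v) (chart_image c)"
  using riemannian by (simp add: riemannian_manifold_def)

lemma g_deriv: "c \<in> atlas M \<Longrightarrow> p \<in> chart_image c \<Longrightarrow>
    ((\<lambda>q. g c q u v) has_derivative (\<lambda>w. dg c p w u v)) (at p)"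
  using smooth_on_derivative(2)[OF g_smooth] .

lemma dg_eq:
  assumes "c \<in> atlas M" "p \<in> chart_image c" "((\<lambda>q. g c q u v) has_derivative D) (at p)"
  shows "dg c p w u v = D w"
  using fun_cong[OF has_derivative_unique[OF g_deriv[OF assms(1,2)] assms(3)]] .

lemma dg_linear1: "c \<in> atlas M \<Longrightarrow> p \<in> chart_image c \<Longrightarrow> linear (\<lambda>w. dg c p w u v)"
  by (rule has_derivative_linear[OF g_deriv])

lemma dg_sym:
  assumes "c \<in> atlas M" "p \<in> chart_image c"
  shows "dg c p w u v = dg c p w v u"
proof -
  have "((\<lambda>q. g c q u v) has_derivative (\<lambda>w. dg c p w v u)) (at p)"
    by (rule has_derivative_transform_within_open[OF g_deriv[OF assms] open_img[OF assms(1)] assms(2)])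
      (rule g_sym[OF assms(1)])
  then show ?thesis by (rule dg_eq[OF assms])
qed

lemma dg_linear2:
  assumes "c \<in> atlas M" "p \<in> chart_image c"
  shows "linear (\<lambda>u. dg c p w u v)"
proof (rule linearI)
  fix u1 u2 :: 'e and a :: real
  note tr = has_derivative_transform_within_open[OF _ open_img[OF assms(1)] assms(2)]
  have "((\<lambda>q. g c q (u1 + u2) v) has_derivative (\<lambda>w. dg c p w u1 v + dg c p w u2 v)) (at p)"
    by (rule tr[OF has_derivative_add[OF g_deriv[OF assms] g_deriv[OF assms]]])
      (simp add: bilinear_ladd[OF g_bilinear[OF assms(1)]])
  then show "dg c p w (u1 + u2) v = dg c p w u1 v + dg c p w u2 v" by (rule dg_eq[OF assms])
  have "((\<lambda>q. g c q (a *\<^sub>R u1) v) has_derivative (\<lambda>w. a *\<^sub>R dg c p w u1 v)) (at p)"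
    by (rule tr[OF has_derivative_scaleR_right[OF g_deriv[OF assms]]])
      (simp add: bilinear_lmul[OF g_bilinear[OF assms(1)]])
  then show "dg c p w (a *\<^sub>R u1) v = a *\<^sub>R dg c p w u1 v" by (rule dg_eq[OF assms])
qed

text \<open>Discharges the definite description in \<open>levi_civita\<close>; afterwards only the
  defining properties are used.\<close>

lemma levi_civita_works:
  assumes "c \<in> atlas M" "p \<in> chart_image c"
  shows "levi_civita_form (g c p) (dg c p) (levi_civita M c p)"
proof -
  interpret I: inner_form "g c p" using g_inner[OF assms] by unfold_locales
  have "\<exists>!\<Gamma>. levi_civita_form (g c p) (dg c p) \<Gamma>"
    using I.levi_civita_form_exists[OF dg_linear1[OF assms] dg_linear2[OF assms] dg_sym[OF assms]]
      I.levi_civita_form_unique by blast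
  then have "levi_civita_form (g c p) (dg c p) (THE \<Gamma>. levi_civita_form (g c p) (dg c p) \<Gamma>)"
    by (rule theI')
  then show ?thesis unfolding levi_civita_def levi_civita_form_def .
qed

lemma levi_civita_unique:
  assumes "c \<in> atlas M" "p \<in> chart_image c" "levi_civita_form (g c p) (dg c p) \<Gamma>"
  shows "\<Gamma> = levi_civita M c p"
proof -
  interpret I: inner_form "g c p" using g_inner[OF assms(1,2)] by unfold_locales
  show ?thesis by (rule I.levi_civita_form_unique[OF assms(3) levi_civita_works[OF assms(1,2)]])
qed

lemma
  assumes "c \<in> atlas M" "p \<in> chart_image c"
  shows levi_civita_bilinear: "bilinear (levi_civita M c p)"
    and levi_civita_sym: "levi_civita M c p u v = levi_civita M c p v u"
    and levi_civita_compat: "dg c p w u v = g c p (levi_civita M c p w u) v + g c p u (levi_civita M c p w v)"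
  using levi_civita_works[OF assms] unfolding levi_civita_form_def by blast+

definition d2trans :: "('m, 'e) chart \<Rightarrow> ('m, 'e) chart \<Rightarrow> 'm \<Rightarrow> 'e \<Rightarrow> 'e \<Rightarrow> 'e" where
  "d2trans c c' x w u = frechet_derivative (\<lambda>y. frechet_derivative (trans c c') (at y) u) (at (snd c x)) w"

lemma trans_deriv2:
  assumes "c \<in> atlas M" "c' \<in> atlas M" "x \<in> fst c" "x \<in> fst c'"
  shows "((\<lambda>y. frechet_derivative (trans c c') (at y) u) has_derivative (\<lambda>w. d2trans c c' x w u)) (at (snd c x))"
  unfolding d2trans_def
  by (rule smooth_on_derivative(2)[OF smooth_on_derivative(1)[OF trans_smooth[OF assms(1,2)]] overlap_in[OF assms(3,4)]])

lemma d2trans_sym: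
  assumes "c \<in> atlas M" "c' \<in> atlas M" "x \<in> fst c" "x \<in> fst c'"
  shows "d2trans c c' x u v = d2trans c c' x v u"
  using second_derivative_symmetric'[OF open_overlap[OF assms(1,2)] overlap_in[OF assms(3,4)]
      smooth_on_derivative(2)[OF trans_smooth[OF assms(1,2)]] trans_deriv2[OF assms, of v] trans_deriv2[OF assms, of u]]
  by simp

lemma tc_at: "c \<in> atlas M \<Longrightarrow> p \<in> chart_image c \<Longrightarrow> tc c c' (chart_inv c p) = frechet_derivative (trans c c') (at p)"
  by (simp add: tc_eq)

text \<open>The transformation law of Christoffel symbols. The connection of c' is pulled back,
  corrected by the second derivative of the transition map, and recognised by uniqueness. Its
  compatibility comes from differentiating the transformation law of the metric.\<close>

lemma levi_civita_change:
  assumes c: "c \<in> atlas M" "c' \<in> atlas M" and x: "x \<in> fst c" "x \<in> fst c'"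
  shows "tc c c' x (levi_civita M c (snd c x) u v) =
    levi_civita M c' (snd c' x) (tc c c' x u) (tc c c' x v) + d2trans c c' x u v"
proof -
  let ?p = "snd c x" and ?q = "snd c' x" and ?A = "tc c c' x" and ?A' = "tc c' c x"
  let ?\<Gamma>' = "levi_civita M c' (snd c' x)"
  define \<Gamma> where "\<Gamma> u v = ?A' (?\<Gamma>' (?A u) (?A v) + d2trans c c' x u v)" for u v
  have p: "?p \<in> chart_image c" and q: "?q \<in> chart_image c'" using x by auto
  have A: "linear ?A" and A': "linear ?A'" using c x by (auto intro: tc_linear)
  have AA': "?A (?A' v) = v" and A'A: "?A' (?A v) = v" for v using c x by auto
  note bl = levi_civita_bilinear[OF c(2) q]
  have d1: "linear (\<lambda>w. d2trans c c' x w u)" for u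
    by (rule has_derivative_linear[OF trans_deriv2[OF c x]])
  have d2: "linear (\<lambda>u. d2trans c c' x w u)" for w
    using d1[of w] by (simp only: d2trans_sym[OF c x, of w])
  have \<Gamma>s: "\<Gamma> u v = \<Gamma> v u" for u v
    unfolding \<Gamma>_def by (simp only: levi_civita_sym[OF c(2) q, of "?A u"] d2trans_sym[OF c x, of u])
  moreover have "bilinear \<Gamma>"
  proof -
    have "linear (\<lambda>u. \<Gamma> u v)" for v unfolding \<Gamma>_def
      by (intro linearI) (simp_all add: linear_add[OF A] linear_scale[OF A] linear_add[OF A'] linear_scale[OF A']
        bilinear_ladd[OF bl] bilinear_lmul[OF bl] linear_add[OF d1] linear_scale[OF d1] algebra_simps)
    moreover from this have "linear (\<lambda>v. \<Gamma> u v)" for u by (simp only: \<Gamma>s[of u])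
    ultimately show ?thesis by (simp add: bilinear_def)
  qed
  moreover have "dg c ?p w u v = g c ?p (\<Gamma> w u) v + g c ?p u (\<Gamma> w v)" for u v w
  proof -
    have gc: "((\<lambda>y. g c' (trans c c' y) a b) has_derivative (\<lambda>w. dg c' ?q (?A w) a b)) (at ?p)" for a b
      by (rule has_derivative_compose[where g = "\<lambda>y. g c' y a b", OF trans_deriv[OF c x]])
        (use g_deriv[OF c(2) q] in \<open>simp add: trans_apply[OF c(1) x(1)]\<close>)
    have bi: "bilinear (g c' (trans c c' y))" if "y \<in> overlap c c'" for y
      using that c by (intro g_bilinear) (auto simp: overlap_iff trans_def)
    have "((\<lambda>y. g c' (trans c c' y) (frechet_derivative (trans c c') (at y) u) (frechet_derivative (trans c c') (at y) v))
       has_derivative (\<lambda>w. dg c' ?q (?A w) (?A u) (?A v) + g c' ?q (d2trans c c' x w u) (?A v)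
         + g c' ?q (?A u) (d2trans c c' x w v))) (at ?p)"
      using has_derivative_moving_bilinear[OF open_overlap[OF c] overlap_in[OF x] bi gc
          trans_deriv2[OF c x, of u] trans_deriv2[OF c x, of v]]
      by (simp add: trans_apply[OF c(1) x(1)] flip: tc_eq)
    then have "((\<lambda>y. g c y u v) has_derivative (\<lambda>w. dg c' ?q (?A w) (?A u) (?A v) + g c' ?q (d2trans c c' x w u) (?A v)
         + g c' ?q (?A u) (d2trans c c' x w v))) (at ?p)"
    proof (rule has_derivative_transform_within_open[OF _ open_overlap[OF c] overlap_in[OF x]])
      fix y assume "y \<in> overlap c c'"
      then have y: "y \<in> chart_image c" "chart_inv c y \<in> fst c'" using c overlap_iff by auto
      show "g c' (trans c c' y) (frechet_derivative (trans c c') (at y) u) (frechet_derivative (trans c c') (at y) v)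
          = g c y u v"
        using g_change[OF c _ y(2), of u v] y c by (simp add: tc_at trans_def)
    qed
    then have "dg c ?p w u v = dg c' ?q (?A w) (?A u) (?A v) + g c' ?q (d2trans c c' x w u) (?A v)
         + g c' ?q (?A u) (d2trans c c' x w v)"
      by (rule dg_eq[OF c(1) p])
    also have "\<dots> = g c' ?q (?\<Gamma>' (?A w) (?A u) + d2trans c c' x w u) (?A v)
        + g c' ?q (?A u) (?\<Gamma>' (?A w) (?A v) + d2trans c c' x w v)"
      unfolding levi_civita_compat[OF c(2) q]
      by (simp add: bilinear_ladd[OF g_bilinear[OF c(2) q]] bilinear_radd[OF g_bilinear[OF c(2) q]])
    also have "\<dots> = g c ?p (\<Gamma> w u) v + g c ?p u (\<Gamma> w v)"
      unfolding g_change[OF c x] \<Gamma>_def AA' ..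
    finally show ?thesis .
  qed
  ultimately have "\<Gamma> = levi_civita M c ?p"
    by (intro levi_civita_unique[OF c(1) p]) (simp add: levi_civita_form_def)
  then have "levi_civita M c ?p u v = \<Gamma> u v" by simp
  then show ?thesis by (simp only: \<Gamma>_def AA')
qed

end

locale riemannian_C2 = riemannian M for M :: "('m::{t2_space, second_countable_topology}, 'e::euclidean_space) manifold" +
  fixes f :: "'m \<Rightarrow> real"
  assumes C2: "C2_function M f"
begin

definition df :: "('m, 'e) chart \<Rightarrow> 'e \<Rightarrow> 'e \<Rightarrow> real" where
  "df c p = frechet_derivative (f \<circ> chart_inv c) (at p)"

definition d2f :: "('m, 'e) chart \<Rightarrow> 'e \<Rightarrow> 'e \<Rightarrow> 'e \<Rightarrow> real" where
  "d2f c p v w = frechet_derivative (\<lambda>q. df c q w) (at p) v"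

text \<open>The covariant Hessian of f, the second derivative minus the Christoffel term. Unlike its
  two summands it is a tensor.\<close>

definition hess_form :: "('m, 'e) chart \<Rightarrow> 'e \<Rightarrow> 'e \<Rightarrow> 'e \<Rightarrow> real" where
  "hess_form c p v w = d2f c p v w - df c p (levi_civita M c p v w)"

lemma f_Ck: "c \<in> atlas M \<Longrightarrow> Ck_on (Suc (Suc 0)) (f \<circ> chart_inv c) (chart_image c)"
  using C2 unfolding C2_function_def numeral_2_eq_2 by blast

lemma f_deriv: "c \<in> atlas M \<Longrightarrow> p \<in> chart_image c \<Longrightarrow> ((f \<circ> chart_inv c) has_derivative df c p) (at p)"
  unfolding df_def using Ck_on_differentiable[OF f_Ck] .

lemma df_Ck: "c \<in> atlas M \<Longrightarrow> Ck_on (Suc 0) (\<lambda>q. df c q w) (chart_image c)"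
  using f_Ck unfolding Ck_on.simps(2)[of "Suc 0"] df_def by blast

lemma df_deriv:
  assumes "c \<in> atlas M" "p \<in> chart_image c"
  shows "((\<lambda>q. df c q w) has_derivative (\<lambda>v. d2f c p v w)) (at p)"
  using Ck_on_differentiable[OF df_Ck[OF assms(1)] assms(2)] unfolding d2f_def .

lemma d2f_eq:
  assumes "c \<in> atlas M" "p \<in> chart_image c" "((\<lambda>q. df c q w) has_derivative D) (at p)"
  shows "d2f c p v w = D v"
  using fun_cong[OF has_derivative_unique[OF df_deriv[OF assms(1,2)] assms(3)]] .

lemma d2f_continuous: "c \<in> atlas M \<Longrightarrow> continuous_on (chart_image c) (\<lambda>p. d2f c p v w)"
  using df_Ck[of c w] unfolding Ck_on.simps d2f_def by blast

lemma df_continuous: "c \<in> atlas M \<Longrightarrow> continuous_on (chart_image c) (\<lambda>p. df c p w)"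
  by (rule Ck_on_continuous[OF df_Ck])

lemma df_linear: "c \<in> atlas M \<Longrightarrow> p \<in> chart_image c \<Longrightarrow> linear (df c p)"
  by (rule has_derivative_linear[OF f_deriv])

lemma d2f_sym:
  assumes "c \<in> atlas M" "p \<in> chart_image c"
  shows "d2f c p u v = d2f c p v u"
  using second_derivative_symmetric[OF open_img[OF assms(1)] assms(2) f_deriv[OF assms(1)]
      df_deriv[OF assms, of v] df_deriv[OF assms, of u]] by simp

lemma hess_form_sym: "c \<in> atlas M \<Longrightarrow> p \<in> chart_image c \<Longrightarrow> hess_form c p u v = hess_form c p v u"
  unfolding hess_form_def by (simp only: d2f_sym[of c p u] levi_civita_sym[of c p u])

lemma df_change:
  assumes c: "c \<in> atlas M" "c' \<in> atlas M" and x: "x \<in> fst c" "x \<in> fst c'"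
  shows "df c (snd c x) v = df c' (snd c' x) (tc c c' x v)"
proof -
  have p: "snd c x \<in> chart_image c" using x by simp
  have "((\<lambda>y. (f \<circ> chart_inv c') (trans c c' y)) has_derivative (\<lambda>v. df c' (snd c' x) (tc c c' x v))) (at (snd c x))"
    by (rule has_derivative_compose[where g = "f \<circ> chart_inv c'", OF trans_deriv[OF c x]])
      (use f_deriv[OF c(2), of "snd c' x"] c x in \<open>simp add: trans_apply\<close>)
  then have "((f \<circ> chart_inv c) has_derivative (\<lambda>v. df c' (snd c' x) (tc c c' x v))) (at (snd c x))"
    by (rule has_derivative_transform_within_open[OF _ open_overlap[OF c] overlap_in[OF x]])
      (use c in \<open>auto simp: trans_def overlap_iff\<close>)
  from fun_cong[OF has_derivative_unique[OF f_deriv[OF c(1) p] this]] show ?thesis .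
qed

text \<open>Second derivatives of the transition map enter both through d2f and through the
  connection, and cancel.\<close>

lemma hess_form_change:
  assumes c: "c \<in> atlas M" "c' \<in> atlas M" and x: "x \<in> fst c" "x \<in> fst c'"
  shows "hess_form c (snd c x) v w = hess_form c' (snd c' x) (tc c c' x v) (tc c c' x w)"
proof -
  let ?p = "snd c x" and ?q = "snd c' x" and ?A = "tc c c' x"
  have p: "?p \<in> chart_image c" and q: "?q \<in> chart_image c'" using x by auto
  have 1: "((\<lambda>y. df c' (trans c c' y) a) has_derivative (\<lambda>v. d2f c' ?q (?A v) a)) (at ?p)" for a
    by (rule has_derivative_compose[where g = "\<lambda>y. df c' y a", OF trans_deriv[OF c x]])
      (use df_deriv[OF c(2) q] in \<open>simp add: trans_apply[OF c(1) x(1)]\<close>)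
  have lin: "linear (df c' (trans c c' y))" if "y \<in> overlap c c'" for y
    using that c by (intro df_linear) (auto simp: overlap_iff trans_def)
  have "((\<lambda>y. df c' (trans c c' y) (frechet_derivative (trans c c') (at y) w)) has_derivative
      (\<lambda>v. d2f c' ?q (?A v) (?A w) + df c' ?q (d2trans c c' x v w))) (at ?p)"
    using has_derivative_moving_linear[OF open_overlap[OF c] overlap_in[OF x] lin 1 trans_deriv2[OF c x, of w]]
    by (simp add: trans_apply[OF c(1) x(1)] flip: tc_eq)
  then have "((\<lambda>y. df c y w) has_derivative
      (\<lambda>v. d2f c' ?q (?A v) (?A w) + df c' ?q (d2trans c c' x v w))) (at ?p)"
  proof (rule has_derivative_transform_within_open[OF _ open_overlap[OF c] overlap_in[OF x]])
    fix y assume "y \<in> overlap c c'"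
    then have y: "y \<in> chart_image c" "chart_inv c y \<in> fst c'" using c overlap_iff by auto
    show "df c' (trans c c' y) (frechet_derivative (trans c c') (at y) w) = df c y w"
      using df_change[OF c _ y(2), of w] y c by (simp add: tc_at trans_def)
  qed
  then have *: "d2f c ?p v w = d2f c' ?q (?A v) (?A w) + df c' ?q (d2trans c c' x v w)"
    by (rule d2f_eq[OF c(1) p])
  show ?thesis
    unfolding hess_form_def * df_change[OF c x] levi_civita_change[OF c x]
    by (simp add: linear_add[OF df_linear[OF c(2) q]])
qed

lemma rgrad_works: "metric M x (rgrad M f x) w = df (c0 x) (snd (c0 x) x) w"
proof -
  interpret I: inner_form "metric M x" using metric_inner by unfold_locales
  show ?thesis unfolding rgrad_def by (rule I.gradient_wrt_works[OF f_deriv]) auto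
qed

text \<open>\<open>rgrad\<close> uses the preferred chart at each point and may jump with the point;
  read in one fixed chart the gradient field is differentiable.\<close>

definition chart_grad :: "('m, 'e) chart \<Rightarrow> 'e \<Rightarrow> 'e" where
  "chart_grad c p = to_chart M c (chart_inv c p) (rgrad M f (chart_inv c p))"

lemma chart_grad_works:
  assumes "c \<in> atlas M" "p \<in> chart_image c"
  shows "g c p (chart_grad c p) w = df c p w"
proof -
  define x where "x = chart_inv c p"
  have x: "x \<in> fst c" "snd c x = p" using assms by (auto simp: x_def)
  have "g c (snd c x) (to_chart M c x (rgrad M f x)) w = metric M x (rgrad M f x) (tc c (c0 x) x w)"
    unfolding g_at[OF assms(1) x(1)] using assms x by (simp del: x(2))
  also have "\<dots> = df c (snd c x) w" unfolding rgrad_works using assms x by (intro df_change[symmetric]) auto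
  finally show ?thesis unfolding x(2) by (simp add: chart_grad_def x_def)
qed

lemma chart_grad_differentiable:
  assumes "c \<in> atlas M" "p \<in> chart_image c"
  shows "chart_grad c differentiable (at p)"
  by (rule differentiable_riesz[where B = "g c" and h = "df c", OF open_img[OF assms(1)] assms(2)])
    (use assms(1) in \<open>auto intro: g_inner differentiableI[OF g_deriv] differentiableI[OF df_deriv] chart_grad_works\<close>)

lemma chart_grad_continuous: "c \<in> atlas M \<Longrightarrow> continuous_on (chart_image c) (chart_grad c)"
  by (intro continuous_at_imp_continuous_on ballI differentiable_imp_continuous_within chart_grad_differentiable)

lemma rHess_eq:
  "rHess M f x v = frechet_derivative (chart_grad (c0 x)) (at (snd (c0 x) x)) v
    + levi_civita M (c0 x) (snd (c0 x) x) v (rgrad M f x)"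
  by (simp add: rHess_def covariant_deriv_def Let_def chart_grad_def[abs_def])

text \<open>Differentiate <grad f, w> = df w for constant w. Metric compatibility splits the
  derivative of the metric, and the part in which the connection acts on w is the Christoffel term
  of \<open>hess_form\<close>.\<close>

lemma rHess_works: "metric M x (rHess M f x v) w = hess_form (c0 x) (snd (c0 x) x) v w"
proof -
  let ?c = "c0 x" and ?p = "snd (c0 x) x"
  let ?\<Gamma> = "levi_civita M ?c ?p" and ?G = "chart_grad ?c ?p" and ?DG = "frechet_derivative (chart_grad ?c) (at ?p)"
  have c: "?c \<in> atlas M" and p: "?p \<in> chart_image ?c" by auto
  have DG: "(chart_grad ?c has_derivative ?DG) (at ?p)"
    using chart_grad_differentiable[OF c p] by (simp add: frechet_derivative_works)
  have G: "rgrad M f x = ?G" by (simp add: chart_grad_def)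
  have lin: "linear (\<lambda>u. g ?c y u w)" if "y \<in> chart_image ?c" for y
    using g_bilinear[OF c that] by (simp add: bilinear_def)
  have "((\<lambda>y. g ?c y (chart_grad ?c y) w) has_derivative (\<lambda>v. dg ?c ?p v ?G w + g ?c ?p (?DG v) w)) (at ?p)"
    by (rule has_derivative_moving_linear[where Q = "\<lambda>y u. g ?c y u w" and D = "\<lambda>u v. dg ?c ?p v u w",
          OF open_img[OF c] p lin g_deriv[OF c p] DG])
  then have "((\<lambda>y. df ?c y w) has_derivative (\<lambda>v. dg ?c ?p v ?G w + g ?c ?p (?DG v) w)) (at ?p)"
    by (rule has_derivative_transform_within_open[OF _ open_img[OF c] p]) (rule chart_grad_works[OF c])
  then have *: "d2f ?c ?p v w = dg ?c ?p v ?G w + g ?c ?p (?DG v) w" by (rule d2f_eq[OF c p])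
  have "metric M x (rHess M f x v) w = g ?c ?p (?DG v + ?\<Gamma> v ?G) w"
    unfolding rHess_eq G g_c0 ..
  also have "\<dots> = g ?c ?p (?DG v) w + g ?c ?p (?\<Gamma> v ?G) w" by (rule bilinear_ladd[OF g_bilinear[OF c p]])
  also have "\<dots> = d2f ?c ?p v w - g ?c ?p ?G (?\<Gamma> v w)"
    using * levi_civita_compat[OF c p, where w = v and u = ?G and v = w] by simp
  also have "g ?c ?p ?G (?\<Gamma> v w) = df ?c ?p (?\<Gamma> v w)" by (rule chart_grad_works[OF c p])
  finally show ?thesis by (simp add: hess_form_def)
qed

lemma rHess_linear: "linear (rHess M f x)"
proof -
  have c: "c0 x \<in> atlas M" and p: "snd (c0 x) x \<in> chart_image (c0 x)" by auto
  have l: "linear (frechet_derivative (chart_grad (c0 x)) (at (snd (c0 x) x)))"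
    using chart_grad_differentiable[OF c p] by (rule linear_frechet_derivative)
  show ?thesis
    by (intro linearI) (simp_all add: rHess_eq linear_add[OF l] linear_scale[OF l]
      bilinear_ladd[OF levi_civita_bilinear[OF c p]] bilinear_lmul[OF levi_civita_bilinear[OF c p]] algebra_simps)
qed

lemma rHess_sym: "metric M x (rHess M f x u) v = metric M x u (rHess M f x v)"
proof -
  interpret I: inner_form "metric M x" using metric_inner by unfold_locales
  have "metric M x (rHess M f x u) v = metric M x (rHess M f x v) u"
    unfolding rHess_works by (rule hess_form_sym) auto
  then show ?thesis by (simp only: I.sym[of u])
qed

end

section \<open>Retractions and pullbacks\<close>

lemma open_less_on:
  fixes F G :: "'a::topological_space \<Rightarrow> real"
  assumes U: "open U" and F: "continuous_on U F" and G: "continuous_on U G"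
  shows "open {q \<in> U. F q < G q}"
proof -
  have "continuous_on U (\<lambda>q. G q - F q)" by (intro continuous_intros F G)
  from continuous_open_preimage[OF this U open_greaterThan[of 0]] show ?thesis
    by (simp add: vimage_def Int_def)
qed

section \<open>Closedness of the set of critical points\<close>

context riemannian begin

lemma closed_by_charts:
  assumes "\<And>c. c \<in> atlas M \<Longrightarrow> open {x \<in> fst c. \<not> P x}"
  shows "closed {x. P x}"
proof -
  have "- {x. P x} = (\<Union>c\<in>atlas M. {x \<in> fst c. \<not> P x})" using c0 by blast
  then show ?thesis using assms by (simp add: closed_def open_UN)
qed

lemma chart_open_preimage:
  assumes c: "c \<in> atlas M" and U: "open U"
  shows "open {x \<in> fst c. snd c x \<in> U}"
proof -
  have "continuous_on (fst c) (snd c)" using homeo[OF c] by (simp add: homeomorphism_def)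
  from continuous_open_preimage[OF this open_dom[OF c] U] show ?thesis by (simp add: vimage_def Int_def)
qed

lemma g_continuous: "c \<in> atlas M \<Longrightarrow> continuous_on (chart_image c) (\<lambda>p. g c p u v)"
  using smooth_on_derivative(3)[OF g_smooth] .

lemma dg_continuous: "c \<in> atlas M \<Longrightarrow> continuous_on (chart_image c) (\<lambda>p. dg c p w u v)"
  using smooth_on_derivative(3)[OF smooth_on_derivative(1)[OF g_smooth]] .

lemma tnorm_sq_chart:
  assumes "c \<in> atlas M" "x \<in> fst c"
  shows "(tnorm M x v)\<^sup>2 = g c (snd c x) (to_chart M c x v) (to_chart M c x v)"
proof -
  interpret I: inner_form "metric M x" using metric_inner by unfold_locales
  show ?thesis unfolding metric_eq_g[OF assms, symmetric] tnorm_def using I.nonneg by simp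
qed

lemma tnorm_nonneg: "tnorm M x v \<ge> 0"
  by (simp add: tnorm_def inner_form.nonneg inner_form.intro metric_inner)

lemma tnorm_le_iff: "0 \<le> a \<Longrightarrow> tnorm M x v \<le> a \<longleftrightarrow> (tnorm M x v)\<^sup>2 \<le> a\<^sup>2"
  using tnorm_nonneg by (meson power2_le_imp_le power_mono)

end

context riemannian_C2 begin

lemma closed_low_gradient:
  assumes "0 \<le> e"
  shows "closed {x. tnorm M x (rgrad M f x) \<le> e}"
proof (rule closed_by_charts)
  fix c assume c: "c \<in> atlas M"
  have cont: "continuous_on (chart_image c) (\<lambda>p. g c p (chart_grad c p) (chart_grad c p))"
    by (rule continuous_on_moving_bilinear[OF g_bilinear[OF c] g_continuous[OF c] chart_grad_continuous[OF c] chart_grad_continuous[OF c]])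
  have "open {p \<in> chart_image c. e\<^sup>2 < g c p (chart_grad c p) (chart_grad c p)}"
    by (rule open_less_on[OF open_img[OF c] continuous_on_const cont])
  from chart_open_preimage[OF c this]
  have "open {x \<in> fst c. snd c x \<in> {p \<in> chart_image c. e\<^sup>2 < g c p (chart_grad c p) (chart_grad c p)}}" .
  also have "{x \<in> fst c. snd c x \<in> {p \<in> chart_image c. e\<^sup>2 < g c p (chart_grad c p) (chart_grad c p)}} =
      {x \<in> fst c. \<not> tnorm M x (rgrad M f x) \<le> e}"
  proof -
    have "e\<^sup>2 < g c (snd c x) (chart_grad c (snd c x)) (chart_grad c (snd c x)) \<longleftrightarrow> \<not> tnorm M x (rgrad M f x) \<le> e"
      if "x \<in> fst c" for x
      unfolding tnorm_le_iff[OF assms] tnorm_sq_chart[OF c that] chart_grad_def chart_inv_left[OF c that] by auto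
    then show ?thesis by auto
  qed
  finally show "open {x \<in> fst c. \<not> tnorm M x (rgrad M f x) \<le> e}" .
qed

text \<open>Continuity of the connection is bypassed: df of the Christoffel term is its inner
  product with the gradient, which the Koszul formula expresses by derivatives of the
  metric.\<close>

lemma hess_form_continuous:
  assumes c: "c \<in> atlas M"
  shows "continuous_on (chart_image c) (\<lambda>p. hess_form c p w w)"
proof -
  have *: "df c p (levi_civita M c p w w) = (2 * dg c p w w (chart_grad c p) - dg c p (chart_grad c p) w w) / 2"
    if p: "p \<in> chart_image c" for p
  proof -
    interpret I: inner_form "g c p" using g_inner[OF c p] by unfold_locales
    have "df c p (levi_civita M c p w w) = g c p (levi_civita M c p w w) (chart_grad c p)"
      by (simp only: chart_grad_works[OF c p, symmetric] I.sym)
    then show ?thesis using I.koszul[OF levi_civita_works[OF c p], of w w "chart_grad c p"] by simp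
  qed
  have l: "linear (\<lambda>v. dg c p w w v)" if "p \<in> chart_image c" for p
  proof -
    have "(\<lambda>v. dg c p w w v) = (\<lambda>v. dg c p w v w)" by (rule ext) (rule dg_sym[OF c that])
    then show ?thesis using dg_linear2[OF c that, of w w] by simp
  qed
  have "continuous_on (chart_image c) (\<lambda>p. dg c p w w (chart_grad c p))"
    by (rule continuous_on_moving_linear[where Q = "\<lambda>p v. dg c p w w v", OF l dg_continuous[OF c] chart_grad_continuous[OF c]])
  moreover have "continuous_on (chart_image c) (\<lambda>p. dg c p (chart_grad c p) w w)"
    by (rule continuous_on_moving_linear[where Q = "\<lambda>p v. dg c p v w w",
          OF dg_linear1[OF c] dg_continuous[OF c] chart_grad_continuous[OF c]])
  ultimately have "continuous_on (chart_image c)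
      (\<lambda>p. d2f c p w w - (2 * dg c p w w (chart_grad c p) - dg c p (chart_grad c p) w w) / 2)"
    by (intro continuous_intros d2f_continuous[OF c]) auto
  then show ?thesis by (rule continuous_on_eq) (simp add: hess_form_def *)
qed

lemma min_eigenvalue_rHess_iff:
  "a \<le> min_eigenvalue (rHess M f x) \<longleftrightarrow> (\<forall>v. a * metric M x v v \<le> metric M x (rHess M f x v) v)"
proof -
  interpret I: inner_form "metric M x" using metric_inner by unfold_locales
  show ?thesis by (rule I.min_eigenvalue_ge_iff[OF rHess_linear rHess_sym])
qed

text \<open>The inequality fails as soon as one direction violates it. For a direction fixed in
  chart coordinates the violation is an open condition on the point, and every tangent vector arises
  from such a direction.\<close>

lemma closed_min_eigenvalue: "closed {x. a \<le> min_eigenvalue (rHess M f x)}"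
proof (rule closed_by_charts)
  fix c assume c: "c \<in> atlas M"
  define U where "U = (\<Union>w. {p \<in> chart_image c. hess_form c p w w < a * g c p w w})"
  have "open {p \<in> chart_image c. hess_form c p w w < a * g c p w w}" for w
    by (rule open_less_on[OF open_img[OF c] hess_form_continuous[OF c] continuous_on_mult_left[OF g_continuous[OF c]]])
  then have "open U" unfolding U_def by (intro open_UN) blast
  from chart_open_preimage[OF c this] have "open {x \<in> fst c. snd c x \<in> U}" .
  also have "{x \<in> fst c. snd c x \<in> U} = {x \<in> fst c. \<not> a \<le> min_eigenvalue (rHess M f x)}"
  proof -
    have "snd c x \<in> U \<longleftrightarrow> \<not> a \<le> min_eigenvalue (rHess M f x)" if x: "x \<in> fst c" for x
    proof -
      have *: "hess_form c (snd c x) (tc (c0 x) c x v) (tc (c0 x) c x v) = metric M x (rHess M f x v) v" for v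
        using hess_form_change[OF c0(1) c c0(2) x, of v v] rHess_works by simp
      have "snd c x \<in> U \<longleftrightarrow> (\<exists>w. hess_form c (snd c x) w w < a * g c (snd c x) w w)"
        using x by (auto simp: U_def)
      also have "\<dots> \<longleftrightarrow> (\<exists>v. hess_form c (snd c x) (tc (c0 x) c x v) (tc (c0 x) c x v)
          < a * g c (snd c x) (tc (c0 x) c x v) (tc (c0 x) c x v))"
        using tc_inv[OF c c0(1) x c0(2)] by metis
      also have "\<dots> \<longleftrightarrow> \<not> a \<le> min_eigenvalue (rHess M f x)"
        unfolding * metric_eq_g[OF c x, symmetric] min_eigenvalue_rHess_iff by (simp add: not_le)
      finally show ?thesis .
    qed
    then show ?thesis by auto
  qed
  finally show "open {x \<in> fst c. \<not> a \<le> min_eigenvalue (rHess M f x)}" .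
qed

lemma closed_second_order_critical:
  assumes "0 \<le> e"
  shows "closed {x. second_order_critical M f \<rho> e x}"
proof -
  have "{x. second_order_critical M f \<rho> e x} =
      {x. tnorm M x (rgrad M f x) \<le> e} \<inter> {x. - sqrt (\<rho> * e) \<le> min_eigenvalue (rHess M f x)}"
    by (auto simp: second_order_critical_def)
  then show ?thesis using closed_Int[OF closed_low_gradient[OF assms] closed_min_eigenvalue] by simp
qed

end

locale retraction_C2 = riemannian_C2 M f
  for M :: "('m::{t2_space, second_countable_topology}, 'e::euclidean_space) manifold" and f +
  fixes R :: "'m \<Rightarrow> 'e \<Rightarrow> 'm"
  assumes retr: "retraction_on_manifold M R"
begin

text \<open>
  \<open>retr_coord c c'\<close> is the retraction read in the bundle chart of \<open>c\<close> and the chart \<open>c'\<close>, valid on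
  \<open>retr_dom c c'\<close>; only its derivative along the fibre, \<open>retr_coord_deriv\<close>, is needed.
\<close>

definition chart_retr :: "('m, 'e) chart \<Rightarrow> 'e \<times> 'e \<Rightarrow> 'm" where
  "chart_retr c = (\<lambda>(p, w). R (chart_inv c p) (from_chart M c (chart_inv c p) w))"

definition retr_dom :: "('m, 'e) chart \<Rightarrow> ('m, 'e) chart \<Rightarrow> ('e \<times> 'e) set" where
  "retr_dom c c' = {(p, w). p \<in> chart_image c \<and> chart_retr c (p, w) \<in> fst c'}"

definition retr_coord :: "('m, 'e) chart \<Rightarrow> ('m, 'e) chart \<Rightarrow> 'e \<times> 'e \<Rightarrow> 'e" where
  "retr_coord c c' = snd c' \<circ> chart_retr c"

definition retr_coord_deriv :: "('m, 'e) chart \<Rightarrow> ('m, 'e) chart \<Rightarrow> 'e \<times> 'e \<Rightarrow> 'e \<Rightarrow> 'e" where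
  "retr_coord_deriv c c' q u = frechet_derivative (retr_coord c c') (at q) (0, u)"

lemma
  assumes "c \<in> atlas M" "c' \<in> atlas M"
  shows open_retr_dom: "open (retr_dom c c')" and retr_coord_smooth: "smooth_on (retr_coord c c') (retr_dom c c')"
  using retr assms unfolding retraction_on_manifold_def retr_dom_def retr_coord_def chart_retr_def Let_def by blast+

lemma retr_0: "R x 0 = x" and retr_deriv0: "((snd (c0 x) \<circ> R x) has_derivative (\<lambda>v. v)) (at 0)"
  using retr unfolding retraction_on_manifold_def by blast+

lemma retr_dom_D: "q \<in> retr_dom c c' \<Longrightarrow> fst q \<in> chart_image c \<and> chart_retr c q \<in> fst c'"
  by (auto simp: retr_dom_def)

lemma retr_coord_image: "q \<in> retr_dom c c' \<Longrightarrow> retr_coord c c' q \<in> chart_image c'"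
  using retr_dom_D by (simp add: retr_coord_def)

lemma retr_coord_deriv:
  assumes "c \<in> atlas M" "c' \<in> atlas M" "(p, w) \<in> retr_dom c c'"
  shows "((\<lambda>w. retr_coord c c' (p, w)) has_derivative retr_coord_deriv c c' (p, w)) (at w)"
  unfolding retr_coord_deriv_def
  by (rule has_derivative_compose[where g = "retr_coord c c'" and f = "\<lambda>w. (p, w)", OF _ smooth_on_derivative(2)[OF retr_coord_smooth[OF assms(1,2)] assms(3)]])
    (auto intro!: derivative_eq_intros)

lemma retr_coord_deriv_smooth: "c \<in> atlas M \<Longrightarrow> c' \<in> atlas M \<Longrightarrow> smooth_on (\<lambda>q. retr_coord_deriv c c' q u) (retr_dom c c')"
  unfolding retr_coord_deriv_def by (rule smooth_on_derivative(1)[OF retr_coord_smooth])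

lemma retr_coord_deriv_differentiable:
  assumes "c \<in> atlas M" "c' \<in> atlas M" "(p, w) \<in> retr_dom c c'"
  shows "(\<lambda>w. retr_coord_deriv c c' (p, w) u) differentiable (at w)"
proof -
  have "((\<lambda>w. retr_coord_deriv c c' (p, w) u) has_derivative
      (\<lambda>v. frechet_derivative (\<lambda>q. retr_coord_deriv c c' q u) (at (p, w)) (0, v))) (at w)"
    by (rule has_derivative_compose[where g = "\<lambda>q. retr_coord_deriv c c' q u" and f = "\<lambda>w. (p, w)",
          OF _ smooth_on_derivative(2)[OF retr_coord_deriv_smooth[OF assms(1,2)] assms(3)]])
      (auto intro!: derivative_eq_intros)
  then show ?thesis by (rule differentiableI)
qed

lemma open_slice:
  assumes "c \<in> atlas M" "c' \<in> atlas M"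
  shows "open {w. (p, w) \<in> retr_dom c c'}"
proof -
  have "open ((\<lambda>w. (p, w)) -` retr_dom c c')"
    by (intro open_vimage open_retr_dom assms continuous_intros)
  then show ?thesis by (simp add: vimage_def)
qed

lemma f_bundle_deriv:
  assumes c: "c \<in> atlas M" "c' \<in> atlas M" and d: "(p, w) \<in> retr_dom c c'"
  shows "((\<lambda>w. f (chart_retr c (p, w))) has_derivative (\<lambda>u. df c' (retr_coord c c' (p, w)) (retr_coord_deriv c c' (p, w) u))) (at w)"
proof -
  have "((\<lambda>w. (f \<circ> chart_inv c') (retr_coord c c' (p, w))) has_derivative
      (\<lambda>u. df c' (retr_coord c c' (p, w)) (retr_coord_deriv c c' (p, w) u))) (at w)"
    by (rule has_derivative_compose[where g = "f \<circ> chart_inv c'", OF retr_coord_deriv[OF c d] f_deriv[OF c(2) retr_coord_image[OF d]]])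
  then show ?thesis
  proof (rule has_derivative_transform_within_open[OF _ open_slice[OF c]])
    show "w \<in> {w. (p, w) \<in> retr_dom c c'}" using d by simp
    fix v assume "v \<in> {w. (p, w) \<in> retr_dom c c'}"
    then have "chart_retr c (p, v) \<in> fst c'" using retr_dom_D[of _ c c'] by blast
    then show "(f \<circ> chart_inv c') (retr_coord c c' (p, v)) = f (chart_retr c (p, v))" using c by (simp add: retr_coord_def)
  qed
qed

lemma chart_retr_c0: "chart_retr (c0 x) (snd (c0 x) x, w) = R x w"
  by (simp add: chart_retr_def)

lemma in_retr_dom_c0: "R x w \<in> fst c' \<Longrightarrow> (snd (c0 x) x, w) \<in> retr_dom (c0 x) c'"
  by (simp add: retr_dom_def chart_retr_c0)

lemma pullback_deriv':
  assumes c: "c' \<in> atlas M" and d: "R x w \<in> fst c'"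
  shows "((f \<circ> R x) has_derivative
    (\<lambda>u. df c' (retr_coord (c0 x) c' (snd (c0 x) x, w)) (retr_coord_deriv (c0 x) c' (snd (c0 x) x, w) u))) (at w)"
  using f_bundle_deriv[OF c0(1) c in_retr_dom_c0[OF d]] by (simp add: chart_retr_c0 comp_def)

lemma pullback_deriv: "((f \<circ> R x) has_derivative (\<lambda>u. metric M x (pullback_grad M R f x w) u)) (at w)"
proof -
  interpret I: inner_form "metric M x" using metric_inner by unfold_locales
  note d = pullback_deriv'[OF c0(1) c0(2), of x w]
  show ?thesis
    using d unfolding pullback_grad_def I.gradient_wrt_works[OF d] by simp
qed

lemma pullback_grad_chart:
  assumes c: "c' \<in> atlas M" and d: "R x w \<in> fst c'"
  shows "metric M x (pullback_grad M R f x w) u =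
    df c' (retr_coord (c0 x) c' (snd (c0 x) x, w)) (retr_coord_deriv (c0 x) c' (snd (c0 x) x, w) u)"
  using fun_cong[OF has_derivative_unique[OF pullback_deriv pullback_deriv'[OF assms]]] .

text \<open>On one tangent space the metric is constant, and the represented functional is df
  composed with the fibre derivative of the retraction; both factors are differentiable, so
  \<open>differentiable_riesz\<close> applies.\<close>

lemma pullback_grad_deriv:
  "(pullback_grad M R f x has_derivative pullback_Hess M R f x w) (at w)"
proof -
  let ?c = "c0 x" and ?c' = "c0 (R x w)" and ?p = "snd (c0 x) x"
  let ?S = "{w. (?p, w) \<in> retr_dom ?c ?c'}"
  let ?h = "\<lambda>w u. df ?c' (retr_coord ?c ?c' (?p, w)) (retr_coord_deriv ?c ?c' (?p, w) u)"
  have S: "R x w \<in> fst ?c'" if "w \<in> ?S" for w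
    using that retr_dom_D[of "(?p, w)" ?c ?c'] by (simp add: chart_retr_c0)
  have "pullback_grad M R f x differentiable (at w)"
  proof (rule differentiable_riesz[where B = "\<lambda>w. metric M x" and S = ?S and h = ?h])
    show "open ?S" by (intro open_slice) auto
    show "w \<in> ?S" using in_retr_dom_c0[of x w ?c'] by simp
    show "metric M x (pullback_grad M R f x v) u = ?h v u" if "v \<in> ?S" for v u
      by (rule pullback_grad_chart) (use S[OF that] in auto)
    show "(\<lambda>w. ?h w u) differentiable (at v)" if v: "v \<in> ?S" for v u
    proof -
      have d: "(?p, v) \<in> retr_dom ?c ?c'" using v by simp
      have D1: "((\<lambda>w. df ?c' (retr_coord ?c ?c' (?p, w)) a) has_derivative
          (\<lambda>u. d2f ?c' (retr_coord ?c ?c' (?p, v)) (retr_coord_deriv ?c ?c' (?p, v) u) a)) (at v)" for a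
        by (rule has_derivative_compose[where g = "\<lambda>q. df ?c' q a", OF retr_coord_deriv[OF c0(1) c0(1) d]
              df_deriv[OF c0(1) retr_coord_image[OF d]]])
      have D2: "((\<lambda>w. retr_coord_deriv ?c ?c' (?p, w) u) has_derivative
          frechet_derivative (\<lambda>w. retr_coord_deriv ?c ?c' (?p, w) u) (at v)) (at v)"
        using retr_coord_deriv_differentiable[OF c0(1) c0(1) d] by (simp add: frechet_derivative_works)
      have lin: "linear (df ?c' (retr_coord ?c ?c' (?p, w)))" if "w \<in> ?S" for w
        using that by (intro df_linear retr_coord_image) auto
      from has_derivative_moving_linear[where Q = "\<lambda>w. df ?c' (retr_coord ?c ?c' (?p, w))",
          OF open_slice[OF c0(1) c0(1)] v lin D1 D2]
      show ?thesis by (rule differentiableI)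
    qed
  qed (auto simp: metric_inner)
  then show ?thesis by (simp add: pullback_Hess_def frechet_derivative_works)
qed

lemma pullback_grad_inner_deriv:
  "((\<lambda>w. metric M x (pullback_grad M R f x w) u) has_derivative
    (\<lambda>v. metric M x (pullback_Hess M R f x w v) u)) (at w)"
proof -
  interpret I: inner_form "metric M x" using metric_inner by unfold_locales
  show ?thesis by (rule bounded_linear.has_derivative[OF I.bounded_linear_B_left pullback_grad_deriv])
qed

lemma pullback_Hess_sym:
  "metric M x (pullback_Hess M R f x w u) v = metric M x u (pullback_Hess M R f x w v)"
proof -
  interpret I: inner_form "metric M x" using metric_inner by unfold_locales
  have "metric M x (pullback_Hess M R f x w v) u = metric M x (pullback_Hess M R f x w u) v"
    using second_derivative_symmetric[OF open_UNIV UNIV_I pullback_deriv pullback_grad_inner_deriv pullback_grad_inner_deriv, of x w u v] by simp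
  then show ?thesis by (simp add: I.sym[of u])
qed

lemma retr_coord_deriv_0: "retr_coord_deriv (c0 x) (c0 x) (snd (c0 x) x, 0) u = u"
proof -
  have "((\<lambda>w. retr_coord (c0 x) (c0 x) (snd (c0 x) x, w)) has_derivative retr_coord_deriv (c0 x) (c0 x) (snd (c0 x) x, 0)) (at 0)"
    by (rule retr_coord_deriv) (auto intro!: in_retr_dom_c0 simp: retr_0)
  then have "((snd (c0 x) \<circ> R x) has_derivative retr_coord_deriv (c0 x) (c0 x) (snd (c0 x) x, 0)) (at 0)"
    by (simp add: retr_coord_def chart_retr_c0 comp_def)
  from fun_cong[OF has_derivative_unique[OF this retr_deriv0]] show ?thesis .
qed

lemma retr_coord_0: "retr_coord (c0 x) (c0 x) (snd (c0 x) x, 0) = snd (c0 x) x"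
  by (simp add: retr_coord_def chart_retr_c0 retr_0)

lemma pullback_grad_0: "pullback_grad M R f x 0 = rgrad M f x"
proof -
  interpret I: inner_form "metric M x" using metric_inner by unfold_locales
  show ?thesis
  proof (rule I.eqI)
    fix u
    have "R x 0 \<in> fst (c0 x)" by (simp add: retr_0)
    from pullback_grad_chart[OF c0(1) this, of u]
    show "metric M x (pullback_grad M R f x 0) u = metric M x (rgrad M f x) u"
      by (simp add: retr_coord_0 retr_coord_deriv_0 rgrad_works)
  qed
qed

text \<open>
  Differentiating \<open>f \<circ> \<gamma>\<close> twice along \<open>\<gamma> t = R x (t s)\<close> relates the two Hessians; the
  acceleration of \<open>\<gamma>\<close> is the only discrepancy.
\<close>

lemma pullback_Hess_0:
  "metric M x (pullback_Hess M R f x 0 s) s =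
    metric M x (rHess M f x s) s + metric M x (rgrad M f x) (intrinsic_acceleration M (\<lambda>\<tau>. R x (\<tau> *\<^sub>R s)) 0)"
proof -
  let ?c = "c0 x" and ?p = "snd (c0 x) x"
  define \<gamma> where "\<gamma> = (\<lambda>\<tau>. R x (\<tau> *\<^sub>R s))"
  define I where "I = {\<tau>. (?p, \<tau> *\<^sub>R s) \<in> retr_dom ?c ?c}"
  define y where "y \<tau> = retr_coord ?c ?c (?p, \<tau> *\<^sub>R s)" for \<tau>
  define y' where "y' \<tau> = retr_coord_deriv ?c ?c (?p, \<tau> *\<^sub>R s) s" for \<tau>
  have c: "?c \<in> atlas M" by simp
  have "open ((\<lambda>\<tau>. (?p, \<tau> *\<^sub>R s)) -` retr_dom ?c ?c)"
    by (intro open_vimage open_retr_dom c continuous_intros)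
  then have I_open: "open I" by (simp add: I_def vimage_def)
  have I0: "0 \<in> I" using in_retr_dom_c0[of x 0 ?c] by (simp add: I_def retr_0)
  have \<gamma>_in: "\<gamma> \<tau> \<in> fst ?c" if "\<tau> \<in> I" for \<tau>
    using that retr_dom_D[of "(?p, \<tau> *\<^sub>R s)" ?c ?c] by (simp add: I_def \<gamma>_def chart_retr_c0)
  have y_eq: "y \<tau> = snd ?c (\<gamma> \<tau>)" for \<tau> by (simp add: y_def retr_coord_def chart_retr_c0 \<gamma>_def)
  have sc: "((\<lambda>\<tau>. \<tau> *\<^sub>R s) has_derivative (\<lambda>w. w *\<^sub>R s)) (at \<tau>)" for \<tau>
    by (auto intro!: derivative_eq_intros)
  have y_deriv: "(y has_derivative (\<lambda>w. w *\<^sub>R y' \<tau>)) (at \<tau>)" if "\<tau> \<in> I" for \<tau>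
  proof -
    have d: "(?p, \<tau> *\<^sub>R s) \<in> retr_dom ?c ?c" using that by (simp add: I_def)
    have "(y has_derivative (\<lambda>w. retr_coord_deriv ?c ?c (?p, \<tau> *\<^sub>R s) (w *\<^sub>R s))) (at \<tau>)"
      unfolding y_def
      by (rule has_derivative_compose[where g = "\<lambda>w. retr_coord ?c ?c (?p, w)", OF sc retr_coord_deriv[OF c c d]])
    then show ?thesis
      by (simp add: y'_def linear_scale[OF has_derivative_linear[OF retr_coord_deriv[OF c c d]]])
  qed
  \<comment> \<open>\<open>a\<close> is the coordinate acceleration of the curve at 0.\<close>
  obtain a where a: "(y' has_derivative (\<lambda>w. w *\<^sub>R a)) (at 0)"
  proof -
    define D where "D = frechet_derivative (\<lambda>w. retr_coord_deriv ?c ?c (?p, w) s) (at (0 *\<^sub>R s))"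
    have "((\<lambda>w. retr_coord_deriv ?c ?c (?p, w) s) has_derivative D) (at (0 *\<^sub>R s))"
      unfolding D_def frechet_derivative_works[symmetric]
      using I0 by (intro retr_coord_deriv_differentiable c) (simp add: I_def)
    note D = this
    have "(y' has_derivative (\<lambda>w. D (w *\<^sub>R s))) (at 0)"
      unfolding y'_def by (rule has_derivative_compose[where g = "\<lambda>w. retr_coord_deriv ?c ?c (?p, w) s", OF sc D])
    then show thesis using that[of "D s"] by (simp add: linear_scale[OF has_derivative_linear[OF D]])
  qed
  have y0: "y 0 = ?p" "y' 0 = s" by (simp_all add: y_def y'_def retr_coord_0 retr_coord_deriv_0)
  \<comment> \<open>\<open>velocity\<close> at \<tau> is taken in the preferred chart at that point
    of the curve; transported to the chart at x it is the coordinate velocity, also for \<tau> near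
    0 and not only at 0.\<close>
  have vel: "to_chart M ?c (\<gamma> \<tau>) (velocity M \<gamma> \<tau>) = y' \<tau>" if \<tau>: "\<tau> \<in> I" for \<tau>
  proof -
    let ?z = "\<gamma> \<tau>" and ?c1 = "c0 (\<gamma> \<tau>)"
    have "((\<lambda>\<sigma>. trans ?c ?c1 (y \<sigma>)) has_derivative (\<lambda>w. tc ?c ?c1 ?z (w *\<^sub>R y' \<tau>))) (at \<tau>)"
      by (rule has_derivative_compose[where g = "trans ?c ?c1", OF y_deriv[OF \<tau>]])
        (use trans_deriv[OF c c0(1) \<gamma>_in[OF \<tau>] c0(2)] in \<open>simp add: y_eq\<close>)
    then have "((\<lambda>\<sigma>. snd ?c1 (\<gamma> \<sigma>)) has_derivative (\<lambda>w. tc ?c ?c1 ?z (w *\<^sub>R y' \<tau>))) (at \<tau>)"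
      by (rule has_derivative_transform_within_open[OF _ I_open \<tau>])
        (use \<gamma>_in in \<open>simp add: y_eq trans_apply\<close>)
    then have "((\<lambda>\<sigma>. snd ?c1 (\<gamma> \<sigma>)) has_vector_derivative tc ?c ?c1 ?z (y' \<tau>)) (at \<tau>)"
      unfolding has_vector_derivative_def
      by (simp add: linear_scale[OF tc_linear[OF c c0(1) \<gamma>_in[OF \<tau>] c0(2)]])
    then have "velocity M \<gamma> \<tau> = tc ?c ?c1 ?z (y' \<tau>)"
      unfolding velocity_def by (rule vector_derivative_at)
    then show ?thesis using \<gamma>_in[OF \<tau>] by simp
  qed
  have \<gamma>0: "\<gamma> 0 = x" by (simp add: \<gamma>_def retr_0)
  have vel0: "velocity M \<gamma> 0 = s" using vel[OF I0] y0 by (simp add: \<gamma>0)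
  have "((\<lambda>\<tau>. to_chart M ?c (\<gamma> \<tau>) (velocity M \<gamma> \<tau>)) has_derivative (\<lambda>w. w *\<^sub>R a)) (at 0)"
    by (rule has_derivative_transform_within_open[OF a I_open I0]) (simp add: vel)
  then have "vector_derivative (\<lambda>\<tau>. to_chart M ?c (\<gamma> \<tau>) (velocity M \<gamma> \<tau>)) (at 0) = a"
    by (intro vector_derivative_at) (simp add: has_vector_derivative_def)
  then have acc: "intrinsic_acceleration M \<gamma> 0 = a + levi_civita M ?c ?p s s"
    by (simp add: intrinsic_acceleration_def covariant_deriv_along_def \<gamma>0 vel0 Let_def)
  have p: "?p \<in> chart_image ?c" by simp
  \<comment> \<open>The derivative of f along the curve is differentiated at 0 in two ways, on the
    tangent space and in the chart; comparing them gives the identity.\<close>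
  have 1: "((\<lambda>\<tau>. metric M x (pullback_grad M R f x (\<tau> *\<^sub>R s)) s) has_derivative
      (\<lambda>w. metric M x (pullback_Hess M R f x (0 *\<^sub>R s) (w *\<^sub>R s)) s)) (at 0)"
    by (rule has_derivative_compose[where g = "\<lambda>w. metric M x (pullback_grad M R f x w) s", OF sc pullback_grad_inner_deriv])
  have "((\<lambda>\<tau>. df ?c (y \<tau>) b) has_derivative (\<lambda>w. d2f ?c ?p (w *\<^sub>R s) b)) (at 0)" for b
    by (rule has_derivative_compose[where g = "\<lambda>q. df ?c q b", OF y_deriv[OF I0, unfolded y0]])
      (simp add: y0 df_deriv)
  note 2 = this
  have lin: "linear (df ?c (y \<tau>))" if "\<tau> \<in> I" for \<tau>
    using that by (intro df_linear) (auto simp: y_def I_def intro: retr_coord_image)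
  have "((\<lambda>\<tau>. df ?c (y \<tau>) (y' \<tau>)) has_derivative (\<lambda>w. d2f ?c ?p (w *\<^sub>R s) s + df ?c ?p (w *\<^sub>R a))) (at 0)"
    using has_derivative_moving_linear[OF I_open I0 lin 2 a] by (simp add: y0)
  then have "((\<lambda>\<tau>. metric M x (pullback_grad M R f x (\<tau> *\<^sub>R s)) s) has_derivative
      (\<lambda>w. d2f ?c ?p (w *\<^sub>R s) s + df ?c ?p (w *\<^sub>R a))) (at 0)"
  proof (rule has_derivative_transform_within_open[OF _ I_open I0])
    fix \<tau> assume "\<tau> \<in> I"
    then show "df ?c (y \<tau>) (y' \<tau>) = metric M x (pullback_grad M R f x (\<tau> *\<^sub>R s)) s"
      using pullback_grad_chart[OF c, of x "\<tau> *\<^sub>R s" s] \<gamma>_in[of \<tau>] by (simp add: y_def y'_def \<gamma>_def)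
  qed
  from fun_cong[OF has_derivative_unique[OF 1 this], of 1]
  have "metric M x (pullback_Hess M R f x 0 s) s = d2f ?c ?p s s + df ?c ?p a" by simp
  moreover have "metric M x (rgrad M f x) (intrinsic_acceleration M \<gamma> 0) = df ?c ?p a + df ?c ?p (levi_civita M ?c ?p s s)"
    unfolding rgrad_works acc by (rule linear_add[OF df_linear[OF c p]])
  ultimately show ?thesis by (simp add: rHess_works hess_form_def \<gamma>_def)
qed

section \<open>Measurability of the set of localized perturbations\<close>

definition chart_pullback_grad :: "('m, 'e) chart \<Rightarrow> 'e \<times> 'e \<Rightarrow> 'e" where
  "chart_pullback_grad c = (\<lambda>(p, w). let x = chart_inv c p in to_chart M c x (pullback_grad M R f x (from_chart M c x w)))"

lemma chart_pullback_grad_works: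
  assumes c: "c \<in> atlas M" "c' \<in> atlas M" and d: "q \<in> retr_dom c c'"
  shows "g c (fst q) (chart_pullback_grad c q) u = df c' (retr_coord c c' q) (retr_coord_deriv c c' q u)"
proof -
  obtain p w where q: "q = (p, w)" by (cases q)
  define x where "x = chart_inv c p"
  have p: "p \<in> chart_image c" using retr_dom_D[OF d] q by simp
  have x: "x \<in> fst c" "snd c x = p" using c p by (auto simp: x_def)
  let ?fr = "tc c (c0 x) x"
  have frd: "(?fr has_derivative ?fr) (at w)"
    by (rule linear_imp_has_derivative) (use c x in \<open>auto intro: tc_linear\<close>)
  have "((\<lambda>w. (f \<circ> R x) (?fr w)) has_derivative (\<lambda>u. metric M x (pullback_grad M R f x (?fr w)) (?fr u))) (at w)"
    by (rule has_derivative_compose[where g = "f \<circ> R x", OF frd pullback_deriv])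
  then have "((\<lambda>w. f (chart_retr c (p, w))) has_derivative
      (\<lambda>u. metric M x (pullback_grad M R f x (?fr w)) (?fr u))) (at w)"
    by (simp add: chart_retr_def x_def)
  from fun_cong[OF has_derivative_unique[OF this f_bundle_deriv[OF c d[unfolded q]]], of u]
  have *: "metric M x (pullback_grad M R f x (?fr w)) (?fr u) = df c' (retr_coord c c' (p, w)) (retr_coord_deriv c c' (p, w) u)" .
  have "g c (snd c x) (to_chart M c x (pullback_grad M R f x (?fr w))) u =
      metric M x (pullback_grad M R f x (?fr w)) (?fr u)"
    unfolding g_at[OF c(1) x(1)] using c x(1) by simp
  then show ?thesis unfolding x(2) * by (simp add: q chart_pullback_grad_def Let_def x_def)
qed

text \<open>Joint continuity in base point and vector. The chart around the retracted point has to
  be chosen anew for every q, so the proof is local.\<close>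

lemma chart_pullback_grad_continuous:
  assumes c: "c \<in> atlas M"
  shows "continuous_on (chart_image c \<times> UNIV) (chart_pullback_grad c)"
proof (rule continuous_at_imp_continuous_on, rule ballI)
  fix q assume q: "q \<in> chart_image c \<times> (UNIV :: 'e set)"
  define c' where "c' = c0 (chart_retr c q)"
  have c': "c' \<in> atlas M" by (simp add: c'_def)
  have qd: "q \<in> retr_dom c c'" using q by (auto simp: retr_dom_def c'_def)
  let ?S = "retr_dom c c'"
  have cf: "continuous_on ?S (\<lambda>q. F (fst q))" if "continuous_on (chart_image c) F" for F :: "'e \<Rightarrow> real"
    by (rule continuous_on_compose2[OF that continuous_on_fst[OF continuous_on_id]]) (use retr_dom_D[of _ c c'] in auto)
  have cr: "continuous_on ?S (retr_coord c c')" by (rule smooth_on_derivative(3)[OF retr_coord_smooth[OF c c']])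
  have dfc: "continuous_on ?S (\<lambda>q. df c' (retr_coord c c' q) a)" for a
    by (rule continuous_on_compose2[OF df_continuous[OF c'] cr]) (use retr_coord_image[of _ c c'] in auto)
  have "continuous_on ?S (\<lambda>q. df c' (retr_coord c c' q) (retr_coord_deriv c c' q u))" for u
    by (rule continuous_on_moving_linear[OF df_linear[OF c' retr_coord_image] dfc smooth_on_derivative(3)[OF retr_coord_deriv_smooth[OF c c']]])
  then have "continuous_on ?S (chart_pullback_grad c)"
    by (intro continuous_on_riesz[where B = "\<lambda>q. g c (fst q)" and h = "\<lambda>q u. df c' (retr_coord c c' q) (retr_coord_deriv c c' q u)"])
      (use retr_dom_D[of _ c c'] in \<open>auto intro!: g_inner[OF c] cf g_continuous[OF c] chart_pullback_grad_works[OF c c']\<close>)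
  then show "isCont (chart_pullback_grad c) q"
    using qd open_retr_dom[OF c c'] continuous_on_eq_continuous_at by blast
qed

lemma gd_chart_continuous:
  assumes c: "c \<in> atlas M"
  shows "continuous_on (chart_image c \<times> UNIV)
    (\<lambda>(p, w). let x = chart_inv c p in to_chart M c x ((gd_step M R f x \<eta> ^^ j) (\<eta> *\<^sub>R from_chart M c x w)))"
    (is "continuous_on ?U (?E j)")
proof (induction j)
  case 0
  have "continuous_on ?U (\<lambda>q. \<eta> *\<^sub>R snd q)" by (intro continuous_intros)
  then show ?case
  proof (rule continuous_on_eq)
    fix q assume "q \<in> ?U"
    then obtain p w where q: "q = (p, w)" "p \<in> chart_image c" by auto
    have x: "chart_inv c p \<in> fst c" using c q by simp
    show "\<eta> *\<^sub>R snd q = ?E 0 q"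
      using c x tc_inv[OF c c0(1) x c0(2), of w]
        linear_scale[OF tc_linear[OF c0(1) c c0(2) x], of \<eta>] by (simp add: q Let_def)
  qed
next
  case (Suc j)
  have pair: "continuous_on ?U (\<lambda>q. (fst q, ?E j q))"
    by (rule continuous_on_Pair[OF continuous_on_fst[OF continuous_on_id] Suc])
  have "continuous_on ?U (\<lambda>q. chart_pullback_grad c (fst q, ?E j q))"
    by (rule continuous_on_compose2[OF chart_pullback_grad_continuous[OF c] pair]) auto
  then have "continuous_on ?U (\<lambda>q. ?E j q - \<eta> *\<^sub>R chart_pullback_grad c (fst q, ?E j q))"
    by (intro continuous_on_diff continuous_on_scaleR continuous_on_const Suc)
  then show ?case
  proof (rule continuous_on_eq)
    fix q assume "q \<in> ?U"
    then obtain p w where q: "q = (p, w)" "p \<in> chart_image c" by auto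
    define x where "x = chart_inv c p"
    have x: "x \<in> fst c" using c q by (simp add: x_def)
    have lin: "linear (to_chart M c x)" by (rule tc_linear[OF c0(1) c c0(2) x])
    show "?E j q - \<eta> *\<^sub>R chart_pullback_grad c (fst q, ?E j q) = ?E (Suc j) q"
      using c x by (simp add: q Let_def chart_pullback_grad_def gd_step_def linear_diff[OF lin] linear_scale[OF lin] flip: x_def)
  qed
qed

text \<open>Contains every draw for which a round fails to decrease f sufficiently, with
  \<open>n\<close> the round length. The start is \<open>\<eta> *\<^sub>R v\<close> because the
  algorithm scales the draw by \<eta>. Over each chart domain its complement is open in bundle
  coordinates.\<close>

definition localized_set :: "real \<Rightarrow> real \<Rightarrow> nat \<Rightarrow> ('m \<times> 'e) set" where
  "localized_set \<eta> r n = {(x, v). \<forall>j\<le>n. tnorm M x ((gd_step M R f x \<eta> ^^ j) (\<eta> *\<^sub>R v) - \<eta> *\<^sub>R v) \<le> r}"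

text \<open>The atlas may be uncountable, but only countable unions stay in the
  sigma-algebra.\<close>

lemma countable_atlas_cover: "\<exists>\<A>. \<A> \<subseteq> atlas M \<and> countable \<A> \<and> (\<forall>x. \<exists>c\<in>\<A>. x \<in> fst c)"
proof -
  obtain F' where F': "F' \<subseteq> fst ` atlas M" "countable F'" "\<Union> F' = \<Union> (fst ` atlas M)"
    using Lindelof[of "fst ` atlas M"] open_dom by blast
  then obtain \<A> where \<A>: "\<A> \<subseteq> atlas M" "countable \<A>" "F' = fst ` \<A>"
    using countable_subset_image[of F' fst "atlas M"] by blast
  have "\<exists>c\<in>\<A>. x \<in> fst c" for x
  proof -
    have "x \<in> \<Union> (fst ` atlas M)" using c0[of x] by blast
    then show ?thesis using F'(3) \<A>(3) by auto
  qed
  then show ?thesis using \<A> by blast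
qed

lemma localized_set_measurable:
  assumes "0 \<le> r"
  shows "localized_set \<eta> r n \<in> sets (tangent_borel M)"
proof -
  let ?Gen = "{{(x, v). x \<in> fst c \<and> (snd c x, to_chart M c x v) \<in> G} | c G. c \<in> atlas M \<and> open G}"
  have sets_eq: "sets (tangent_borel M) = sigma_sets UNIV ?Gen"
    unfolding tangent_borel_def by (rule sets_measure_of) simp
  obtain \<A> where \<A>: "\<A> \<subseteq> atlas M" "countable \<A>" "\<And>x. \<exists>c\<in>\<A>. x \<in> fst c"
    using countable_atlas_cover by blast
  have piece: "{(x, v). x \<in> fst c \<and> (x, v) \<notin> localized_set \<eta> r n} \<in> sigma_sets UNIV ?Gen" if c: "c \<in> atlas M" for c
  proof -
    define U where "U = chart_image c \<times> (UNIV :: 'e set)"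
    define E where "E j = (\<lambda>(p, w). let x = chart_inv c p in
        to_chart M c x ((gd_step M R f x \<eta> ^^ j) (\<eta> *\<^sub>R from_chart M c x w)))" for j
    define d where "d j q = E j q - \<eta> *\<^sub>R snd q" for j q
    have U: "open U" unfolding U_def by (intro open_Times open_img c open_UNIV)
    have Ec: "continuous_on U (E j)" for j
      unfolding E_def U_def by (rule gd_chart_continuous[OF c])
    then have dc: "continuous_on U (d j)" for j
      unfolding d_def by (intro continuous_intros) auto
    have gc: "continuous_on U (\<lambda>q. g c (fst q) u v)" for u v
      by (rule continuous_on_compose2[OF g_continuous[OF c] continuous_on_fst[OF continuous_on_id]]) (auto simp: U_def)
    have bi: "bilinear (g c (fst q))" if "q \<in> U" for q
      using that by (intro g_bilinear[OF c]) (auto simp: U_def)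
    have nc: "continuous_on U (\<lambda>q. g c (fst q) (d j q) (d j q))" for j
      by (rule continuous_on_moving_bilinear[where Q = "\<lambda>q. g c (fst q)", OF bi gc dc dc])
    define G where "G = (\<Union>j\<in>{..n}. {q \<in> U. r\<^sup>2 < g c (fst q) (d j q) (d j q)})"
    have "open {q \<in> U. r\<^sup>2 < g c (fst q) (d j q) (d j q)}" for j
      by (rule open_less_on[OF U continuous_on_const nc])
    then have G: "open G" unfolding G_def by (intro open_UN) blast
    have "{(x, v). x \<in> fst c \<and> (x, v) \<notin> localized_set \<eta> r n} =
        {(x, v). x \<in> fst c \<and> (snd c x, to_chart M c x v) \<in> G}"
    proof -
      have "(x, v) \<notin> localized_set \<eta> r n \<longleftrightarrow> (snd c x, to_chart M c x v) \<in> G" if x: "x \<in> fst c" for x v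
      proof -
        have lin: "linear (to_chart M c x)" by (rule tc_linear[OF c0(1) c c0(2) x])
        have "d j (snd c x, to_chart M c x v) =
            to_chart M c x ((gd_step M R f x \<eta> ^^ j) (\<eta> *\<^sub>R v) - \<eta> *\<^sub>R v)" for j
          using c x by (simp add: d_def E_def Let_def linear_diff[OF lin] linear_scale[OF lin])
        then have "r\<^sup>2 < g c (snd c x) (d j (snd c x, to_chart M c x v)) (d j (snd c x, to_chart M c x v)) \<longleftrightarrow>
            \<not> tnorm M x ((gd_step M R f x \<eta> ^^ j) (\<eta> *\<^sub>R v) - \<eta> *\<^sub>R v) \<le> r" for j
          unfolding tnorm_le_iff[OF assms] tnorm_sq_chart[OF c x] by auto
        then show ?thesis using x by (auto simp: G_def U_def localized_set_def)
      qed
      then show ?thesis by auto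
    qed
    also have "\<dots> \<in> sigma_sets UNIV ?Gen" using c G by (intro sigma_sets.Basic) blast
    finally show ?thesis .
  qed
  have "(\<Union>c\<in>\<A>. {(x, v). x \<in> fst c \<and> (x, v) \<notin> localized_set \<eta> r n}) \<in> sets (tangent_borel M)"
    using piece \<A>(1,2) unfolding sets_eq[symmetric] by (intro sets.countable_UN') auto
  moreover have "(\<Union>c\<in>\<A>. {(x, v). x \<in> fst c \<and> (x, v) \<notin> localized_set \<eta> r n}) = - localized_set \<eta> r n"
    using \<A>(3) by auto
  ultimately have "- localized_set \<eta> r n \<in> sigma_sets UNIV ?Gen" unfolding sets_eq by simp
  then have "UNIV - - localized_set \<eta> r n \<in> sigma_sets UNIV ?Gen" by (rule sigma_sets.Compl)
  then show ?thesis unfolding sets_eq by (simp add: Diff_eq)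
qed

end

section \<open>Volume of thin sets\<close>

lemma exp_one_le_3: "exp 1 \<le> (3::real)"
  using exp_bound[of 1] by simp

lemma one_plus_inverse_power_le:
  assumes "d > 0"
  shows "(1 + 1 / real d) ^ d \<le> 3"
proof -
  have "(1 + 1 / real d) ^ d \<le> exp (1 / real d) ^ d"
    by (intro power_mono exp_ge_add_one_self) auto
  also have "\<dots> = exp 1" using assms by (simp flip: exp_of_nat_mult)
  finally show ?thesis using exp_one_le_3 by linarith
qed

context inner_form begin

lemma closed_nball: "closed {v. nrm v \<le> r}"
  by (intro closed_Collect_le continuous_on_nrm continuous_on_const)

lemma bounded_nball: "bounded {v. nrm v \<le> r}"
proof -
  obtain c where c: "c > 0" "\<And>v. c * norm v \<le> nrm v" using nrm_lower by blast
  show ?thesis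
  proof (rule boundedI)
    fix v assume "v \<in> {v. nrm v \<le> r}"
    then have "c * norm v \<le> r" using c(2)[of v] by simp
    then show "norm v \<le> r / c" using c(1) by (simp add: field_simps)
  qed
qed

lemma nball_sets [measurable]: "{v. nrm v \<le> r} \<in> sets borel"
  using closed_nball by (rule borel_closed)

lemma nball_finite: "emeasure lborel {v. nrm v \<le> r} < \<infinity>"
  using bounded_nball by (rule emeasure_bounded_finite)

lemma nball_pos:
  assumes "r > 0"
  shows "0 < measure lborel {v. nrm v \<le> r}"
proof -
  obtain C where C: "C > 0" "\<And>v. nrm v \<le> C * norm v" using nrm_upper by blast
  have "cball 0 (r / C) \<subseteq> {v. nrm v \<le> r}"
  proof
    fix v :: 'e assume "v \<in> cball 0 (r / C)"
    then have "C * norm v \<le> r" using C(1) by (simp add: field_simps)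
    then show "v \<in> {v. nrm v \<le> r}" using C(2)[of v] by simp
  qed
  moreover have "0 < measure lborel (cball (0::'e) (r / C))"
    using content_cball_pos[of "r / C" "0::'e"] assms C(1) by simp
  moreover have "measure lborel (cball (0::'e) (r / C)) \<le> measure lborel {v. nrm v \<le> r}"
    using calculation(1) nball_finite by (intro measure_mono_fmeasurable) (auto simp: fmeasurable_def)
  ultimately show ?thesis by linarith
qed

lemma nball_scale:
  assumes "t > 0"
  shows "measure lborel {v. nrm v \<le> t * r} = t ^ DIM('e) * measure lborel {v. nrm v \<le> r}"
proof -
  have "{v. nrm v \<le> t * r} = (\<lambda>v. t *\<^sub>R v + 0) ` {v. nrm v \<le> r}"
  proof (intro equalityI subsetI)
    fix v assume "v \<in> {v. nrm v \<le> t * r}"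
    then have "nrm ((1 / t) *\<^sub>R v) \<le> r" using assms by (simp add: field_simps)
    then show "v \<in> (\<lambda>v. t *\<^sub>R v + 0) ` {v. nrm v \<le> r}"
      using assms by (intro image_eqI[of _ _ "(1 / t) *\<^sub>R v"]) auto
  next
    fix v assume "v \<in> (\<lambda>v. t *\<^sub>R v + 0) ` {v. nrm v \<le> r}"
    then show "v \<in> {v. nrm v \<le> t * r}" using assms by auto
  qed
  then have "measure lebesgue {v. nrm v \<le> t * r} = t ^ DIM('e) * measure lebesgue {v. nrm v \<le> r}"
    using measure_lebesgue_affine[of t "0::'e" "{v. nrm v \<le> r}"] assms by simp
  then show ?thesis by simp
qed

text \<open>
  The translates of \<open>S\<close> by multiples of \<open>w e\<close> are disjoint; \<open>m\<close> of them with \<open>m \<approx> r / (w d)\<close> fit into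
  the ball of radius \<open>(1 + 1/d) r\<close>, whose volume is at most \<open>3\<close> times that of the ball of radius \<open>r\<close>.
\<close>

lemma thin_set_measure:
  assumes S: "S \<in> sets borel" "S \<subseteq> {v. nrm v \<le> r}" and e: "nrm e = 1" and w: "w > 0" and r: "r > 0"
    and thin: "\<And>v \<mu>. v \<in> S \<Longrightarrow> v + \<mu> *\<^sub>R e \<in> S \<Longrightarrow> \<bar>\<mu>\<bar> < w"
  shows "measure lborel S \<le> 6 * w * DIM('e) / r * measure lborel {v. nrm v \<le> r}"
proof -
  let ?V = "measure lborel {v. nrm v \<le> r}"
  define d where "d = real DIM('e)"
  have d: "d > 0" by (simp add: d_def)
  have Sfin: "emeasure lborel S < \<infinity>"
    using emeasure_mono[OF S(2), of lborel] nball_finite[of r] by (auto intro: le_less_trans)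
  have SV: "measure lborel S \<le> ?V"
    using S nball_finite by (intro measure_mono_fmeasurable) (auto simp: fmeasurable_def)
  show ?thesis
  \<comment> \<open>If w d is at least r, the claimed bound exceeds the volume of the ball.\<close>
  proof (cases "r \<le> w * d")
    case True
    then have "1 \<le> 6 * w * d / r" using r w d by (simp add: field_simps)
    then have "1 * ?V \<le> 6 * w * d / r * ?V" by (intro mult_right_mono) auto
    then show ?thesis using SV by (simp add: d_def)
  next
    case False
    define m where "m = nat \<lfloor>r / (w * d)\<rfloor>"
    have q: "1 \<le> r / (w * d)" using False w d by (simp add: field_simps)
    then have m1: "1 \<le> m" unfolding m_def by linarith
    have m_le: "real m \<le> r / (w * d)" unfolding m_def using q by linarith
    \<comment> \<open>Rounding down loses at most a factor 2 because m is at least 1; with the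
      volume factor 3 this gives the 6.\<close>
    have m_ge: "r / (w * d) \<le> 2 * real m"
    proof -
      have "r / (w * d) < real m + 1" unfolding m_def using q by linarith
      then show ?thesis using m1 by linarith
    qed
    \<comment> \<open>The scaling by 1 gives the translation the shape of
      \<open>emeasure_lebesgue_affine\<close>.\<close>
    define T where "T i = (\<lambda>v. 1 *\<^sub>R v + (real i * w) *\<^sub>R e) ` S" for i
    have T_sets: "T i \<in> sets lebesgue" for i
    proof -
      have "T i = (\<lambda>v. v - (real i * w) *\<^sub>R e) -` S \<inter> space borel"
        unfolding T_def by (auto simp: image_iff intro!: bexI[of _ "_ - (real i * w) *\<^sub>R e"])
      also have "\<dots> \<in> sets borel" by (rule measurable_sets[OF _ S(1)]) simp
      finally show ?thesis by simp
    qed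
    have T_em: "emeasure lebesgue (T i) = emeasure lborel S" for i
      unfolding T_def using emeasure_lebesgue_affine[of 1 "(real i * w) *\<^sub>R e" S] S(1) by simp
    have disj: "disjoint_family_on T {..<m}"
      unfolding disjoint_family_on_def
    proof (intro ballI impI)
      fix i j :: nat assume "i \<noteq> j"
      show "T i \<inter> T j = {}"
      proof (rule ccontr)
        assume "T i \<inter> T j \<noteq> {}"
        then obtain u v where uv: "u \<in> S" "v \<in> S" "u + (real i * w) *\<^sub>R e = v + (real j * w) *\<^sub>R e"
          unfolding T_def by auto
        then have "v = u + ((real i - real j) * w) *\<^sub>R e"
          by (simp add: algebra_simps)
        then have "\<bar>(real i - real j) * w\<bar> < w" using thin[OF uv(1)] uv(2) by simp
        then have "\<bar>real i - real j\<bar> < 1" using w by (simp add: abs_mult)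
        then show False using \<open>i \<noteq> j\<close> by linarith
      qed
    qed
    have sub: "(\<Union>i\<in>{..<m}. T i) \<subseteq> {v. nrm v \<le> (1 + 1 / d) * r}"
    proof clarify
      fix i v assume "i < m" "v \<in> T i"
      then obtain u where u: "u \<in> S" "v = u + (real i * w) *\<^sub>R e" unfolding T_def by auto
      have "nrm v \<le> nrm u + real i * w"
        using nrm_triangle[of u "(real i * w) *\<^sub>R e"] e w u(2) by simp
      also have "\<dots> \<le> r + real m * w" using u(1) S(2) \<open>i < m\<close> w by (intro add_mono mult_right_mono) auto
      also have "\<dots> \<le> r + r / (w * d) * w" using m_le w by (intro add_left_mono mult_right_mono) auto
      also have "\<dots> = (1 + 1 / d) * r" using w d by (simp add: field_simps)
      finally show "nrm v \<le> (1 + 1 / d) * r" .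
    qed
    have "of_nat m * emeasure lborel S = (\<Sum>i<m. emeasure lebesgue (T i))"
      by (simp add: T_em)
    also have "\<dots> = emeasure lebesgue (\<Union>i\<in>{..<m}. T i)"
      by (rule sum_emeasure) (use T_sets disj in auto)
    also have "\<dots> \<le> emeasure lebesgue {v. nrm v \<le> (1 + 1 / d) * r}"
      using sub by (intro emeasure_mono) auto
    also have "\<dots> = emeasure lborel {v. nrm v \<le> (1 + 1 / d) * r}" by simp
    also have "\<dots> = ennreal (measure lborel {v. nrm v \<le> (1 + 1 / d) * r})"
      using nball_finite[of "(1 + 1 / d) * r"] by (simp add: emeasure_eq_ennreal_measure less_top)
    finally have "ennreal (real m * measure lborel S) \<le> ennreal (measure lborel {v. nrm v \<le> (1 + 1 / d) * r})"
      using Sfin by (simp add: emeasure_eq_ennreal_measure less_top ennreal_mult ennreal_of_nat_eq_real_of_nat)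
    then have "real m * measure lborel S \<le> measure lborel {v. nrm v \<le> (1 + 1 / d) * r}"
      by (simp add: ennreal_le_iff)
    also have "\<dots> = (1 + 1 / d) ^ DIM('e) * ?V" using d by (intro nball_scale) (simp add: add_pos_pos)
    also have "\<dots> \<le> 3 * ?V"
      unfolding d_def by (intro mult_right_mono one_plus_inverse_power_le) auto
    finally have *: "real m * measure lborel S \<le> 3 * ?V" .
    have "r / (w * d) * measure lborel S \<le> 2 * real m * measure lborel S"
      using m_ge by (intro mult_right_mono) auto
    also have "\<dots> \<le> 6 * ?V" using * by simp
    finally show ?thesis using r w d by (simp add: d_def field_simps)
  qed
qed

end

section \<open>The parameters\<close>

lemma half_le_ln2: "1 / 2 \<le> ln (2::real)"
  using ln2_ge_two_thirds by simp

locale prgd_numbers =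
  fixes d :: nat and l \<rho> \<epsilon> \<delta> \<Delta> chi :: real
  assumes d: "d \<ge> 1" and rho: "\<rho> > 0" and eps: "\<epsilon> > 0" and l_ge: "l \<ge> sqrt (\<rho> * \<epsilon>)"
    and delta: "0 < \<delta>" "\<delta> < 1" and gap: "\<epsilon> powr (3 / 2) \<le> 3 * sqrt \<rho> * \<Delta>"
    and chi_ge: "chi_bound d l \<rho> \<epsilon> \<delta> \<Delta> \<le> chi"
begin

text \<open>In terms of these square roots all the powers of \<open>\<rho>\<close> and \<open>\<epsilon>\<close> that occur have integer exponents.\<close>

abbreviation "p \<equiv> sqrt \<rho>"
abbreviation "e \<equiv> sqrt \<epsilon>"
definition "Q = l\<^sup>2 * sqrt (real d) * \<Delta> / (\<delta> * p * e ^ 5)"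

lemma p_pos: "p > 0" and e_pos: "e > 0" and p_sq: "p\<^sup>2 = \<rho>" and e_sq: "e\<^sup>2 = \<epsilon>"
  using rho eps by auto

lemma e_cube: "\<epsilon> powr (3 / 2) = e ^ 3" and e_five: "\<epsilon> powr (5 / 2) = e ^ 5"
proof -
  have "e ^ n = \<epsilon> powr (real n / 2)" for n
    using eps by (simp add: powr_half_sqrt[symmetric] powr_powr flip: powr_realpow)
  from this[of 3] this[of 5] show "\<epsilon> powr (3 / 2) = e ^ 3" "\<epsilon> powr (5 / 2) = e ^ 5" by simp_all
qed

lemma l_ge': "p * e \<le> l" and l_pos: "l > 0"
proof -
  show 1: "p * e \<le> l" using l_ge by (simp add: real_sqrt_mult)
  have "0 < p * e" using p_pos e_pos by simp
  then show "l > 0" using 1 by linarith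
qed

lemma gap': "e ^ 3 \<le> 3 * p * \<Delta>"
  using gap by (simp add: e_cube)

lemma Delta_pos: "\<Delta> > 0"
proof -
  have "0 < e ^ 3" using e_pos by simp
  then have "0 < 3 * p * \<Delta>" using gap' by linarith
  then show ?thesis using p_pos by (simp add: zero_less_mult_iff)
qed

lemma chi_bound_eq: "chi_bound d l \<rho> \<epsilon> \<delta> \<Delta> = 4 * log 2 (2 ^ 31 * Q)"
  by (simp add: chi_bound_def Q_def e_five)

lemma sqrt_d: "sqrt (real d) \<ge> 1"
  using d by simp

text \<open>The gap assumption and the lower bound on l keep the argument of the logarithm from
  being small. This yields the size of chi and lets \<open>union_bound\<close> trade sqrt d for
  Q.\<close>

lemma Q_ge: "sqrt (real d) \<le> 3 * Q"
proof -
  have "(p * e)\<^sup>2 \<le> l\<^sup>2" using l_ge' p_pos e_pos by (intro power_mono) auto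
  then have "(p * e)\<^sup>2 * e ^ 3 \<le> l\<^sup>2 * (3 * p * \<Delta>)"
    using gap' e_pos by (intro mult_mono) auto
  then have "p * (p * e ^ 5) \<le> p * (3 * l\<^sup>2 * \<Delta>)"
    by (simp add: power2_eq_square power3_eq_cube power_numeral_reduce algebra_simps)
  then have 1: "p * e ^ 5 \<le> 3 * l\<^sup>2 * \<Delta>" using p_pos by simp
  have "\<delta> * (p * e ^ 5) \<le> 1 * (p * e ^ 5)" using delta p_pos e_pos by (intro mult_right_mono) auto
  then have "\<delta> * p * e ^ 5 \<le> 3 * l\<^sup>2 * \<Delta>" using 1 by (simp add: mult.assoc)
  then have "sqrt (real d) * (\<delta> * p * e ^ 5) \<le> sqrt (real d) * (3 * l\<^sup>2 * \<Delta>)"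
    using sqrt_d by (intro mult_left_mono) auto
  moreover have "0 < \<delta> * p * e ^ 5" using delta p_pos e_pos by simp
  ultimately have "sqrt (real d) \<le> sqrt (real d) * (3 * l\<^sup>2 * \<Delta>) / (\<delta> * p * e ^ 5)"
    by (simp add: pos_le_divide_eq)
  then show ?thesis by (simp add: Q_def algebra_simps)
qed

lemma Q_ge': "1 / 3 \<le> Q"
  using Q_ge sqrt_d by linarith

text \<open>\<open>Q\<close> is at least 1/3, so the argument of the logarithm is at least 2^29, and
  116 = 4 * 29.\<close>

lemma chi_bound_ge: "chi_bound d l \<rho> \<epsilon> \<delta> \<Delta> \<ge> 116"
proof -
  have "(2::real) ^ 29 \<le> 2 ^ 31 * Q" using Q_ge' by simp
  then have "2 powr 29 \<le> 2 ^ 31 * Q" by simp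
  moreover have "0 < 2 ^ 31 * Q" using Q_ge' by simp
  ultimately have "29 \<le> log 2 (2 ^ 31 * Q)" by (subst le_log_iff) auto
  then show ?thesis unfolding chi_bound_eq by linarith
qed

lemma chi_ge_116: "chi \<ge> 116"
  using chi_bound_ge chi_ge by linarith

lemma Q_le: "2 ^ 31 * Q \<le> 2 powr (chi / 4)"
proof -
  have "0 < 2 ^ 31 * Q" using Q_ge' by simp
  then have "2 ^ 31 * Q = 2 powr log 2 (2 ^ 31 * Q)" by simp
  also have "\<dots> \<le> 2 powr (chi / 4)" using chi_ge unfolding chi_bound_eq by (intro powr_mono) auto
  finally show ?thesis .
qed

lemma round_length_eq: "round_length l \<rho> \<epsilon> chi = l * chi / (p * e)"
  by (simp add: round_length_def real_sqrt_mult)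

lemma round_decrease_eq: "round_decrease \<rho> \<epsilon> chi = e ^ 3 / (50 * chi ^ 3 * p)"
proof -
  have "sqrt (\<epsilon> ^ 3 / \<rho>) = e ^ 3 / p" by (simp add: real_sqrt_divide real_sqrt_power)
  then show ?thesis by (simp add: round_decrease_def)
qed

lemma round_decrease_pos: "round_decrease \<rho> \<epsilon> chi > 0"
  using p_pos e_pos chi_ge_116 by (simp add: round_decrease_eq)

lemma round_decrease_le: "round_decrease \<rho> \<epsilon> chi \<le> \<Delta>"
proof -
  have "1 \<le> chi ^ 3" using chi_ge_116 by (intro one_le_power) auto
  then have "3 * (p * \<Delta>) \<le> (50 * chi ^ 3) * (p * \<Delta>)" using p_pos Delta_pos by (intro mult_right_mono) auto
  then have "e ^ 3 \<le> \<Delta> * (50 * chi ^ 3 * p)" using gap' by (simp add: algebra_simps)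
  then show ?thesis unfolding round_decrease_eq using p_pos chi_ge_116 by (simp add: pos_divide_le_eq)
qed

text \<open>The middle term of the maximum dominates: against the first because F is at most
  \<Delta>, against the third because of the power of chi.\<close>

lemma horizon_eq: "horizon l \<rho> \<epsilon> chi \<Delta> = 400 * chi ^ 4 * (l * \<Delta> / \<epsilon>\<^sup>2)"
proof -
  let ?N = "round_length l \<rho> \<epsilon> chi" and ?F = "round_decrease \<rho> \<epsilon> chi"
  have c: "chi > 0" using chi_ge_116 by simp
  have mid: "\<Delta> * ?N / ?F = 50 * chi ^ 4 * (l * \<Delta> / \<epsilon>\<^sup>2)"
  proof -
    have e4: "\<epsilon>\<^sup>2 = e * e ^ 3" by (simp add: power2_eq_square power3_eq_cube eps less_imp_le)
    show ?thesis unfolding round_length_eq round_decrease_eq e4 using p_pos e_pos c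
      by (simp add: divide_simps power_numeral_reduce)
  qed
  have "?N / 3 \<le> \<Delta> * ?N / ?F"
  proof -
    have N: "0 \<le> ?N" using l_pos p_pos e_pos c by (simp add: round_length_eq)
    have "?N * ?F \<le> ?N * (3 * \<Delta>)" using round_decrease_le Delta_pos N by (intro mult_left_mono) auto
    then show ?thesis using round_decrease_pos by (simp add: field_simps)
  qed
  moreover have "\<Delta> / ((1 / l) * \<epsilon>\<^sup>2) \<le> \<Delta> * ?N / ?F"
  proof -
    have "1 \<le> chi ^ 4" using chi_ge_116 by (intro one_le_power) auto
    then have "1 * (l * \<Delta> / \<epsilon>\<^sup>2) \<le> 50 * chi ^ 4 * (l * \<Delta> / \<epsilon>\<^sup>2)"
      using l_pos Delta_pos by (intro mult_right_mono) auto
    then show ?thesis unfolding mid by (simp add: mult.commute[of l])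
  qed
  ultimately have "horizon l \<rho> \<epsilon> chi \<Delta> = 8 * (\<Delta> * ?N / ?F)"
    unfolding horizon_def by (simp add: max_def)
  then show ?thesis unfolding mid by simp
qed

text \<open>The bound on the probability that a draw at a saddle leaves the round localized: 6 w d /
  r from the thin-set estimate, see \<open>pfail_eq\<close>, with the parameters inserted.\<close>

definition pfail :: real where
  "pfail = 6400 * chi\<^sup>2 * real d * l * 2 powr (- chi) / (p * e)"

lemma pfail_nonneg: "pfail \<ge> 0"
  using l_pos p_pos e_pos by (simp add: pfail_def)

text \<open>Four of the powers come from the horizon and two from \<open>pfail\<close>. A sixth of
  the exponent is compared with its exponential and raised to the sixth power; 24^6 is below
  2^28.\<close>

lemma power6_le: "chi ^ 6 \<le> 2 ^ 28 * 2 powr (chi / 2)"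
proof -
  have c: "chi > 0" using chi_ge_116 by simp
  have "chi / 12 * (1 / 2) \<le> chi / 12 * ln 2" using c half_le_ln2 by (intro mult_left_mono) auto
  also have "\<dots> \<le> exp (chi / 12 * ln 2)" using exp_ge_add_one_self[of "chi / 12 * ln 2"] by linarith
  finally have "(chi / 24) ^ 6 \<le> exp (chi / 12 * ln 2) ^ 6" using c by (intro power_mono) auto
  also have "\<dots> = 2 powr (chi / 2)" by (simp add: powr_def flip: exp_of_nat_mult)
  finally have "chi ^ 6 \<le> 24 ^ 6 * 2 powr (chi / 2)" by (simp add: power_divide)
  also have "\<dots> \<le> 2 ^ 28 * 2 powr (chi / 2)" by (intro mult_right_mono) auto
  finally show ?thesis .
qed

text \<open>The factor 2 covers the number of indices up to \<open>T\<close>. Half of the exponent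
  of 2 powr (- chi) pays for Q^2, the other half for chi^6. What remains is 15360000 * 2^28 / 2^62,
  below 1.\<close>

lemma union_bound: "2 * horizon l \<rho> \<epsilon> chi \<Delta> * pfail \<le> \<delta>"
proof -
  have c: "chi > 0" using chi_ge_116 by simp
  have e4: "\<epsilon>\<^sup>2 = e ^ 4" using eps by (simp add: power_numeral_reduce)
  have "2 * horizon l \<rho> \<epsilon> chi \<Delta> * pfail =
      5120000 * chi ^ 6 * (\<delta> * Q * sqrt (real d)) * 2 powr (- chi)"
    unfolding horizon_eq pfail_def e4 Q_def using p_pos e_pos delta
    by (simp add: divide_simps power_numeral_reduce)
  also have "\<dots> \<le> 5120000 * chi ^ 6 * (\<delta> * Q * (3 * Q)) * 2 powr (- chi)"
    using Q_ge Q_ge' delta c by (intro mult_right_mono mult_left_mono) auto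
  also have "\<dots> = \<delta> * (15360000 * chi ^ 6 * Q\<^sup>2 * 2 powr (- chi))" by (simp add: power2_eq_square)
  also have "\<dots> \<le> \<delta> * 1"
  proof (intro mult_left_mono)
    have "(2 ^ 31 * Q)\<^sup>2 \<le> (2 powr (chi / 4))\<^sup>2" using Q_le Q_ge' by (intro power_mono) auto
    also have "(2 powr (chi / 4))\<^sup>2 = 2 powr (chi / 2)" by (simp add: power2_eq_square flip: powr_add)
    finally have "2 ^ 62 * Q\<^sup>2 \<le> 2 powr (chi / 2)" by (simp add: power_mult_distrib)
    then have "chi ^ 6 * (2 ^ 62 * Q\<^sup>2) \<le> (2 ^ 28 * 2 powr (chi / 2)) * 2 powr (chi / 2)"
      using power6_le by (intro mult_mono) auto
    also have "\<dots> = 2 ^ 28 * 2 powr chi" by (simp flip: powr_add)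
    finally have "chi ^ 6 * (2 ^ 62 * Q\<^sup>2) * 2 powr (- chi) \<le> 2 ^ 28 * 2 powr chi * 2 powr (- chi)"
      by (intro mult_right_mono) auto
    also have "\<dots> = 2 ^ 28" by (simp flip: powr_add)
    finally have "2 ^ 62 * (chi ^ 6 * Q\<^sup>2 * 2 powr (- chi)) \<le> 2 ^ 28" by (simp only: mult.assoc mult.left_commute)
    moreover have "15360000 * Z \<le> 1" if "2 ^ 62 * Z \<le> 2 ^ 28" for Z :: real using that by simp
    ultimately have "15360000 * (chi ^ 6 * Q\<^sup>2 * 2 powr (- chi)) \<le> 1" by blast
    then show "15360000 * chi ^ 6 * Q\<^sup>2 * 2 powr (- chi) \<le> 1" by (simp only: mult.assoc)
  qed (use delta in auto)
  finally show ?thesis by simp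
qed

end

text \<open>152 = 4 * 38, and 38 collects 31 from the power of two, 6 from twice the bound 3 s on
  the logarithms, and 1 from ln d; the doubling comes from dividing by ln 2.\<close>

lemma (in prgd_numbers) chi_bound_le:
  "chi_bound d l \<rho> \<epsilon> \<delta> \<Delta> \<le> 152 * (1 + ln (real d)) *
    (1 + \<bar>ln l\<bar> + \<bar>ln \<Delta>\<bar> + \<bar>ln (1 / \<delta>)\<bar> + \<bar>ln (1 / \<rho>)\<bar> + \<bar>ln (1 / \<epsilon>)\<bar>)"
proof -
  define s where "s = 1 + \<bar>ln l\<bar> + \<bar>ln \<Delta>\<bar> + \<bar>ln (1 / \<delta>)\<bar> + \<bar>ln (1 / \<rho>)\<bar> + \<bar>ln (1 / \<epsilon>)\<bar>"
  define D where "D = ln (real d)"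
  have D: "D \<ge> 0" using d by (simp add: D_def)
  have s: "s \<ge> 1" by (simp add: s_def)
  have "ln Q = 2 * ln l + D / 2 + ln \<Delta> - ln \<delta> - ln \<rho> / 2 - 5 * (ln \<epsilon> / 2)"
    using l_pos d Delta_pos delta rho eps
    by (simp add: Q_def D_def ln_mult ln_div ln_sqrt ln_realpow)
  also have "\<dots> \<le> 3 * s + D / 2"
  proof -
    have "ln (1 / \<delta>) = - ln \<delta>" "ln (1 / \<rho>) = - ln \<rho>" "ln (1 / \<epsilon>) = - ln \<epsilon>"
      using delta rho eps by (simp_all add: ln_div)
    moreover have "2 * A + D / 2 + B - x - y / 2 - 5 * (z / 2) \<le> 3 * (1 + A' + B' + x' + y' + z') + D / 2"
      if "A \<le> A'" "B \<le> B'" "- x \<le> x'" "- y \<le> y'" "- z \<le> z'" "0 \<le> A'" "0 \<le> B'" "0 \<le> x'" "0 \<le> y'" "0 \<le> z'"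
      for A B x y z A' B' x' y' z' :: real
      using that by argo
    ultimately show ?thesis unfolding s_def by simp
  qed
  finally have lnQ: "ln Q \<le> 3 * s + D / 2" .
  have Q: "Q > 0" using Q_ge' by linarith
  have "log 2 (2 ^ 31 * Q) = 31 + ln Q / ln 2"
    using Q by (simp add: log_def ln_mult ln_realpow[of 2 31, simplified] add_divide_distrib)
  also have "ln Q / ln 2 \<le> (3 * s + D / 2) / ln 2" using lnQ by (intro divide_right_mono) auto
  also have "\<dots> \<le> (3 * s + D / 2) / (1 / 2)" using half_le_ln2 s D by (intro divide_left_mono) auto
  also have "31 + (3 * s + D / 2) / (1 / 2) = 31 * 1 + 6 * s + D" by simp
  also have "\<dots> \<le> 38 * s * (1 + D)"
  proof -
    have "D \<le> s * D" using mult_right_mono[OF s D] by simp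
    moreover have "0 \<le> s * D" using s D by simp
    ultimately show ?thesis using s by (simp add: algebra_simps)
  qed
  finally show ?thesis unfolding chi_bound_eq s_def[symmetric] D_def by (simp add: algebra_simps)
qed

lemma horizon_order:
  fixes \<kappa> :: real
  assumes \<kappa>: "\<kappa> > 0"
  shows "\<exists>C>0. \<exists>p::nat. \<forall>d::nat. \<forall>l' \<rho>' \<epsilon>' \<delta>' \<Delta> chi' :: real.
       d \<ge> 1 \<longrightarrow> \<rho>' > 0 \<longrightarrow> \<epsilon>' > 0 \<longrightarrow> l' \<ge> sqrt (\<rho>' * \<epsilon>') \<longrightarrow> 0 < \<delta>' \<longrightarrow> \<delta>' < 1 \<longrightarrow>
       \<epsilon>' powr (3 / 2) \<le> 3 * sqrt \<rho>' * \<Delta> \<longrightarrow> chi' > 1 / 4 \<longrightarrow>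
       chi_bound d l' \<rho>' \<epsilon>' \<delta>' \<Delta> \<le> chi' \<longrightarrow> chi' \<le> \<kappa> * chi_bound d l' \<rho>' \<epsilon>' \<delta>' \<Delta> \<longrightarrow>
       horizon l' \<rho>' \<epsilon>' chi' \<Delta> \<le> C * (l' * \<Delta> / \<epsilon>'\<^sup>2) * (1 + ln (real d)) ^ 4 *
         (1 + \<bar>ln l'\<bar> + \<bar>ln \<Delta>\<bar> + \<bar>ln (1 / \<delta>')\<bar> + \<bar>ln (1 / \<rho>')\<bar> + \<bar>ln (1 / \<epsilon>')\<bar>) ^ p"
\<comment> \<open>The horizon is proportional to chi^4, hence both the exponent 4 and the fourth
  power in the constant.\<close>
proof (rule exI[of _ "400 * (152 * \<kappa>) ^ 4"], intro conjI exI[of _ 4] allI impI)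
  fix d :: nat and l \<rho> \<epsilon> \<delta> \<Delta> chi :: real
  assume "d \<ge> 1" "\<rho> > 0" "\<epsilon> > 0" "l \<ge> sqrt (\<rho> * \<epsilon>)" "0 < \<delta>" "\<delta> < 1"
    "\<epsilon> powr (3 / 2) \<le> 3 * sqrt \<rho> * \<Delta>" "chi_bound d l \<rho> \<epsilon> \<delta> \<Delta> \<le> chi"
  then interpret prgd_numbers d l \<rho> \<epsilon> \<delta> \<Delta> chi by unfold_locales
  assume le: "chi \<le> \<kappa> * chi_bound d l \<rho> \<epsilon> \<delta> \<Delta>"
  define s where "s = 1 + \<bar>ln l\<bar> + \<bar>ln \<Delta>\<bar> + \<bar>ln (1 / \<delta>)\<bar> + \<bar>ln (1 / \<rho>)\<bar> + \<bar>ln (1 / \<epsilon>)\<bar>"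
  have "chi \<le> \<kappa> * (152 * (1 + ln (real d)) * s)"
    unfolding s_def using le mult_left_mono[OF chi_bound_le, of \<kappa>] \<kappa> by linarith
  then have "chi ^ 4 \<le> (\<kappa> * (152 * (1 + ln (real d)) * s)) ^ 4"
    using chi_ge_116 by (intro power_mono) auto
  also have "\<dots> = (152 * \<kappa>) ^ 4 * (1 + ln (real d)) ^ 4 * s ^ 4" by (simp only: power_mult_distrib mult_ac)
  finally have c4: "chi ^ 4 \<le> (152 * \<kappa>) ^ 4 * (1 + ln (real d)) ^ 4 * s ^ 4" .
  have "400 * chi ^ 4 * (l * \<Delta> / \<epsilon>\<^sup>2) \<le>
      400 * ((152 * \<kappa>) ^ 4 * (1 + ln (real d)) ^ 4 * s ^ 4) * (l * \<Delta> / \<epsilon>\<^sup>2)"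
    by (rule mult_right_mono[OF mult_left_mono[OF c4]]) (use l_pos Delta_pos in auto)
  then show "horizon l \<rho> \<epsilon> chi \<Delta> \<le> 400 * (152 * \<kappa>) ^ 4 * (l * \<Delta> / \<epsilon>\<^sup>2) * (1 + ln (real d)) ^ 4 *
       (1 + \<bar>ln l\<bar> + \<bar>ln \<Delta>\<bar> + \<bar>ln (1 / \<delta>)\<bar> + \<bar>ln (1 / \<rho>)\<bar> + \<bar>ln (1 / \<epsilon>)\<bar>) ^ 4"
    unfolding horizon_eq s_def[symmetric] by (simp only: mult_ac)
qed (use \<kappa> in simp)

text \<open>Convexity: on [0, 1] the function 2^y lies below its chord 1 + y.\<close>

lemma two_powr_le:
  fixes y :: real
  assumes "0 \<le> y" "y \<le> 1"
  shows "2 powr y \<le> 1 + y"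
proof -
  have "exp ((1 - y) * 0 + y * ln 2) \<le> (1 - y) * exp 0 + y * exp (ln 2)"
    using convex_onD[OF exp_convex, of y 0 "ln 2"] assms by simp
  then show ?thesis by (simp add: powr_def)
qed

section \<open>One round of the algorithm\<close>

text \<open>A real supremum bounds its elements only if the set is bounded above; the norm
  equivalence supplies this, and v = 0 contributes 0 / 0 = 0.\<close>

lemma (in inner_form) nrm_le_operator_norm:
  assumes A: "linear A"
  shows "nrm (A v) \<le> (SUP v. nrm (A v) / nrm v) * nrm v"
proof (cases "v = 0")
  case True
  then show ?thesis by (simp add: linear_0[OF A])
next
  case False
  obtain c where c: "c > 0" "\<And>v. c * norm v \<le> nrm v" using nrm_lower by blast
  obtain C where C: "C > 0" "\<And>v. nrm v \<le> C * norm v" using nrm_upper by blast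
  obtain K where K: "\<And>v. norm (A v) \<le> norm v * K" "K > 0"
    using bounded_linear.pos_bounded[of A] A linear_conv_bounded_linear by blast
  have "nrm (A v) / nrm v \<le> C * K / c" for v
  proof (cases "v = 0")
    case True
    then show ?thesis using c(1) C(1) K(2) by simp
  next
    case False
    have "nrm (A v) \<le> C * (norm v * K)" using C(2)[of "A v"] K(1)[of v] C(1)
      by (meson mult_left_mono order_trans less_imp_le)
    also have "\<dots> \<le> C * (nrm v / c * K)"
      using c C(1) K(2) by (intro mult_left_mono mult_right_mono) (auto simp: field_simps)
    finally show ?thesis using nrm_pos[OF False] by (simp add: field_simps)
  qed
  then have "bdd_above (range (\<lambda>v. nrm (A v) / nrm v))" by (intro bdd_aboveI[of _ "C * K / c"]) auto
  then have "nrm (A v) / nrm v \<le> (SUP v. nrm (A v) / nrm v)" by (rule cSUP_upper[OF UNIV_I])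
  then show ?thesis using nrm_pos[OF False] by (simp add: field_simps)
qed

locale prgd_setting = retraction_C2 M f R + prgd_numbers "DIM('e)" l \<rho> \<epsilon> \<delta> "f x0 - fstar" chi
  for M :: "('m::{t2_space, second_countable_topology}, 'e::euclidean_space) manifold" and f R
    and l \<rho> \<epsilon> \<delta> chi :: real and x0 :: 'm and fstar :: real +
  fixes \<beta> :: real and b :: ereal and N :: nat
  assumes f_ge: "\<And>x. fstar \<le> f x"
    and b_pos: "0 < b" and b_ge: "ereal (sqrt (\<epsilon> / \<rho>)) \<le> b"
    and lipschitz: "\<And>x s s'. ereal (tnorm M x s) \<le> b \<Longrightarrow> ereal (tnorm M x s') \<le> b \<Longrightarrow>
         tnorm M x (pullback_grad M R f x s - pullback_grad M R f x s') \<le> l * tnorm M x (s - s')"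
    and Hess_lipschitz: "\<And>x s. ereal (tnorm M x s) \<le> b \<Longrightarrow>
         tonorm M x (\<lambda>v. pullback_Hess M R f x s v - pullback_Hess M R f x 0 v) \<le> \<rho> * tnorm M x s"
    and beta: "0 \<le> \<beta>" "\<beta> \<noteq> 0 \<Longrightarrow> \<epsilon> \<le> \<rho> / \<beta>\<^sup>2"
    and acceleration: "\<And>x s. tnorm M x s = 1 \<Longrightarrow>
         tnorm M x (intrinsic_acceleration M (\<lambda>\<tau>. R x (\<tau> *\<^sub>R s)) 0) \<le> \<beta>"
    and N: "real N = round_length l \<rho> \<epsilon> chi"
begin

abbreviation "F \<equiv> round_decrease \<rho> \<epsilon> chi"
abbreviation "r \<equiv> \<epsilon> / (400 * chi ^ 3)"
text \<open>
  \<open>S\<close> is the radius around its starting point that a round without sufficient decrease cannot leave;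
  \<open>m\<close> bounds the norms of the iterates of such a round, the perturbation included.
\<close>

definition S :: real where "S = e / (4 * p * chi)"
definition m :: real where "m = e / (3 * p * chi)"
abbreviation "bad \<equiv> localized_set (1 / l) S N"

lemma chi_pos: "chi > 0"
  using chi_ge_116 by simp

lemma r_pos: "r > 0"
  using eps chi_pos by simp

lemma sqrt_quot: "sqrt (\<epsilon> / \<rho>) = e / p"
  by (simp add: real_sqrt_divide)

lemma eps_over_l: "\<epsilon> / l \<le> e / p"
proof -
  have "\<epsilon> * p = e * (p * e)" using e_sq by (simp add: power2_eq_square)
  also have "\<dots> \<le> e * l" using l_ge' e_pos by (intro mult_left_mono) auto
  finally show ?thesis using l_pos p_pos by (simp add: field_simps)
qed

lemma r_over_l: "r / l \<le> e / p / (400 * chi ^ 3)"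
  using divide_right_mono[OF eps_over_l, of "400 * chi ^ 3"] chi_pos by (simp add: mult.commute)

lemma S_m: "S + r / l \<le> m" and m_less: "m < e / p" and m_nonneg: "0 \<le> m" and S_nonneg: "0 \<le> S"
proof -
  have q: "0 < e / p" using e_pos p_pos by simp
  \<comment> \<open>Makes the perturbation radius r / l at most 1/5000 of e / (p chi), which fits
    between the coefficient 1/4 of \<open>S\<close> and 1/3 of \<open>m\<close>.\<close>
  have "(5000::real) * chi \<le> 400 * chi ^ 3"
  proof -
    have "116 * 116 \<le> chi * chi" using chi_ge_116 by (intro mult_mono) auto
    then have "5000 * chi \<le> (400 * (chi * chi)) * chi" using chi_pos by (intro mult_right_mono) auto
    then show ?thesis by (simp add: power3_eq_cube mult.assoc)
  qed
  then have "e / p / (400 * chi ^ 3) \<le> e / p / (5000 * chi)"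
    using q chi_pos by (intro divide_left_mono) auto
  then have "r / l \<le> e / p / (5000 * chi)" using r_over_l by linarith
  moreover define k where "k = e / p / chi"
  moreover have "S = (1 / 4) * k" and mk: "m = (1 / 3) * k" by (simp_all add: S_def m_def k_def)
  moreover have "e / p / (5000 * chi) = (1 / 5000) * k" by (simp add: k_def)
  moreover have c: "0 < k" unfolding k_def by (rule divide_pos_pos[OF q chi_pos])
  ultimately show "S + r / l \<le> m" "0 \<le> m" "0 \<le> S" by argo+
  have "k \<le> e / p / 1" unfolding k_def using q chi_ge_116 by (intro divide_left_mono) auto
  then show "m < e / p" using mk c by argo
qed

lemma m_b: "ereal m < b"
  using m_less b_ge unfolding sqrt_quot by (meson ereal_less(2) less_ereal.simps(1) less_le_trans)

lemma model: "tangent_model M x R f l \<rho> b"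
proof -
  interpret I: inner_form "metric M x" using metric_inner by unfold_locales
  have tn: "tnorm M x = I.nrm" by (auto simp: tnorm_def I.nrm_def)
  show ?thesis
  proof unfold_locales
    fix s v assume s: "ereal (tnorm M x s) \<le> b"
    have lin: "linear (\<lambda>v. pullback_Hess M R f x s v - pullback_Hess M R f x 0 v)"
      by (intro linear_compose_sub has_derivative_linear[OF pullback_grad_deriv])
    have "tnorm M x (pullback_Hess M R f x s v - pullback_Hess M R f x 0 v) \<le>
        tonorm M x (\<lambda>v. pullback_Hess M R f x s v - pullback_Hess M R f x 0 v) * tnorm M x v"
      unfolding tonorm_def tn by (rule I.nrm_le_operator_norm[OF lin])
    also have "\<dots> \<le> \<rho> * tnorm M x s * tnorm M x v"
      using Hess_lipschitz[OF s] by (intro mult_right_mono tnorm_nonneg)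
    finally show "tnorm M x (pullback_Hess M R f x s v - pullback_Hess M R f x 0 v) \<le> \<rho> * tnorm M x s * tnorm M x v" .
  qed (use pullback_deriv pullback_grad_deriv pullback_Hess_sym l_pos rho b_pos lipschitz in auto)
qed

text \<open>Gradient descent on the tangent space sees the pullback Hessian, so the direction has to
  be its eigenvector. A direction v of negative curvature for f only certifies that the bottom
  eigenvalue is low enough: its curvature changes by at most \<epsilon> \<beta>.\<close>

lemma strict_saddle_direction:
  assumes low: "tnorm M x (rgrad M f x) \<le> \<epsilon>" and nc: "\<not> second_order_critical M f \<rho> (\<sigma> * \<epsilon>) x"
    and \<sigma>: "\<sigma> = 4 \<or> \<sigma> = 1 \<and> \<beta> = 0"
  shows "\<exists>\<gamma> u. tnorm M x u = 1 \<and> pullback_Hess M R f x 0 u = - \<gamma> *\<^sub>R u \<and> p * e \<le> \<gamma> \<and>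
    (\<forall>v. - \<gamma> * metric M x v v \<le> metric M x (pullback_Hess M R f x 0 v) v)"
proof -
  interpret T: tangent_model M x R f l \<rho> b by (rule model)
  have \<sigma>1: "1 \<le> \<sigma>" using \<sigma> by auto
  have "1 * \<epsilon> \<le> \<sigma> * \<epsilon>" using \<sigma>1 eps by (intro mult_right_mono) auto
  then have "tnorm M x (rgrad M f x) \<le> \<sigma> * \<epsilon>" using low by linarith
  then have "\<not> - sqrt (\<rho> * (\<sigma> * \<epsilon>)) \<le> min_eigenvalue (rHess M f x)"
    using nc by (simp add: second_order_critical_def)
  then obtain v0 where v0: "metric M x (rHess M f x v0) v0 < - sqrt (\<rho> * (\<sigma> * \<epsilon>)) * metric M x v0 v0"
    unfolding min_eigenvalue_rHess_iff by (auto simp: not_le)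
  then have nz: "v0 \<noteq> 0" by (auto simp: linear_0[OF rHess_linear])
  define v where "v = (1 / T.nrm v0) *\<^sub>R v0"
  have nv: "T.nrm v = 1" using nz by (simp add: v_def)
  have vv: "metric M x v v = 1" using T.nrm_sq[of v] nv by simp
  have "metric M x (rHess M f x v) v = metric M x (rHess M f x v0) v0 / (T.nrm v0)\<^sup>2"
    unfolding v_def by (simp add: linear_scale[OF rHess_linear] power2_eq_square)
  also have "\<dots> < - sqrt (\<rho> * (\<sigma> * \<epsilon>))"
    using v0 T.pos[OF nz] unfolding T.nrm_sq by (simp add: divide_less_eq)
  finally have rv: "metric M x (rHess M f x v) v < - sqrt (\<rho> * (\<sigma> * \<epsilon>))" .
  have "metric M x (rgrad M f x) (intrinsic_acceleration M (\<lambda>\<tau>. R x (\<tau> *\<^sub>R v)) 0) \<le>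
      T.nrm (rgrad M f x) * T.nrm (intrinsic_acceleration M (\<lambda>\<tau>. R x (\<tau> *\<^sub>R v)) 0)"
    by (rule T.cauchy_schwarz')
  also have "\<dots> \<le> \<epsilon> * \<beta>"
    using low acceleration[of x v] nv eps unfolding T.tnorm_eq by (intro mult_mono) auto
  finally have Hv: "metric M x (pullback_Hess M R f x 0 v) v < - sqrt (\<rho> * (\<sigma> * \<epsilon>)) + \<epsilon> * \<beta>"
    using rv unfolding pullback_Hess_0 by linarith
  also have "\<dots> \<le> - (p * e)"
  proof (cases "\<beta> = 0")
    case True
    have "\<rho> * \<epsilon> \<le> \<rho> * (\<sigma> * \<epsilon>)" using \<open>1 * \<epsilon> \<le> \<sigma> * \<epsilon>\<close> rho by (intro mult_left_mono) auto
    then have "sqrt (\<rho> * \<epsilon>) \<le> sqrt (\<rho> * (\<sigma> * \<epsilon>))" by (rule real_sqrt_le_mono)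
    then show ?thesis using True by (simp add: real_sqrt_mult)
  next
    case False
    then have "\<sigma> = 4" using \<sigma> by simp
    then have s: "sqrt (\<rho> * (\<sigma> * \<epsilon>)) = 2 * (p * e)" by (simp add: real_sqrt_mult)
    have "\<beta> > 0" using beta(1) False by simp
    have "\<epsilon> * \<beta>\<^sup>2 \<le> \<rho>" using beta(2)[OF False] \<open>\<beta> > 0\<close> by (simp add: field_simps)
    \<comment> \<open>The bound \<epsilon> \<le> \<rho> / \<beta>^2 says that \<epsilon> \<beta> is
      at most p e, half of 2 p e.\<close>
    then have "sqrt (\<epsilon> * \<beta>\<^sup>2) \<le> sqrt \<rho>" by (rule real_sqrt_le_mono)
    then have "e * \<beta> \<le> p" using \<open>\<beta> > 0\<close> by (simp add: real_sqrt_mult)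
    then have "e * (e * \<beta>) \<le> e * p" using e_pos by (intro mult_left_mono) auto
    moreover have "e * (e * \<beta>) = \<epsilon> * \<beta>" using real_sqrt_mult_self[of \<epsilon>] eps by (simp only: mult.assoc[symmetric] abs_of_pos)
    ultimately show ?thesis unfolding s using mult.commute[of e p] by argo
  qed
  finally have Hv': "metric M x (pullback_Hess M R f x 0 v) v < - (p * e)" .
  obtain e1 k where e1: "e1 \<noteq> 0" "pullback_Hess M R f x 0 e1 = k *\<^sub>R e1"
    and k: "\<And>v. k * metric M x v v \<le> metric M x (pullback_Hess M R f x 0 v) v"
    using T.min_eigenvector[OF has_derivative_linear[OF pullback_grad_deriv] pullback_Hess_sym] by blast
  define u where "u = (1 / T.nrm e1) *\<^sub>R e1"
  have "k \<le> - (p * e)" using k[of v] Hv' vv by simp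
  moreover have "T.nrm u = 1" using e1(1) by (simp add: u_def)
  moreover have "pullback_Hess M R f x 0 u = - (- k) *\<^sub>R u"
    by (simp add: u_def linear_scale[OF has_derivative_linear[OF pullback_grad_deriv]] e1(2))
  ultimately show ?thesis using k unfolding T.tnorm_eq by (intro exI[of _ "- k"] exI[of _ u]) auto
qed

text \<open>Each step multiplies by at least 1 + y with y = p e / l in (0, 1], hence by at least 2
  powr y, and the round length is chosen so that N y = chi.\<close>

lemma growth: 
  assumes "p * e \<le> \<gamma>"
  shows "2 powr chi \<le> (1 + \<gamma> / l) ^ N"
proof -
  define y where "y = p * e / l"
  have y: "0 < y" "y \<le> 1" using p_pos e_pos l_pos l_ge' by (auto simp: y_def)
  have "real N * y = chi" unfolding N round_length_eq y_def using p_pos e_pos l_pos by simp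
  then have "2 powr chi = (2 powr y) ^ N"
    by (simp add: powr_power mult.commute)
  also have "\<dots> \<le> (1 + \<gamma> / l) ^ N"
  proof (rule power_mono)
    have "y \<le> \<gamma> / l" using assms l_pos by (simp add: y_def divide_right_mono)
    then show "2 powr y \<le> 1 + \<gamma> / l" using two_powr_le[of y] y by linarith
  qed simp
  finally show ?thesis .
qed

text \<open>The 3 in the definition of \<open>m\<close> makes the exponent 1/3, and exp (1/3) is
  below 3/2; the factor 2 - (1 + k)^N in \<open>gd_separation\<close> then stays at least
  1/2.\<close>

lemma error_growth: "(1 + \<rho> * m / l) ^ N \<le> 3 / 2"
proof -
  have "real N * (\<rho> * m / l) = 1 / 3"
    unfolding N round_length_eq m_def using p_pos e_pos l_pos chi_pos p_sq
    by (simp add: divide_simps power2_eq_square)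
  have "(1 + \<rho> * m / l) ^ N \<le> exp (\<rho> * m / l) ^ N"
    using rho m_nonneg l_pos by (intro power_mono exp_ge_add_one_self) (auto intro!: add_nonneg_nonneg)
  also have "\<dots> = exp (1 / 3)"
    unfolding exp_of_nat_mult[symmetric] \<open>real N * (\<rho> * m / l) = 1 / 3\<close> ..
  also have "\<dots> \<le> 3 / 2" using exp_bound[of "1 / 3"] by (simp add: power2_eq_square)
  finally show ?thesis .
qed

text \<open>Twice the bound that \<open>gd_separation\<close> gives, so that translates by \<open>w\<close> are disjoint.\<close>

definition w :: real where "w = 8 * m * l * 2 powr (- chi)"

lemma w_pos: "w > 0"
  using e_pos p_pos chi_pos l_pos by (simp add: w_def m_def)

text \<open>The two starting points differ by \<mu> / l along the bottom eigenvector. After N steps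
  the runs are at least 2 powr chi times half of that apart, yet both are within \<open>m\<close> of
  the origin.\<close>

lemma bad_thin:
  assumes u: "tnorm M x u = 1" "pullback_Hess M R f x 0 u = - \<gamma> *\<^sub>R u" and \<gamma>: "p * e \<le> \<gamma>"
    and low: "\<And>v. - \<gamma> * metric M x v v \<le> metric M x (pullback_Hess M R f x 0 v) v"
    and v: "tnorm M x v \<le> r" "(x, v) \<in> bad" and v': "tnorm M x (v + \<mu> *\<^sub>R u) \<le> r" "(x, v + \<mu> *\<^sub>R u) \<in> bad"
  shows "\<bar>\<mu>\<bar> < w"
proof -
  interpret T: tangent_model M x R f l \<rho> b by (rule model)
  have loc: "T.nrm ((T.gd ^^ j) ((1 / l) *\<^sub>R v)) \<le> m" if "tnorm M x v \<le> r" "(x, v) \<in> bad" "j \<le> N" for v j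
  proof -
    have "T.nrm ((T.gd ^^ j) ((1 / l) *\<^sub>R v) - (1 / l) *\<^sub>R v) \<le> S"
      using that by (simp add: localized_set_def T.tnorm_eq)
    moreover have "T.nrm ((1 / l) *\<^sub>R v) \<le> r / l"
      using divide_right_mono[OF that(1), of l] l_pos by (simp add: T.tnorm_eq)
    ultimately show ?thesis
      using T.nrm_triangle[of "(T.gd ^^ j) ((1 / l) *\<^sub>R v) - (1 / l) *\<^sub>R v" "(1 / l) *\<^sub>R v"] S_m by simp
  qed
  define s d0 where "s = (1 / l) *\<^sub>R v" and "d0 = (\<mu> / l) *\<^sub>R u"
  have sd: "s + d0 = (1 / l) *\<^sub>R (v + \<mu> *\<^sub>R u)" by (simp add: s_def d0_def algebra_simps)
  have \<gamma>0: "0 \<le> \<gamma>" using \<gamma> p_pos e_pos by (meson mult_pos_pos less_imp_le order_trans)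
  have "(1 + \<gamma> / l) ^ N * T.nrm d0 * (2 - (1 + \<rho> * m / l) ^ N) \<le> T.nrm ((T.gd ^^ N) (s + d0) - (T.gd ^^ N) s)"
  proof (rule T.gd_separation)
    show "T.H 0 d0 = - \<gamma> *\<^sub>R d0"
      by (simp add: d0_def linear_scale[OF has_derivative_linear[OF T.deriv2]] u(2))
    show "T.nrm ((T.gd ^^ j) s) \<le> m" "T.nrm ((T.gd ^^ j) (s + d0)) \<le> m" if "j < N" for j
      unfolding sd using loc[OF v] loc[OF v'] that by (auto simp: s_def)
  qed (use low \<gamma>0 m_b m_nonneg in auto)
  also have "\<dots> \<le> 2 * m"
    using T.nrm_diff[of "(T.gd ^^ N) (s + d0)" "(T.gd ^^ N) s"] loc[OF v, of N] loc[OF v', of N]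
    unfolding sd by (simp add: s_def)
  finally have up: "(1 + \<gamma> / l) ^ N * T.nrm d0 * (2 - (1 + \<rho> * m / l) ^ N) \<le> 2 * m" .
  have lo: "2 powr chi * T.nrm d0 * (1 / 2) \<le> (1 + \<gamma> / l) ^ N * T.nrm d0 * (2 - (1 + \<rho> * m / l) ^ N)"
    using growth[OF \<gamma>] error_growth \<gamma>0 l_pos by (intro mult_mono) (auto intro!: mult_nonneg_nonneg)
  have "T.nrm d0 = \<bar>\<mu>\<bar> / l" using u(1) l_pos by (simp add: d0_def T.tnorm_eq)
  with order_trans[OF lo up] have "2 powr chi * (\<bar>\<mu>\<bar> / l) * (1 / 2) \<le> 2 * m" by (simp only:)
  moreover have "Z \<le> 4 * k" if "Z * (1 / 2) \<le> 2 * k" for Z k :: real using that by simp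
  ultimately have "2 powr chi * (\<bar>\<mu>\<bar> / l) \<le> 4 * m" by blast
  then have "2 powr (- chi) * (2 powr chi * (\<bar>\<mu>\<bar> / l)) \<le> 2 powr (- chi) * (4 * m)"
    by (intro mult_left_mono) auto
  moreover have "2 powr (- chi) * (2 powr chi * (\<bar>\<mu>\<bar> / l)) = \<bar>\<mu>\<bar> / l"
    by (simp add: powr_minus field_simps)
  ultimately have "\<bar>\<mu>\<bar> / l \<le> 2 powr (- chi) * (4 * m)" by (simp only:)
  then have "\<bar>\<mu>\<bar> \<le> 4 * m * l * 2 powr (- chi)" unfolding pos_divide_le_eq[OF l_pos] by (simp only: mult_ac)
  also have "\<dots> < w" using w_pos by (simp add: w_def)
  finally show ?thesis .
qed

lemma pfail_eq: "pfail = 6 * w * DIM('e) / r"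
proof -
  \<comment> \<open>A fresh name for the root lets \<epsilon> be rewritten as a square without
    affecting the root itself.\<close>
  define E where "E = e"
  have E: "\<epsilon> = E * E" "E > 0" using eps by (simp_all add: E_def)
  show ?thesis
    unfolding pfail_def w_def m_def unfolding E_def[symmetric] unfolding E(1) using p_pos E(2) chi_pos
    by (simp add: divide_simps power2_eq_square power3_eq_cube)
qed

lemma bad_probability:
  assumes "tnorm M x (rgrad M f x) \<le> \<epsilon>" "\<not> second_order_critical M f \<rho> (\<sigma> * \<epsilon>) x" "\<sigma> = 4 \<or> \<sigma> = 1 \<and> \<beta> = 0"
  shows "measure (uniform_tball M x r 0) {v. (x, v) \<in> bad} \<le> pfail"
proof (cases "{v. (x, v) \<in> bad} \<in> sets lborel")
  \<comment> \<open>A slice that is not measurable has measure 0 by convention, which satisfies the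
    bound.\<close>
  case False
  then have "measure (uniform_tball M x r 0) {v. (x, v) \<in> bad} = 0"
    by (intro measure_notin_sets) (simp add: uniform_tball_def)
  then show ?thesis using pfail_nonneg by simp
next
  case True
  interpret T: tangent_model M x R f l \<rho> b by (rule model)
  obtain \<gamma> u where u: "tnorm M x u = 1" "pullback_Hess M R f x 0 u = - \<gamma> *\<^sub>R u" "p * e \<le> \<gamma>"
    "\<And>v. - \<gamma> * metric M x v v \<le> metric M x (pullback_Hess M R f x 0 v) v"
    using strict_saddle_direction[OF assms] by blast
  define A where "A = {v. T.nrm v \<le> r}"
  define Z where "Z = A \<inter> {v. (x, v) \<in> bad}"
  have tb: "tball M x r 0 = A" by (simp add: tball_def T.tnorm_eq A_def)
  have pos: "0 < measure lborel A" unfolding A_def using r_pos by (rule T.nball_pos)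
  have "measure lborel Z \<le> 6 * w * DIM('e) / r * measure lborel A"
    unfolding A_def
  proof (rule T.thin_set_measure)
    show "Z \<in> sets borel" unfolding Z_def A_def using True T.nball_sets by (intro sets.Int) auto
    show "Z \<subseteq> {v. T.nrm v \<le> r}" by (auto simp: Z_def A_def)
    show "T.nrm u = 1" using u(1) by (simp add: T.tnorm_eq)
    show "\<bar>\<mu>\<bar> < w" if "v \<in> Z" "v + \<mu> *\<^sub>R u \<in> Z" for v \<mu>
      by (rule bad_thin[OF u]) (use that in \<open>auto simp: Z_def A_def T.tnorm_eq\<close>)
  qed (use w_pos r_pos in auto)
  then have le: "measure lborel Z \<le> pfail * measure lborel A" by (simp only: pfail_eq)
  have "measure (uniform_tball M x r 0) {v. (x, v) \<in> bad} = measure lborel Z / measure lborel A"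
    unfolding uniform_tball_def tb Z_def
  proof (rule measure_uniform_measure)
    show "emeasure lborel A \<noteq> \<infinity>" unfolding A_def using T.nball_finite[of r] by simp
    show "emeasure lborel A \<noteq> 0" using pos by (auto simp: measure_def)
  qed (use True in simp)
  also have "\<dots> \<le> pfail" using le pos by (simp add: divide_le_eq)
  finally show ?thesis .
qed

lemma high_gradient_step:
  assumes "\<epsilon> < tnorm M x (rgrad M f x)"
  shows "f (tangent_space_steps M R f x 0 (1 / l) b 1) \<le> f x - \<epsilon>\<^sup>2 / (2 * l)"
proof -
  interpret T: tangent_model M x R f l \<rho> b by (rule model)
  have "ereal (\<epsilon> / l) \<le> b" using eps_over_l b_ge unfolding sqrt_quot by (meson ereal_less_eq(3) order_trans)
  then show ?thesis
    using T.large_gradient_decrease[of \<epsilon>] assms eps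
    by (simp add: tangent_space_steps_def retr_0 pullback_grad_0 T.tnorm_eq)
qed

text \<open>The linear and the quadratic cost of the draw are each at most \<epsilon> r / l, and
  this is at most F/8 because the 400 in \<open>r\<close> is eight times the 50 in F.\<close>

lemma perturbed_start:
  assumes low: "tnorm M x (rgrad M f x) \<le> \<epsilon>" and \<xi>: "\<xi> \<in> tball M x r 0"
  shows "ereal (tnorm M x ((1 / l) *\<^sub>R \<xi>)) < b" "tnorm M x ((1 / l) *\<^sub>R \<xi>) \<le> r / l"
    "f (R x ((1 / l) *\<^sub>R \<xi>)) \<le> f x + F / 4"
proof -
  interpret T: tangent_model M x R f l \<rho> b by (rule model)
  let ?s = "(1 / l) *\<^sub>R \<xi>"
  show n: "tnorm M x ?s \<le> r / l"
    using divide_right_mono[of "tnorm M x \<xi>" r l] \<xi> l_pos by (simp add: tball_def T.tnorm_eq)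
  then have "tnorm M x ?s \<le> m" using S_m S_nonneg by linarith
  then show b: "ereal (tnorm M x ?s) < b" using m_b by (meson ereal_less_eq(3) le_less_trans)
  have "f (R x ?s) \<le> f x + T.nrm (rgrad M f x) * T.nrm ?s + l / 2 * (T.nrm ?s)\<^sup>2"
    using T.perturbation_bound[of ?s] b by (simp add: T.tnorm_eq retr_0 pullback_grad_0)
  also have "\<dots> \<le> f x + \<epsilon> * (r / l) + l / 2 * (r / l)\<^sup>2"
    using low n l_pos eps unfolding T.tnorm_eq by (intro add_mono mult_mono power_mono) auto
  also have "l / 2 * (r / l)\<^sup>2 = r / 2 * (r / l)" using l_pos by (simp add: power2_eq_square)
  also have "r / 2 * (r / l) \<le> \<epsilon> * (r / l)"
  proof (intro mult_right_mono)
    have "1 \<le> chi ^ 3" using chi_ge_116 by (intro one_le_power) auto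
    then show "r / 2 \<le> \<epsilon>" using eps chi_pos by (simp add: field_simps)
    show "0 \<le> r / l" by (rule divide_nonneg_pos[OF less_imp_le[OF r_pos] l_pos])
  qed
  also have "f x + \<epsilon> * (r / l) + \<epsilon> * (r / l) = f x + 2 * (\<epsilon> * (r / l))" by simp
  also have "\<epsilon> * (r / l) \<le> \<epsilon> * (e / p / (400 * chi ^ 3))" using r_over_l eps by (intro mult_left_mono) auto
  also have "\<epsilon> * (e / p / (400 * chi ^ 3)) = F / 8"
  proof -
    define E where "E = e"
    have E: "\<epsilon> = E * E" using eps by (simp add: E_def)
    show ?thesis unfolding round_decrease_eq unfolding E_def[symmetric] unfolding E by (simp add: power3_eq_cube)
  qed
  finally show "f (R x ?s) \<le> f x + F / 4" by simp
qed

lemma perturbed_round: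
  assumes low: "tnorm M x (rgrad M f x) \<le> \<epsilon>" and \<xi>: "\<xi> \<in> tball M x r 0"
  shows "f (tangent_space_steps M R f x ((1 / l) *\<^sub>R \<xi>) (1 / l) b N) \<le> f x + F / 4"
    and "(x, \<xi>) \<notin> bad \<Longrightarrow> f (tangent_space_steps M R f x ((1 / l) *\<^sub>R \<xi>) (1 / l) b N) \<le> f x - F"
proof -
  interpret T: tangent_model M x R f l \<rho> b by (rule model)
  let ?s = "(1 / l) *\<^sub>R \<xi>" and ?z = "tangent_iterate M R f x (1 / l) b ((1 / l) *\<^sub>R \<xi>) N"
  note ps = perturbed_start[OF low \<xi>]
  have sb: "ereal (T.nrm ?s) < b" using ps(1) unfolding T.tnorm_eq .
  show "f (tangent_space_steps M R f x ?s (1 / l) b N) \<le> f x + F / 4"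
    using T.tangent_iterate_bounds[OF sb, of N] ps(3) by (simp add: tangent_space_steps_def)
  assume nb: "(x, \<xi>) \<notin> bad"
  \<comment> \<open>The localization radius for a drop of 5/4 F is e / (p chi) over sqrt 20, below
    \<open>S\<close>, where the divisor is 4.\<close>
  have rad: "sqrt (2 / l * (real N * (5 / 4 * F))) \<le> S"
  proof (rule real_le_lsqrt)
    have "2 / l * (real N * (5 / 4 * F)) = (e / (p * chi))\<^sup>2 / 20"
      unfolding N round_length_eq round_decrease_eq using l_pos p_pos e_pos chi_pos
      by (simp add: divide_simps power2_eq_square power3_eq_cube)
    also have "\<dots> \<le> (e / (p * chi))\<^sup>2 / 16" by (intro divide_left_mono) auto
    also have "\<dots> = S\<^sup>2" by (simp add: S_def power2_eq_square)
    finally show "2 / l * (real N * (5 / 4 * F)) \<le> S\<^sup>2" .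
  qed (rule S_nonneg)
  have sS: "ereal (T.nrm ?s + sqrt (2 / l * (real N * (5 / 4 * F)))) < b"
  proof -
    have "T.nrm ?s + sqrt (2 / l * (real N * (5 / 4 * F))) \<le> m"
      using ps(2) rad S_m unfolding T.tnorm_eq by linarith
    then show ?thesis using m_b by (meson ereal_less_eq(3) le_less_trans)
  qed
  have "5 / 4 * F < T.fh ?s - T.fh ?z"
  proof (rule ccontr)
    assume "\<not> 5 / 4 * F < T.fh ?s - T.fh ?z"
    then have "T.nrm ((T.gd ^^ j) ?s - ?s) \<le> S" if "j \<le> N" for j
      using T.no_decrease_imp_localized[OF sb sS _ that] rad by (meson not_less order_trans)
    then show False using nb by (simp add: localized_set_def T.tnorm_eq)
  qed
  then show "f (tangent_space_steps M R f x ?s (1 / l) b N) \<le> f x - F"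
    using ps(3) by (simp add: tangent_space_steps_def)
qed

end

section \<open>Trajectories and probabilities\<close>

text \<open>A single outcome. All counting is deterministic; chance enters only through the draws
  that lie in \<open>bad\<close>.\<close>

locale prgd_trajectory = prgd_setting M f R l \<rho> \<epsilon> \<delta> chi x0 fstar \<beta> b N
  for M :: "('m::{t2_space, second_countable_topology}, 'e::euclidean_space) manifold" and f R
    and l \<rho> \<epsilon> \<delta> chi :: real and x0 fstar \<beta> b N +
  fixes X :: "nat \<Rightarrow> 'm" and t :: "nat \<Rightarrow> nat" and \<xi> :: "nat \<Rightarrow> 'e" and T :: real
  assumes T: "T = horizon l \<rho> \<epsilon> chi (f x0 - fstar)"
    and path: "prgd_path M R f x0 (1 / l) r N \<epsilon> T b X t \<xi>"
begin

abbreviation "\<Delta> \<equiv> f x0 - fstar"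
abbreviation "V \<equiv> low_gradient_visits M f \<epsilon> T X t"

lemma N_pos: "N \<ge> 1"
proof -
  have "0 < real N" unfolding N round_length_eq using l_pos chi_pos p_pos e_pos by simp
  then show ?thesis by simp
qed

lemma T_ge: "8 / 3 * real N \<le> T" "8 * (\<Delta> * real N / F) \<le> T" "8 * (\<Delta> * l / \<epsilon>\<^sup>2) \<le> T"
  unfolding T horizon_def N[symmetric] by auto

lemma T_pos: "0 < T" "1 \<le> T"
  using T_ge(1) N_pos by linarith+

lemma path_0: "X 0 = x0" "t 0 = 0"
  using path by (auto simp: prgd_path_def)

lemma
  assumes "real (t k) \<le> T" "\<epsilon> < tnorm M (X k) (rgrad M f (X k))"
  shows high_X: "X (Suc k) = tangent_space_steps M R f (X k) 0 (1 / l) b 1"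
    and high_t: "t (Suc k) = t k + 1"
  using path assms unfolding prgd_path_def by auto

lemma
  assumes "k \<in> V"
  shows low_\<xi>: "\<xi> k \<in> tball M (X k) r 0"
    and low_X: "X (Suc k) = tangent_space_steps M R f (X k) ((1 / l) *\<^sub>R \<xi> k) (1 / l) b N"
    and low_t: "t (Suc k) = t k + N"
  using path assms unfolding prgd_path_def low_gradient_visits_def by (auto simp: not_less)

lemma stopped: "T < real (t k) \<Longrightarrow> t (Suc k) = t k"
  using path unfolding prgd_path_def by (auto simp: not_less not_le)

lemma t_step: "real (t k) \<le> T \<Longrightarrow> t k + 1 \<le> t (Suc k) \<and> t (Suc k) \<le> t k + N"
  using high_t[of k] low_t[of k] N_pos by (cases "k \<in> V") (auto simp: low_gradient_visits_def)

lemma t_mono: "i \<le> j \<Longrightarrow> t i \<le> t j"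
proof -
  have "t n \<le> t (Suc n)" for n
    using t_step[of n] stopped[of n] by (cases "real (t n) \<le> T") auto
  then show "i \<le> j \<Longrightarrow> t i \<le> t j" by (rule lift_Suc_mono_le)
qed

lemma index_le: "real (t k) \<le> T \<Longrightarrow> k \<le> t k"
proof (induction k)
  case (Suc k)
  have "real (t k) \<le> T" using t_mono[of k "Suc k"] Suc.prems by linarith
  then show ?case using Suc.IH t_step[of k] by linarith
qed simp

text \<open>The number of executions of the loop body.\<close>

definition K :: nat where "K = (LEAST k. T < real (t k))"

lemma stop_exists: "\<exists>k. T < real (t k)"
proof (rule ccontr)
  assume "\<not> ?thesis"
  then have all: "real (t k) \<le> T" for k by (simp add: not_less)
  have "real (nat \<lceil>T\<rceil> + 1) \<le> T" using index_le[OF all, of "nat \<lceil>T\<rceil> + 1"] all[of "nat \<lceil>T\<rceil> + 1"] by linarith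
  then show False by linarith
qed

lemma K: "T < real (t K)"
  unfolding K_def by (rule LeastI_ex[OF stop_exists])

lemma before_K: "k < K \<Longrightarrow> real (t k) \<le> T"
  unfolding K_def using not_less_Least by (metis not_less)

lemma after_K: "K \<le> k \<Longrightarrow> T < real (t k)"
  using K t_mono[of K k] by linarith

lemma V_K: "V = {k. k < K \<and> tnorm M (X k) (rgrad M f (X k)) \<le> \<epsilon>}"
proof -
  have "real (t k) \<le> T \<longleftrightarrow> k < K" for k
    using before_K[of k] after_K[of k] by linarith
  then show ?thesis by (simp add: low_gradient_visits_def)
qed

lemma finite_V: "finite V"
  unfolding V_K by simp

lemma t_after: "K \<le> k \<Longrightarrow> t k = t K"
  by (induction rule: dec_induct) (auto simp: stopped after_K)

text \<open>The last execution starts with a counter of at most \<open>T\<close> and adds at most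
  \<open>N\<close>.\<close>

lemma t_bound: "real (t k) \<le> T + real N"
proof -
  have "K \<noteq> 0" using K path_0 T_pos by (cases K) auto
  then obtain j where j: "K = Suc j" by (cases K) auto
  have "real (t j) \<le> T" using before_K[of j] j by simp
  moreover from this have "t K \<le> t j + N" using t_step[of j] j by simp
  ultimately have KN: "real (t K) \<le> T + real N" by linarith
  show ?thesis
  proof (cases "k < K")
    case True
    then show ?thesis using before_K[of k] by simp
  next
    case False
    then show ?thesis using t_after[of k] KN by simp
  qed
qed

text \<open>\<open>H\<close> collects the high-gradient steps, \<open>D\<close> the perturbed rounds
  that are guaranteed to decrease f by F.\<close>

definition "H = {k. k < K \<and> k \<notin> V}"
definition "D = {k \<in> V. (X k, \<xi> k) \<notin> bad}"

text \<open>Every perturbed round is debited the cost F/4 of its draw; those in \<open>D\<close> are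
  credited 5/4 F, so their net gain is F.\<close>

lemma progress:
  assumes "n \<le> K"
  shows "t n = card {k \<in> H. k < n} + N * card {k \<in> V. k < n} \<and>
    f (X n) \<le> f x0 - real (card {k \<in> H. k < n}) * (\<epsilon>\<^sup>2 / (2 * l)) + real (card {k \<in> V. k < n}) * (F / 4)
      - real (card {k \<in> D. k < n}) * (5 / 4 * F)"
  using assms
proof (induction n)
  case 0
  then show ?case by (simp add: path_0)
next
  case (Suc n)
  have IH: "t n = card {k \<in> H. k < n} + N * card {k \<in> V. k < n}"
    "f (X n) \<le> f x0 - real (card {k \<in> H. k < n}) * (\<epsilon>\<^sup>2 / (2 * l)) + real (card {k \<in> V. k < n}) * (F / 4)
      - real (card {k \<in> D. k < n}) * (5 / 4 * F)" using Suc by auto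
  have act: "real (t n) \<le> T" using Suc.prems by (intro before_K) simp
  have cs: "card {k \<in> A. k < Suc n} = card {k \<in> A. k < n} + (if n \<in> A then 1 else 0)" for A
  proof -
    have "{k \<in> A. k < Suc n} = (if n \<in> A then insert n {k \<in> A. k < n} else {k \<in> A. k < n})"
      by (auto simp: less_Suc_eq)
    moreover have "finite {k \<in> A. k < n}" by simp
    ultimately show ?thesis by simp
  qed
  show ?case
  proof (cases "n \<in> V")
    case True
    then have nH: "n \<notin> H" by (simp add: H_def)
    have low: "tnorm M (X n) (rgrad M f (X n)) \<le> \<epsilon>" using True by (simp add: low_gradient_visits_def)
    note pr = perturbed_round[OF low low_\<xi>[OF True], folded low_X[OF True]]
    show ?thesis
    proof (cases "n \<in> D")
      case True
      then have "f (X (Suc n)) \<le> f (X n) - F" using pr(2) by (simp add: D_def)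
      then show ?thesis unfolding cs using IH low_t[OF \<open>n \<in> V\<close>] \<open>n \<in> V\<close> nH True by (simp add: algebra_simps)
    next
      case False
      then show ?thesis unfolding cs using pr(1) IH low_t[OF \<open>n \<in> V\<close>] \<open>n \<in> V\<close> nH by (simp add: algebra_simps)
    qed
  next
    case False
    then have nH: "n \<in> H" "n \<notin> D" using Suc.prems by (auto simp: H_def D_def)
    have hi: "\<epsilon> < tnorm M (X n) (rgrad M f (X n))" using False act by (simp add: low_gradient_visits_def)
    show ?thesis unfolding cs
      using IH high_t[OF act hi] high_gradient_step[OF hi, folded high_X[OF act hi]] False nH
      by (simp add: algebra_simps)
  qed
qed

lemma budget:
  "T < real (card H) + real N * real (card V)"
  "real (card H) * (\<epsilon>\<^sup>2 / (2 * l)) + real (card D) * (5 / 4 * F) \<le> \<Delta> + real (card V) * (F / 4)"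
proof -
  have s: "{k \<in> H. k < K} = H" "{k \<in> V. k < K} = V" "{k \<in> D. k < K} = D"
    unfolding D_def V_K by (auto simp: H_def)
  note pr = progress[OF order_refl, unfolded s]
  have "real (t K) = real (card H) + real N * real (card V)" using pr by simp
  then show "T < real (card H) + real N * real (card V)" using K by linarith
  show "real (card H) * (\<epsilon>\<^sup>2 / (2 * l)) + real (card D) * (5 / 4 * F) \<le> \<Delta> + real (card V) * (F / 4)"
    using pr f_ge[of "X K"] by linarith
qed

lemma card_H_le:
  assumes "real (card H) * (\<epsilon>\<^sup>2 / (2 * l)) \<le> a * \<Delta>" "0 \<le> a"
  shows "real (card H) \<le> a / 4 * T"
proof -
  have pos: "0 < \<epsilon>\<^sup>2 / (2 * l)" using eps l_pos by simp
  have "real (card H) \<le> a * \<Delta> / (\<epsilon>\<^sup>2 / (2 * l))" using assms(1) by (simp only: pos_le_divide_eq[OF pos])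
  also have "\<dots> = a / 4 * (8 * (\<Delta> * l / \<epsilon>\<^sup>2))" by simp
  also have "\<dots> \<le> a / 4 * T" using T_ge(3) assms(2) by (intro mult_left_mono) auto
  finally show ?thesis .
qed

text \<open>With at most one visit the high-gradient steps account for at most 5/16 of
  \<open>T\<close> and the visit for at most 3/8, the latter by the first term of the horizon; the
  counter could not pass \<open>T\<close>.\<close>

lemma card_V_ge: "2 \<le> card V"
proof (rule ccontr)
  assume "\<not> 2 \<le> card V"
  then have v: "real (card V) \<le> 1" by simp
  have "real (card V) * (F / 4) \<le> 1 * (F / 4)" using v round_decrease_pos by (intro mult_right_mono) auto
  moreover have "0 \<le> real (card D) * (5 / 4 * F)" using round_decrease_pos by simp
  ultimately have "real (card H) * (\<epsilon>\<^sup>2 / (2 * l)) \<le> 5 / 4 * \<Delta>"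
    using budget(2) round_decrease_le by argo
  then have "real (card H) \<le> 5 / 4 / 4 * T" by (rule card_H_le) simp
  moreover have "real N * real (card V) \<le> real N * 1" using v by (intro mult_left_mono) auto
  ultimately show False using budget(1) T_ge(1) T_pos(1) by argo
qed

text \<open>Otherwise at least a third of the visits lie in \<open>D\<close> and the average gain
  per visit is 5/12 F - F/4 = F/6. The budget then limits the visits to 3/4 and the high-gradient
  steps to 1/4 of \<open>T\<close>.\<close>

lemma two_thirds_critical:
  assumes good: "\<And>k. k \<in> V \<Longrightarrow> \<not> P (X k) \<Longrightarrow> (X k, \<xi> k) \<notin> bad"
  shows "2 / 3 * real (card V) \<le> real (card {k \<in> V. P (X k)})"
proof (rule ccontr)
  assume n: "\<not> ?thesis"
  have "V = {k \<in> V. P (X k)} \<union> {k \<in> V. \<not> P (X k)}" by auto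
  then have "card V = card {k \<in> V. P (X k)} + card {k \<in> V. \<not> P (X k)}"
    using finite_V by (subst card_Un_disjoint[symmetric]) auto
  moreover have "card {k \<in> V. \<not> P (X k)} \<le> card D"
    unfolding D_def using finite_V good by (intro card_mono) auto
  ultimately have D: "real (card V) / 3 \<le> real (card D)" using n by linarith
  have "real (card V) / 3 * (5 / 4 * F) \<le> real (card D) * (5 / 4 * F)"
    using D round_decrease_pos by (intro mult_right_mono) auto
  then have le: "real (card H) * (\<epsilon>\<^sup>2 / (2 * l)) + real (card V) * F / 6 \<le> \<Delta>"
    using budget(2) by argo
  have "0 \<le> real (card V) * F / 6" "0 \<le> real (card H) * (\<epsilon>\<^sup>2 / (2 * l))"
    using round_decrease_pos l_pos by (auto intro!: mult_nonneg_nonneg divide_nonneg_pos)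
  with le have 1: "real (card H) * (\<epsilon>\<^sup>2 / (2 * l)) \<le> 1 * \<Delta>" and 2: "real (card V) * F \<le> 6 * \<Delta>" by argo+
  have "real (card V) \<le> 6 * \<Delta> / F" using 2 by (simp only: pos_le_divide_eq[OF round_decrease_pos])
  then have "real N * real (card V) \<le> real N * (6 * \<Delta> / F)" by (intro mult_left_mono) auto
  also have "\<dots> = 6 / 8 * (8 * (\<Delta> * real N / F))" by simp
  also have "\<dots> \<le> 6 / 8 * T" using T_ge(2) by (intro mult_left_mono) auto
  finally show False using card_H_le[OF 1] budget(1) by simp
qed

end

section \<open>The randomized run: measurability and conditional probabilities\<close>

locale prgd_randomized = prgd_setting M f R l \<rho> \<epsilon> \<delta> chi x0 fstar \<beta> b N
  for M :: "('m::{t2_space, second_countable_topology}, 'e::euclidean_space) manifold" and f R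
    and l \<rho> \<epsilon> \<delta> chi :: real and x0 fstar \<beta> b N +
  fixes P :: "'w measure" and \<F> :: "nat \<Rightarrow> 'w measure"
    and X :: "nat \<Rightarrow> 'w \<Rightarrow> 'm" and t :: "nat \<Rightarrow> 'w \<Rightarrow> nat" and \<xi> :: "nat \<Rightarrow> 'w \<Rightarrow> 'e" and T :: real
  assumes T: "T = horizon l \<rho> \<epsilon> chi (f x0 - fstar)"
    and run: "prgd_run M R f x0 (1 / l) r N \<epsilon> T b P \<F> X t \<xi>"
begin

abbreviation "V \<omega> \<equiv> low_gradient_visits M f \<epsilon> T (\<lambda>k. X k \<omega>) (\<lambda>k. t k \<omega>)"

lemma trajectory:
  "\<omega> \<in> space P \<Longrightarrow> prgd_trajectory M f R l \<rho> \<epsilon> \<delta> chi x0 fstar \<beta> b N (\<lambda>k. X k \<omega>) (\<lambda>k. t k \<omega>) (\<lambda>k. \<xi> k \<omega>) T"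
  using run T by unfold_locales (auto simp: prgd_run_def)

sublocale prob_space P
  using run by (simp add: prgd_run_def)

lemma subalg: "subalgebra P (\<F> k)" and subalg_Suc: "subalgebra (\<F> (Suc k)) (\<F> k)"
  and X_meas: "X k \<in> \<F> k \<rightarrow>\<^sub>M borel"
  and pair_meas: "(\<lambda>\<omega>. (X k \<omega>, \<xi> k \<omega>)) \<in> \<F> (Suc k) \<rightarrow>\<^sub>M tangent_borel M"
  using run by (auto simp: prgd_run_def)

lemma cond_exp:
  assumes "C \<in> sets (tangent_borel M)"
  shows "AE \<omega> in P. k \<in> V \<omega> \<longrightarrow> real_cond_exp P (\<F> k) (\<lambda>\<omega>'. indicator C (X k \<omega>', \<xi> k \<omega>')) \<omega> =
    measure (uniform_tball M (X k \<omega>) r 0) {v. (X k \<omega>, v) \<in> C}"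
  using run assms unfolding prgd_run_def low_gradient_visits_def by simp

lemma space_F: "space (\<F> k) = space P"
  using subalg by (simp add: subalgebra_def)

lemma F_sets: "A \<in> sets (\<F> k) \<Longrightarrow> A \<in> sets P"
  using subalg by (auto simp: subalgebra_def)

lemma closed_event:
  assumes "closed C"
  shows "{\<omega> \<in> space P. X k \<omega> \<in> C} \<in> sets (\<F> k)"
  using measurable_sets[OF X_meas borel_closed[OF assms], of k]
  by (simp add: space_F vimage_def Int_def conj_commute)

lemma low_event: "{\<omega> \<in> space P. tnorm M (X k \<omega>) (rgrad M f (X k \<omega>)) \<le> \<epsilon>} \<in> sets (\<F> k)"
  using closed_event[OF closed_low_gradient[of \<epsilon>], of k] eps by simp

text \<open>\<open>prgd_run\<close> postulates measurability of the iterates and draws only; that of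
  the counter follows recursively, since the branch taken depends on the closed low-gradient
  set.\<close>

lemma t_meas: "t k \<in> \<F> k \<rightarrow>\<^sub>M count_space UNIV"
proof (induction k)
  case 0
  have "t 0 \<omega> = 0" if "\<omega> \<in> space (\<F> 0)" for \<omega>
    using prgd_trajectory.path_0(2)[OF trajectory] that by (simp add: space_F)
  then show ?case by (subst measurable_cong[where g = "\<lambda>_. 0"]) auto
next
  case (Suc k)
  have tk: "t k \<in> \<F> (Suc k) \<rightarrow>\<^sub>M count_space UNIV"
    using measurable_from_subalg[OF subalg_Suc Suc] .
  have lk: "{\<omega> \<in> space (\<F> (Suc k)). tnorm M (X k \<omega>) (rgrad M f (X k \<omega>)) \<le> \<epsilon>} \<in> sets (\<F> (Suc k))"
    using low_event[of k] subalg_Suc[of k] by (auto simp: subalgebra_def space_F)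
  have eq: "t (Suc k) \<omega> = (if real (t k \<omega>) \<le> T then if tnorm M (X k \<omega>) (rgrad M f (X k \<omega>)) \<le> \<epsilon>
      then t k \<omega> + N else t k \<omega> + 1 else t k \<omega>)" if "\<omega> \<in> space (\<F> (Suc k))" for \<omega>
    using run that unfolding prgd_run_def prgd_path_def by (auto simp: space_F not_le not_less)
  have tT: "{\<omega> \<in> space (\<F> (Suc k)). real (t k \<omega>) \<le> T} \<in> sets (\<F> (Suc k))"
    using measurable_sets[OF tk, of "{n. real n \<le> T}"] by (simp add: vimage_def Int_def conj_commute)
  show ?case
  proof (rule measurable_cong[OF eq, THEN iffD2], assumption, intro measurable_If tk)
    show "(\<lambda>x. t k x + N) \<in> \<F> (Suc k) \<rightarrow>\<^sub>M count_space UNIV" "(\<lambda>x. t k x + 1) \<in> \<F> (Suc k) \<rightarrow>\<^sub>M count_space UNIV"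
      using measurable_compose[OF tk, of "\<lambda>n. n + N" "count_space UNIV"]
        measurable_compose[OF tk, of "\<lambda>n. n + 1" "count_space UNIV"] by simp_all
  qed (use lk tT in simp_all)
qed

lemma visit_event: "{\<omega> \<in> space P. k \<in> V \<omega>} \<in> sets (\<F> k)"
proof -
  have "{\<omega> \<in> space P. real (t k \<omega>) \<le> T} \<in> sets (\<F> k)"
    using measurable_sets[OF t_meas, of "{n. real n \<le> T}" k] by (simp add: space_F vimage_def Int_def conj_commute)
  then have "{\<omega> \<in> space P. real (t k \<omega>) \<le> T} \<inter> {\<omega> \<in> space P. tnorm M (X k \<omega>) (rgrad M f (X k \<omega>)) \<le> \<epsilon>} \<in> sets (\<F> k)"
    using low_event by (rule sets.Int)
  moreover have "{\<omega> \<in> space P. real (t k \<omega>) \<le> T} \<inter> {\<omega> \<in> space P. tnorm M (X k \<omega>) (rgrad M f (X k \<omega>)) \<le> \<epsilon>} =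
      {\<omega> \<in> space P. k \<in> V \<omega>}" by (auto simp: low_gradient_visits_def)
  ultimately show ?thesis by simp
qed

lemma visit_index_le:
  assumes "\<omega> \<in> space P" "k \<in> V \<omega>"
  shows "k < Suc (nat \<lfloor>T\<rfloor>)"
proof -
  have "real (t k \<omega>) \<le> T" using assms(2) by (simp add: low_gradient_visits_def)
  then have "real k \<le> T" using prgd_trajectory.index_le[OF trajectory[OF assms(1)]] by fastforce
  then show ?thesis by linarith
qed

section \<open>Failure probability, for both tolerances at once\<close>

context
  fixes \<sigma> :: real
  assumes sigma: "\<sigma> = 4 \<or> \<sigma> = 1 \<and> \<beta> = 0"
begin

abbreviation "critical x \<equiv> second_order_critical M f \<rho> (\<sigma> * \<epsilon>) x"

text \<open>Determined by the history before the draw, so it may be integrated against the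
  conditional expectation; \<open>stuck_event\<close> also involves the draw.\<close>

definition saddle_event :: "nat \<Rightarrow> 'w set" where
  "saddle_event k = {\<omega> \<in> space P. k \<in> V \<omega> \<and> \<not> critical (X k \<omega>)}"

definition stuck_event :: "nat \<Rightarrow> 'w set" where
  "stuck_event k = {\<omega> \<in> saddle_event k. (X k \<omega>, \<xi> k \<omega>) \<in> bad}"

lemma critical_event: "{\<omega> \<in> space P. critical (X k \<omega>)} \<in> sets (\<F> k)"
proof -
  have "0 \<le> \<sigma> * \<epsilon>" using sigma eps by auto
  from closed_event[OF closed_second_order_critical[OF this], of k] show ?thesis by simp
qed

lemma saddle_event_sets: "saddle_event k \<in> sets (\<F> k)"
proof -
  have "saddle_event k = {\<omega> \<in> space P. k \<in> V \<omega>} - {\<omega> \<in> space P. critical (X k \<omega>)}"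
    by (auto simp: saddle_event_def)
  then show ?thesis using visit_event critical_event by simp
qed

lemma stuck_event_sets: "stuck_event k \<in> sets P"
proof -
  have "(\<lambda>\<omega>. (X k \<omega>, \<xi> k \<omega>)) -` bad \<inter> space P \<in> sets P"
    using F_sets[OF measurable_sets[OF pair_meas localized_set_measurable[OF S_nonneg]]] by (simp add: space_F)
  moreover have "stuck_event k = saddle_event k \<inter> ((\<lambda>\<omega>. (X k \<omega>, \<xi> k \<omega>)) -` bad \<inter> space P)"
    by (auto simp: stuck_event_def saddle_event_def)
  ultimately show ?thesis using F_sets[OF saddle_event_sets] by simp
qed

text \<open>The conditional probability of \<open>bad\<close> given the history is at most
  \<open>pfail\<close> wherever a saddle is visited; integrate it over the saddle event.\<close>

lemma stuck_event_prob: "prob (stuck_event k) \<le> pfail"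
proof -
  interpret FM: finite_measure_subalgebra P "\<F> k" using subalg by unfold_locales
  define h :: "'w \<Rightarrow> real" where "h \<omega> = indicator bad (X k \<omega>, \<xi> k \<omega>)" for \<omega>
  have h: "h \<in> borel_measurable P"
    unfolding h_def
    by (rule measurable_compose[OF measurable_from_subalg[OF subalg pair_meas]
          borel_measurable_indicator[OF localized_set_measurable[OF S_nonneg]]])
  have hi: "integrable P h"
    by (rule integrable_const_bound[of _ 1]) (use h in \<open>auto simp: h_def indicator_def\<close>)
  note ce = FM.real_cond_exp_int[OF hi]
  have G: "saddle_event k \<in> sets P" by (rule F_sets[OF saddle_event_sets])
  have bad_sets: "bad \<in> sets (tangent_borel M)" by (rule localized_set_measurable[OF S_nonneg])
  have "prob (stuck_event k) = (\<integral>\<omega>. indicator (stuck_event k) \<omega> \<partial>P)"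
    using stuck_event_sets by simp
  also have "\<dots> = (\<integral>\<omega>\<in>saddle_event k. h \<omega> \<partial>P)"
    unfolding set_lebesgue_integral_def by (intro Bochner_Integration.integral_cong) (auto simp: stuck_event_def h_def indicator_def)
  also have "\<dots> = (\<integral>\<omega>\<in>saddle_event k. real_cond_exp P (\<F> k) h \<omega> \<partial>P)"
    by (rule FM.real_cond_exp_intA[OF hi saddle_event_sets])
  also have "\<dots> \<le> (\<integral>\<omega>. pfail \<partial>P)"
    unfolding set_lebesgue_integral_def
  proof (rule integral_mono_AE)
    show "integrable P (\<lambda>\<omega>. indicator (saddle_event k) \<omega> *\<^sub>R real_cond_exp P (\<F> k) h \<omega>)"
      by (rule integrable_mult_indicator[OF G ce(1)])
    show "AE \<omega> in P. indicator (saddle_event k) \<omega> *\<^sub>R real_cond_exp P (\<F> k) h \<omega> \<le> pfail"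
      using cond_exp[OF bad_sets, of k]
    proof eventually_elim
      case (elim \<omega>)
      show ?case
      proof (cases "\<omega> \<in> saddle_event k")
        case True
        then have "k \<in> V \<omega>" "\<not> critical (X k \<omega>)" by (auto simp: saddle_event_def)
        then show ?thesis
          using elim bad_probability[OF _ _ sigma, of "X k \<omega>"] True
          by (simp add: h_def[abs_def] low_gradient_visits_def)
      qed (simp add: pfail_nonneg)
    qed
  qed simp
  also have "\<dots> = pfail" by (simp add: prob_space)
  finally show ?thesis .
qed

abbreviation "good_event \<equiv> {\<omega> \<in> space P. 2 / 3 * real (card (V \<omega>)) \<le> real (card {k \<in> V \<omega>. critical (X k \<omega>)})}"

text \<open>Visits have indices at most \<open>T\<close>, so both cardinalities are finite sums of
  indicators of measurable events.\<close>

lemma good_event_sets: "good_event \<in> sets P"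
proof -
  let ?K = "{..nat \<lfloor>T\<rfloor>}"
  define A where "A k = {\<omega> \<in> space P. k \<in> V \<omega>}" for k
  define C where "C k = {\<omega> \<in> space P. k \<in> V \<omega> \<and> critical (X k \<omega>)}" for k
  have A: "A k \<in> sets P" for k unfolding A_def by (rule F_sets[OF visit_event])
  have "C k = A k \<inter> {\<omega> \<in> space P. critical (X k \<omega>)}" for k by (auto simp: A_def C_def)
  then have C: "C k \<in> sets P" for k using A F_sets[OF critical_event] by simp
  have count: "real (card {k \<in> V \<omega>. Z k}) = (\<Sum>k\<in>?K. if k \<in> V \<omega> \<and> Z k then 1 else 0)"
    if \<omega>: "\<omega> \<in> space P" for \<omega> Z
  proof -
    have "{k \<in> V \<omega>. Z k} = {k \<in> ?K. k \<in> V \<omega> \<and> Z k}" using visit_index_le[OF \<omega>] by (auto simp: less_Suc_eq_le)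
    moreover have "(\<Sum>k\<in>?K. if k \<in> V \<omega> \<and> Z k then 1 else 0) = real (card {k \<in> ?K. k \<in> V \<omega> \<and> Z k})"
      by (simp add: sum.If_cases Int_def)
    ultimately show ?thesis by simp
  qed
  have "good_event = {\<omega> \<in> space P. 2 / 3 * (\<Sum>k\<in>?K. indicator (A k) \<omega>) \<le> (\<Sum>k\<in>?K. indicator (C k) \<omega> :: real)}"
  proof (intro Collect_cong conj_cong refl)
    fix \<omega> assume \<omega>: "\<omega> \<in> space P"
    have "(\<Sum>k\<in>?K. indicator (A k) \<omega>) = (\<Sum>k\<in>?K. if k \<in> V \<omega> \<and> True then 1 else 0 :: real)"
      using \<omega> by (intro sum.cong refl) (simp add: A_def)
    then have "real (card (V \<omega>)) = (\<Sum>k\<in>?K. indicator (A k) \<omega>)"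
      using count[OF \<omega>, of "\<lambda>_. True"] by (simp only: simp_thms Collect_mem_eq)
    moreover have "(\<Sum>k\<in>?K. indicator (C k) \<omega>) =
        (\<Sum>k\<in>?K. if k \<in> V \<omega> \<and> critical (X k \<omega>) then 1 else 0 :: real)"
      using \<omega> by (intro sum.cong refl) (simp add: C_def)
    then have "real (card {k \<in> V \<omega>. critical (X k \<omega>)}) = (\<Sum>k\<in>?K. indicator (C k) \<omega>)"
      using count[OF \<omega>, of "\<lambda>k. critical (X k \<omega>)"] by (simp only:)
    ultimately show "2 / 3 * real (card (V \<omega>)) \<le> real (card {k \<in> V \<omega>. critical (X k \<omega>)}) \<longleftrightarrow>
        2 / 3 * (\<Sum>k\<in>?K. indicator (A k) \<omega>) \<le> (\<Sum>k\<in>?K. indicator (C k) \<omega> :: real)" by simp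
  qed
  also have "\<dots> \<in> sets P"
    using A C by measurable
  finally show ?thesis .
qed

lemma good_event_prob: "1 - \<delta> \<le> prob good_event"
proof -
  let ?n = "Suc (nat \<lfloor>T\<rfloor>)"
  obtain \<omega>0 where "\<omega>0 \<in> space P" using not_empty by blast
  then have T1: "1 \<le> T" using prgd_trajectory.T_pos(2)[OF trajectory] by blast
  have "space P - good_event \<subseteq> (\<Union>k\<in>{..<?n}. stuck_event k)"
  proof
    fix \<omega> assume \<omega>: "\<omega> \<in> space P - good_event"
    then have sp: "\<omega> \<in> space P" by simp
    have "\<not> (\<forall>k\<in>V \<omega>. \<not> critical (X k \<omega>) \<longrightarrow> (X k \<omega>, \<xi> k \<omega>) \<notin> bad)"
    proof
      assume "\<forall>k\<in>V \<omega>. \<not> critical (X k \<omega>) \<longrightarrow> (X k \<omega>, \<xi> k \<omega>) \<notin> bad"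
      then have "2 / 3 * real (card (V \<omega>)) \<le> real (card {k \<in> V \<omega>. critical (X k \<omega>)})"
        by (intro prgd_trajectory.two_thirds_critical[OF trajectory[OF sp]]) auto
      then show False using \<omega> by simp
    qed
    then obtain k where "k \<in> V \<omega>" "\<not> critical (X k \<omega>)" "(X k \<omega>, \<xi> k \<omega>) \<in> bad" by blast
    then show "\<omega> \<in> (\<Union>k\<in>{..<?n}. stuck_event k)"
      using sp visit_index_le[OF sp] by (auto simp: stuck_event_def saddle_event_def)
  qed
  then have "prob (space P - good_event) \<le> prob (\<Union>k\<in>{..<?n}. stuck_event k)"
    using stuck_event_sets by (intro finite_measure_mono) auto
  also have "\<dots> \<le> (\<Sum>k<?n. prob (stuck_event k))"
    using stuck_event_sets by (intro finite_measure_subadditive_finite) auto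
  also have "\<dots> \<le> (\<Sum>k<?n. pfail)" by (intro sum_mono stuck_event_prob)
  also have "\<dots> = real ?n * pfail" by simp
  also have "\<dots> \<le> 2 * T * pfail"
  proof (intro mult_right_mono pfail_nonneg)
    \<comment> \<open>The indices 0 to the floor of \<open>T\<close> are at most T + 1 in number,
      and \<open>T\<close> is at least 1.\<close>
    show "real ?n \<le> 2 * T" using T1 by linarith
  qed
  also have "\<dots> \<le> \<delta>" unfolding T by (rule union_bound)
  finally show ?thesis using prob_compl[OF good_event_sets] by simp
qed

end

end

theorem corollary3p5:
  fixes M :: "('m::{t2_space, second_countable_topology}, 'e::euclidean_space) manifold"
    and R :: "'m \<Rightarrow> 'e \<Rightarrow> 'm" and f :: "'m \<Rightarrow> real"
    and fstar L \<rho> \<beta> l \<epsilon> \<delta> chi \<eta> r T :: real and b1 b2 b :: ereal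
    and N :: nat and x0 :: 'm
    and P :: "'w measure" and F :: "nat \<Rightarrow> 'w measure"
    and X :: "nat \<Rightarrow> 'w \<Rightarrow> 'm" and t :: "nat \<Rightarrow> 'w \<Rightarrow> nat" and \<xi> :: "nat \<Rightarrow> 'w \<Rightarrow> 'e"
  assumes manifold: "riemannian_manifold M"
    and retr: "retraction_on_manifold M R"
    and C2: "C2_function M f"
    and A1: "\<And>x. f x \<ge> fstar"
    and A2: "b1 > 0" "L > 0"
      "\<And>x s. ereal (tnorm M x s) \<le> b1 \<Longrightarrow>
         tnorm M x (pullback_grad M R f x s - pullback_grad M R f x 0) \<le> L * tnorm M x s"
    and A3: "b2 > 0" "\<rho> > 0"
      "\<And>x s. ereal (tnorm M x s) \<le> b2 \<Longrightarrow>
         tonorm M x (\<lambda>v. pullback_Hess M R f x s v - pullback_Hess M R f x 0 v)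
           \<le> \<rho> * tnorm M x s"
    and A4: "\<beta> \<ge> 0"
      "\<And>x s. tnorm M x s = 1 \<Longrightarrow>
         tnorm M x (intrinsic_acceleration M (\<lambda>\<tau>. R x (\<tau> *\<^sub>R s)) 0) \<le> \<beta>"
    and b: "b = min b1 b2"
    and l_range: "L \<le> l" "ereal l \<le> ereal L + ereal \<rho> * b"
    and l_lipschitz: "\<And>x s s'. ereal (tnorm M x s) \<le> b \<Longrightarrow> ereal (tnorm M x s') \<le> b \<Longrightarrow>
         tnorm M x (pullback_grad M R f x s - pullback_grad M R f x s') \<le> l * tnorm M x (s - s')"
    and eps: "0 < \<epsilon>" "\<beta> \<noteq> 0 \<Longrightarrow> \<epsilon> \<le> \<rho> / \<beta>\<^sup>2" "ereal \<epsilon> \<le> b\<^sup>2 * ereal \<rho>"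
    and L_large: "L \<ge> sqrt (\<rho> * \<epsilon>)"
    and eps_gap: "\<epsilon> powr (3 / 2) \<le> 3 * sqrt \<rho> * (f x0 - fstar)"
    and delta: "0 < \<delta>" "\<delta> < 1"
    and chi_large: "chi > 1 / 4" "chi \<ge> chi_bound DIM('e) l \<rho> \<epsilon> \<delta> (f x0 - fstar)"
    and N: "real N = round_length l \<rho> \<epsilon> chi"
    and eta: "\<eta> = 1 / l"
    and r: "r = \<epsilon> / (400 * chi ^ 3)"
    and T: "T = horizon l \<rho> \<epsilon> chi (f x0 - fstar)"
    and run: "prgd_run M R f x0 \<eta> r N \<epsilon> T b P F X t \<xi>"
  shows
    \<comment> \<open>conjuncts 4 and 5: the loop terminates, the final counter is at most \<open>T + N\<close>, and that is
       at most \<open>2 T\<close>.  Conjunct 6: the order of \<open>T\<close> when \<open>chi\<close> is of the order of its lower bound,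
       up to powers of logarithms of the parameters other than the dimension; \<open>C\<close> and \<open>p\<close> do not
       depend on the problem, and \<open>1 + ln d\<close> differs essentially from \<open>ln d\<close> only for \<open>d = 1\<close>.\<close>
    "(\<forall>\<omega>\<in>space P. card (low_gradient_visits M f \<epsilon> T (\<lambda>k. X k \<omega>) (\<lambda>k. t k \<omega>)) \<ge> 2) \<and>
     measure P {\<omega> \<in> space P.
       let V = low_gradient_visits M f \<epsilon> T (\<lambda>k. X k \<omega>) (\<lambda>k. t k \<omega>) in
       real (card {k \<in> V. second_order_critical M f \<rho> (4 * \<epsilon>) (X k \<omega>)}) \<ge> 2 / 3 * real (card V)}
     \<ge> 1 - \<delta> \<and>
     (\<beta> = 0 \<longrightarrow> measure P {\<omega> \<in> space P.
       let V = low_gradient_visits M f \<epsilon> T (\<lambda>k. X k \<omega>) (\<lambda>k. t k \<omega>) in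
       real (card {k \<in> V. second_order_critical M f \<rho> \<epsilon> (X k \<omega>)}) \<ge> 2 / 3 * real (card V)}
     \<ge> 1 - \<delta>) \<and>
     (\<forall>\<omega>\<in>space P. \<exists>K. real (t K \<omega>) > T \<and> (\<forall>k. real (t k \<omega>) \<le> T + real N)) \<and>
     T + real N \<le> 2 * T \<and>
     (\<forall>\<kappa>>0. \<exists>C>0. \<exists>p::nat. \<forall>d::nat. \<forall>l' \<rho>' \<epsilon>' \<delta>' \<Delta> chi' :: real.
       d \<ge> 1 \<longrightarrow> \<rho>' > 0 \<longrightarrow> \<epsilon>' > 0 \<longrightarrow> l' \<ge> sqrt (\<rho>' * \<epsilon>') \<longrightarrow> 0 < \<delta>' \<longrightarrow> \<delta>' < 1 \<longrightarrow>
       \<epsilon>' powr (3 / 2) \<le> 3 * sqrt \<rho>' * \<Delta> \<longrightarrow> chi' > 1 / 4 \<longrightarrow>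
       chi_bound d l' \<rho>' \<epsilon>' \<delta>' \<Delta> \<le> chi' \<longrightarrow> chi' \<le> \<kappa> * chi_bound d l' \<rho>' \<epsilon>' \<delta>' \<Delta> \<longrightarrow>
       horizon l' \<rho>' \<epsilon>' chi' \<Delta> \<le> C * (l' * \<Delta> / \<epsilon>'\<^sup>2) * (1 + ln (real d)) ^ 4 *
         (1 + \<bar>ln l'\<bar> + \<bar>ln \<Delta>\<bar> + \<bar>ln (1 / \<delta>')\<bar> + \<bar>ln (1 / \<rho>')\<bar> + \<bar>ln (1 / \<epsilon>')\<bar>) ^ p)"
proof -
  have b_pos: "0 < b" using A2(1) A3(1) by (simp add: b)
  \<comment> \<open>All radii used later lie within sqrt (\<epsilon> / \<rho>). The assumption on
    \<epsilon> supplies this for finite b; it is immediate for b infinite.\<close>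
  have b_ge: "ereal (sqrt (\<epsilon> / \<rho>)) \<le> b"
  proof (cases b)
    case (real c)
    have "\<epsilon> \<le> c\<^sup>2 * \<rho>" using eps(3) by (simp add: real power2_eq_square)
    then have "\<epsilon> / \<rho> \<le> c\<^sup>2" using A3(2) by (simp add: pos_divide_le_eq)
    moreover have "0 < c" using b_pos by (simp add: real)
    ultimately show ?thesis by (simp add: real real_le_lsqrt)
  qed (use b_pos in auto)
  interpret prgd_randomized M f R l \<rho> \<epsilon> \<delta> chi x0 fstar \<beta> b N P F X t \<xi> T
  proof unfold_locales
    show "tonorm M x (\<lambda>v. pullback_Hess M R f x s v - pullback_Hess M R f x 0 v) \<le> \<rho> * tnorm M x s"
      if "ereal (tnorm M x s) \<le> b" for x s
      using A3(3) that by (simp add: b)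
    show "prgd_run M R f x0 (1 / l) (\<epsilon> / (400 * chi ^ 3)) N \<epsilon> T b P F X t \<xi>"
      using run by (simp only: eta r)
    show "sqrt (\<rho> * \<epsilon>) \<le> l" using L_large l_range(1) by linarith
  qed (use manifold C2 retr A1 A3(2) eps(1,2) delta eps_gap chi_large(2) b_pos b_ge l_lipschitz A4 N T in \<open>auto simp: Suc_le_eq\<close>)
  \<comment> \<open>The inequality between \<open>N\<close> and \<open>T\<close> is taken from some
    trajectory, so one outcome has to exist.\<close>
  obtain \<omega>0 where \<omega>0: "\<omega>0 \<in> space P" using not_empty by blast
  have "2 \<le> card (V \<omega>)" "\<exists>K. T < real (t K \<omega>)" "real (t k \<omega>) \<le> T + real N" if "\<omega> \<in> space P" for \<omega> k
    using prgd_trajectory.card_V_ge[OF trajectory[OF that]] prgd_trajectory.stop_exists[OF trajectory[OF that]]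
      prgd_trajectory.t_bound[OF trajectory[OF that]] by auto
  moreover have "T + real N \<le> 2 * T" using prgd_trajectory.T_ge(1)[OF trajectory[OF \<omega>0]] by linarith
  moreover have "1 - \<delta> \<le> prob (good_event 4)" by (rule good_event_prob) simp
  moreover have "1 - \<delta> \<le> prob (good_event 1)" if "\<beta> = 0" by (rule good_event_prob) (simp add: that)
  ultimately show ?thesis
    using horizon_order by (simp add: Let_def)
qed

end
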